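(* Let $G$ be a semisimple algebraic group with $\dim G>0$. Then there is no rational linear étale representation of $G$.
   Context: All groups are linear algebraic groups over $\mathbb{C}$. A rational linear étale representation of $G$ is a rational representation $\varrho:G\to\mathrm{GL}(V)$ on a finite-dimensional complex vector space $V$ such that $G$ has a Zariski-open orbit in $V$ and $\dim G=\dim V$. *)

theory Defs
  imports "HOL-Analysis.Analysis" "HOL-Algebra.Solvable_Groups" "HOL-Library.Extended_Nat"
begin

section \<open>The Zariski topology of a complex vector space\<close>

text \<open>
  Complex vector spaces are given by their scalar multiplication \<open>s\<close>, as in
  \<^theory>\<open>HOL.Vector_Spaces\<close>. The polynomial functions form the subalgebra of all
  complex-valued functions that is generated by the linear forms. For a finite-dimensional
  space these are the polynomials in the coordinates with respect to any basis.
\<close>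

inductive_set poly_fun :: "(complex \<Rightarrow> 'v::ab_group_add \<Rightarrow> 'v) \<Rightarrow> ('v \<Rightarrow> complex) set"
  for s :: "complex \<Rightarrow> 'v \<Rightarrow> 'v"
where
  const: "(\<lambda>_. c) \<in> poly_fun s"
| linear_form: "Vector_Spaces.linear s (*) f \<Longrightarrow> f \<in> poly_fun s"
| add: "f \<in> poly_fun s \<Longrightarrow> g \<in> poly_fun s \<Longrightarrow> (\<lambda>x. f x + g x) \<in> poly_fun s"
| mult: "f \<in> poly_fun s \<Longrightarrow> g \<in> poly_fun s \<Longrightarrow> (\<lambda>x. f x * g x) \<in> poly_fun s"

definition zariski :: "(complex \<Rightarrow> 'v::ab_group_add \<Rightarrow> 'v) \<Rightarrow> 'v topology" where
  "zariski s = topology (\<lambda>U. \<exists>F \<subseteq> poly_fun s. - U = {x. \<forall>f\<in>F. f x = 0})"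

lemma openin_zariski:
  "openin (zariski s) U \<longleftrightarrow> (\<exists>F \<subseteq> poly_fun s. - U = {x. \<forall>f\<in>F. f x = 0})"
proof -
  let ?L = "\<lambda>U. \<exists>F \<subseteq> poly_fun s. - U = {x. \<forall>f\<in>F. f x = 0}"
  have "?L (S \<inter> T)" if "?L S" "?L T" for S T
  proof -
    obtain F where F: "F \<subseteq> poly_fun s" "- S = {x. \<forall>f\<in>F. f x = 0}" using \<open>?L S\<close> by blast
    obtain H where H: "H \<subseteq> poly_fun s" "- T = {x. \<forall>f\<in>H. f x = 0}" using \<open>?L T\<close> by blast
    let ?P = "{(\<lambda>x. f x * h x) | f h. f \<in> F \<and> h \<in> H}"
    have "?P \<subseteq> poly_fun s" using F(1) H(1) by (auto intro: poly_fun.mult)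
    moreover have "- (S \<inter> T) = {x. \<forall>f\<in>?P. f x = 0}"
      unfolding Compl_Int F(2) H(2) by (auto; metis mult_eq_0_iff)
    ultimately show ?thesis by blast
  qed
  moreover have "?L (\<Union>K)" if "\<forall>U\<in>K. ?L U" for K
  proof -
    from that obtain F where F: "\<forall>U\<in>K. F U \<subseteq> poly_fun s \<and> - U = {x. \<forall>f\<in>F U. f x = 0}"
      unfolding bchoice_iff ..
    have "- \<Union>K = (\<Inter>U\<in>K. - U) \<inter> UNIV"
      by auto
    also have "(\<Inter>U\<in>K. - U) = (\<Inter>U\<in>K. {x. \<forall>f\<in>F U. f x = 0})"
      using F by (intro INF_cong) auto
    finally have "- \<Union>K = {x. \<forall>f\<in>\<Union>(F ` K). f x = 0}"
      by auto
    moreover have "\<Union>(F ` K) \<subseteq> poly_fun s" using F by auto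
    ultimately show ?thesis by (intro exI[of _ "\<Union>(F ` K)"] conjI)
  qed
  ultimately have "istopology ?L" unfolding istopology_def by simp
  then show ?thesis by (simp add: zariski_def topology_inverse')
qed

lemma topspace_zariski [simp]: "topspace (zariski s) = UNIV"
proof -
  have "openin (zariski s) UNIV"
    unfolding openin_zariski
    by (rule exI[of _ "{\<lambda>_. 1}"]) (auto intro: poly_fun.const)
  then show ?thesis using openin_subset by blast
qed


section \<open>Krull dimension of a topological space\<close>

definition irreducible_in :: "'a topology \<Rightarrow> 'a set \<Rightarrow> bool" where
  "irreducible_in X Z \<longleftrightarrow> Z \<subseteq> topspace X \<and> Z \<noteq> {} \<and>
     (\<forall>A B. closedin X A \<longrightarrow> closedin X B \<longrightarrow> Z \<subseteq> A \<union> B \<longrightarrow> Z \<subseteq> A \<or> Z \<subseteq> B)"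

text \<open>The empty space gets dimension \<open>0\<close> here; it does not occur as the space of a group.\<close>

definition krull_dim :: "'a topology \<Rightarrow> enat" where
  "krull_dim X = Sup {enat n | n. \<exists>Z :: nat \<Rightarrow> 'a set.
     (\<forall>i\<le>n. closedin X (Z i) \<and> irreducible_in X (Z i)) \<and> (\<forall>i<n. Z i \<subset> Z (Suc i))}"


section \<open>Linear algebraic groups\<close>

definition mscale :: "complex \<Rightarrow> complex^'n^'n \<Rightarrow> complex^'n^'n" where
  "mscale c A = (\<chi> i j. c * A $ i $ j)"

lemma vector_space_mscale: "vector_space mscale"
  by unfold_locales (auto simp: mscale_def vec_eq_iff algebra_simps)

definition GL :: "(complex^'n^'n) monoid" where
  "GL = \<lparr>carrier = {A. invertible A}, mult = (**), one = mat 1\<rparr>"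

lemma group_GL: "group (GL :: (complex^'n^'n) monoid)"
proof (rule groupI)
  fix A :: "complex^'n^'n"
  assume "A \<in> carrier GL"
  then obtain B where "A ** B = mat 1" "B ** A = mat 1"
    by (auto simp: GL_def invertible_def)
  then show "\<exists>B\<in>carrier GL. B \<otimes>\<^bsub>GL\<^esub> A = \<one>\<^bsub>GL\<^esub>"
    by (auto simp: GL_def invertible_def)
qed (auto simp: GL_def invertible_mult matrix_mul_assoc invertible_def[of "mat 1"])

text \<open>The topology on \<open>GL\<close> is the one induced from the space of all matrices. It is the Zariski
  topology of the affine variety \<open>GL\<close>, since \<open>GL\<close> is a principal open subset of that space.\<close>

definition linear_algebraic_group :: "(complex^'n^'n) set \<Rightarrow> bool" where
  "linear_algebraic_group G \<longleftrightarrow>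
     subgroup G GL \<and> closedin (subtopology (zariski mscale) (carrier GL)) G"

definition group_dim :: "(complex^'n^'n) set \<Rightarrow> enat" where
  "group_dim G = krull_dim (subtopology (zariski mscale) G)"

text \<open>The radical is the largest closed connected solvable normal subgroup. It is written here as
  the union of all such subgroups; as a product of two of them is again one, and dimensions are
  bounded, this union is the largest one. A group need not be connected to be semisimple;
  connected semisimple groups are included.\<close>

definition radical :: "(complex^'n^'n) set \<Rightarrow> (complex^'n^'n) set" where
  "radical G = \<Union>{H. H \<lhd> GL\<lparr>carrier := G\<rparr> \<and>
     closedin (subtopology (zariski mscale) G) H \<and>
     connectedin (zariski mscale) H \<and>
     solvable (GL\<lparr>carrier := H\<rparr>)}"

definition semisimple_algebraic_group :: "(complex^'n^'n) set \<Rightarrow> bool" where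
  "semisimple_algebraic_group G \<longleftrightarrow> linear_algebraic_group G \<and> radical G = {mat 1}"


section \<open>Rational representations\<close>

text \<open>The coordinate ring of \<open>GL\<close> is generated by the matrix entries and the inverse of the
  determinant; regular functions on a closed subgroup are the restrictions to it.\<close>

definition regular_fun :: "(complex^'n^'n) set \<Rightarrow> (complex^'n^'n \<Rightarrow> complex) \<Rightarrow> bool" where
  "regular_fun G f \<longleftrightarrow> (\<exists>p\<in>poly_fun mscale. \<exists>k::nat. \<forall>g\<in>G. f g = p g / det g ^ k)"

definition GL_space :: "(complex \<Rightarrow> 'v::ab_group_add \<Rightarrow> 'v) \<Rightarrow> ('v \<Rightarrow> 'v) monoid" where
  "GL_space s = \<lparr>carrier = {T. Vector_Spaces.linear s s T \<and> bij T}, mult = (\<circ>), one = id\<rparr>"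

text \<open>A homomorphism to \<open>GL(V)\<close> is a morphism of varieties iff all its matrix coefficients are
  regular functions.\<close>

definition rational_representation ::
  "(complex \<Rightarrow> 'v::ab_group_add \<Rightarrow> 'v) \<Rightarrow> (complex^'n^'n) set \<Rightarrow> (complex^'n^'n \<Rightarrow> 'v \<Rightarrow> 'v) \<Rightarrow> bool"
where
  "rational_representation s G \<rho> \<longleftrightarrow>
     (\<exists>B. finite_dimensional_vector_space s B) \<and>
     \<rho> \<in> hom (GL\<lparr>carrier := G\<rparr>) (GL_space s) \<and>
     (\<forall>v f. Vector_Spaces.linear s (*) f \<longrightarrow> regular_fun G (\<lambda>g. f (\<rho> g v)))"

definition etale_representation ::
  "(complex \<Rightarrow> 'v::ab_group_add \<Rightarrow> 'v) \<Rightarrow> (complex^'n^'n) set \<Rightarrow> (complex^'n^'n \<Rightarrow> 'v \<Rightarrow> 'v) \<Rightarrow> bool"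
where
  "etale_representation s G \<rho> \<longleftrightarrow>
     rational_representation s G \<rho> \<and>
     (\<exists>v. openin (zariski s) ((\<lambda>g. \<rho> g v) ` G)) \<and>
     group_dim G = enat (vector_space.dim s UNIV)"

end

theory Submission
  imports Defs "HOL-Complex_Analysis.Complex_Analysis"
    "HOL-Computational_Algebra.Fundamental_Theorem_Algebra"
begin

text \<open>
  The group \<open>G\<close> is studied through its Lie algebra \<open>lie\<close>, the set of all matrices \<open>X\<close> such that
  \<open>exp (t X)\<close> lies in \<open>G\<close> for all complex \<open>t\<close>. The contradiction is a trace computation. For an
  etale representation on \<open>V\<close> with open orbit through \<open>v\<close>, the evaluation map
  \<open>X \<mapsto> X v\<close> is a linear isomorphism from \<open>lie\<close> to \<open>V\<close>. Use it to carry the adjoint representation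
  over to \<open>V\<close>, and let \<open>E\<close> be the element with \<open>E v = v\<close>. If \<open>X\<close> corresponds to \<open>u = X v\<close>, then
  \<open>[E, X]\<close> corresponds to \<open>E X v - X E v = E u - u\<close>. Hence the action of \<open>E\<close> on \<open>V\<close> and its adjoint
  action differ by the identity of \<open>V\<close>, and the difference of their traces is \<open>dim V\<close>. But the trace
  of either representation vanishes on brackets, and the Lie algebra of a semisimple group is spanned
  by brackets (\<open>lie_perfect\<close>). So \<open>dim V = 0\<close>, against \<open>dim G > 0\<close> (\<open>no_etale\<close>).

  Three facts carry this argument.

  \<^emph>\<open>The Lie algebra is perfect.\<close> Every nonzero abelian ideal of \<open>lie\<close> that is stable under
  conjugation by \<open>G\<close> exponentiates to a nontrivial closed connected abelian normal subgroup
  (\<open>abelian_ideal_trivial\<close>); a trivial radical excludes this. Consider the trace form \<open>tr (x y)\<close> on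
  \<open>lie\<close>. If \<open>x\<close> has eigenvalues \<open>\<mu>\<close> with spectral projections \<open>P \<mu>\<close>, then
  \<open>\<Sum>\<mu>. cnj \<mu> P \<mu>\<close> also lies in \<open>lie\<close>, because polynomial equations that hold along \<open>exp (t x)\<close> are
  identities between exponential polynomials and survive the conjugation of the exponents
  (\<open>conjugate_semisimple_part_in_lie\<close>). The pairing with \<open>x\<close> is \<open>\<Sum>\<mu>. |\<mu>|\<^sup>2 dim (P \<mu>)\<close>, so the radical of
  the trace form consists of nilpotent matrices. By Engel's theorem it is zero or has a nonzero
  centre, and the centre would be an abelian ideal. So the trace form is nondegenerate. If brackets did
  not span \<open>lie\<close>, some \<open>z \<noteq> 0\<close> would be orthogonal to all of them; then \<open>[z, x]\<close> is orthogonal to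
  \<open>lie\<close>, hence zero, and \<open>z\<close> would be central, again an abelian ideal.

  \<^emph>\<open>The evaluation map is onto\<close> (\<open>open_orbit_tangent\<close>). Otherwise the orbit is a countable union of
  differentiable images of a space of smaller dimension than \<open>V\<close>; such a union is a null set and
  contains no nonempty Zariski-open set. The covering uses that elements of \<open>G\<close> close to the identity
  are products \<open>exp X exp Y\<close> with \<open>Y\<close> annihilating \<open>v\<close> (\<open>group_chart\<close>).

  \<^emph>\<open>The evaluation map is injective.\<close> Otherwise \<open>lie\<close> would contain more than \<open>dim V = dim G\<close>
  independent elements, but the Krull dimension of \<open>G\<close> is at least the dimension of \<open>lie\<close>
  (\<open>lie_dim_le_group_dim\<close>): slices of a holomorphic chart of \<open>G\<close> have irreducible Zariski closures that
  form a strict chain.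
\<close>

section \<open>Complex matrices as a Euclidean algebra\<close>

text \<open>
  A type of its own for square matrices turns \<open>*\<close> into the matrix product (on \<open>complex^'n^'n\<close> it is the
  entrywise one) and makes ring notation, powers and products of lists available. With the Frobenius norm
  the type is also a Euclidean space, so that compactness of spheres, real dimensions and
  the open mapping theorem apply to it.
\<close>

typedef (overloaded) 'n cmat = "UNIV :: (complex^'n^'n) set"
  morphisms raw cmat by simp

lemma raw_cmat [simp]: "raw (cmat A) = A"
  by (simp add: cmat_inverse)

lemma cmat_raw [simp]: "cmat (raw X) = X"
  by (rule raw_inverse)

lemma cmat_eq_iff: "X = Y \<longleftrightarrow> raw X = raw Y"
  by (simp add: raw_inject)

instantiation cmat :: (finite) ring_1
begin
definition zero_cmat where "0 = cmat 0"
definition one_cmat where "1 = cmat (mat 1)"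
definition plus_cmat where "X + Y = cmat (raw X + raw Y)"
definition minus_cmat where "X - Y = cmat (raw X - raw Y)"
definition uminus_cmat where "- X = cmat (- raw X)"
definition times_cmat where "X * Y = cmat (raw X ** raw Y)"
instance
proof
  fix X Y Z :: "'a cmat"
  show "X * Y * Z = X * (Y * Z)"
    by (simp add: times_cmat_def matrix_mul_assoc)
  show "(X + Y) * Z = X * Z + Y * Z" "X * (Y + Z) = X * Y + X * Z"
    by (simp_all add: times_cmat_def plus_cmat_def matrix_matrix_mult_def vec_eq_iff cmat_eq_iff
      sum.distrib algebra_simps)
next
  have "(0::complex^'a^'a) \<noteq> mat 1"
    by (auto simp: vec_eq_iff mat_def)
  then show "(0::'a cmat) \<noteq> 1"
    by (simp add: zero_cmat_def one_cmat_def cmat_eq_iff)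
qed (auto simp: zero_cmat_def one_cmat_def plus_cmat_def minus_cmat_def uminus_cmat_def times_cmat_def
    cmat_eq_iff)
end

lemma raw_simps [simp]:
  "raw 0 = 0" "raw 1 = mat 1" "raw (X + Y) = raw X + raw Y" "raw (X - Y) = raw X - raw Y"
  "raw (- X) = - raw X" "raw (X * Y) = raw X ** raw Y"
  by (simp_all add: zero_cmat_def one_cmat_def plus_cmat_def minus_cmat_def uminus_cmat_def times_cmat_def)

text \<open>
  Each row of \<open>A ** B\<close> is a combination of the rows of \<open>B\<close>; the Cauchy-Schwarz inequality bounds it.
\<close>

lemma norm_matrix_matrix_mult_le:
  fixes A B :: "complex^'n^'n"
  shows "norm (A ** B) \<le> norm A * norm B"
proof -
  have row: "norm ((A ** B) $ i) \<le> norm (A $ i) * norm B" for i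
  proof -
    have "(A ** B) $ i = (\<Sum>k\<in>UNIV. (A $ i $ k) *s (B $ k))"
      by (simp add: vec_eq_iff matrix_matrix_mult_def)
    also have "norm \<dots> \<le> (\<Sum>k\<in>UNIV. norm ((A $ i $ k) *s (B $ k)))"
      by (rule norm_sum)
    also have "\<dots> = (\<Sum>k\<in>UNIV. norm (A $ i $ k) * norm (B $ k))"
    proof (intro sum.cong refl)
      fix k
      have "norm (c *s v) = norm c * norm v" for c :: complex and v :: "complex^'n"
        by (simp add: norm_vec_def norm_mult L2_set_right_distrib)
      then show "norm ((A $ i $ k) *s (B $ k)) = norm (A $ i $ k) * norm (B $ k)" .
    qed
    also have "\<dots> \<le> L2_set (\<lambda>k. norm (A $ i $ k)) UNIV * L2_set (\<lambda>k. norm (B $ k)) UNIV"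
      using L2_set_mult_ineq[of "\<lambda>k. norm (A $ i $ k)" "\<lambda>k. norm (B $ k)" UNIV] by simp
    finally show ?thesis by (simp add: norm_vec_def)
  qed
  have "norm (A ** B) = L2_set (\<lambda>i. norm ((A ** B) $ i)) UNIV"
    by (simp only: norm_vec_def)
  also have "\<dots> \<le> L2_set (\<lambda>i. norm (A $ i) * norm B) UNIV"
    by (rule L2_set_mono) (use row in auto)
  also have "\<dots> = L2_set (\<lambda>i. norm (A $ i)) UNIV * norm B"
    by (subst L2_set_left_distrib) auto
  also have "\<dots> = norm A * norm B" by (simp add: norm_vec_def)
  finally show ?thesis .
qed

instantiation cmat :: (finite) real_normed_algebra
begin
definition scaleR_cmat where "r *\<^sub>R X = cmat (r *\<^sub>R raw X)"
definition norm_cmat where "norm X = norm (raw X)"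
definition dist_cmat where "dist X Y = norm (X - Y)" for X Y :: "'a cmat"
definition sgn_cmat where "sgn X = inverse (norm X) *\<^sub>R X" for X :: "'a cmat"
definition uniformity_cmat :: "('a cmat \<times> 'a cmat) filter"
  where "uniformity_cmat = (INF e\<in>{0<..}. principal {(x, y). dist x y < e})"
definition open_cmat :: "'a cmat set \<Rightarrow> bool"
  where "open_cmat U = (\<forall>x\<in>U. eventually (\<lambda>(x', y). x' = x \<longrightarrow> y \<in> U) uniformity)"
instance
proof
  fix X Y :: "'a cmat" and r :: real
  show "norm (X + Y) \<le> norm X + norm Y"
    by (simp add: norm_cmat_def norm_triangle_ineq)
  show "norm (X * Y) \<le> norm X * norm Y"
    by (simp add: norm_cmat_def norm_matrix_matrix_mult_le)
  show "r *\<^sub>R X * Y = r *\<^sub>R (X * Y)" "X * r *\<^sub>R Y = r *\<^sub>R (X * Y)"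
    by (simp_all add: scaleR_cmat_def times_cmat_def matrix_matrix_mult_def vec_eq_iff scaleR_sum_right
        cmat_eq_iff)
qed (auto simp: scaleR_cmat_def norm_cmat_def dist_cmat_def sgn_cmat_def uniformity_cmat_def
    open_cmat_def cmat_eq_iff scaleR_add_right scaleR_add_left)
end

lemma raw_scaleR [simp]: "raw (r *\<^sub>R X) = r *\<^sub>R raw X"
  by (simp add: scaleR_cmat_def)

instantiation cmat :: (finite) euclidean_space
begin
definition inner_cmat where "inner X Y = inner (raw X) (raw Y)"
definition Basis_cmat :: "'a cmat set" where "Basis = cmat ` Basis"
instance
proof
  fix x y z :: "'a cmat" and r :: real
  show "inner x y = inner y x" "inner (x + y) z = inner x z + inner y z"
    "inner (r *\<^sub>R x) y = r * inner x y" "0 \<le> inner x x" "(inner x x = 0) = (x = 0)"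
    "norm x = sqrt (inner x x)"
    by (simp_all add: inner_cmat_def norm_cmat_def cmat_eq_iff inner_add_left
      norm_eq_sqrt_inner inner_commute[of "raw x" "raw y"])
  show "(Basis :: 'a cmat set) \<noteq> {}" "finite (Basis :: 'a cmat set)"
    by (simp_all add: Basis_cmat_def)
  show "inner u v = (if u = v then 1 else 0)" if "u \<in> Basis" "v \<in> Basis" for u v :: "'a cmat"
    using that by (auto simp: Basis_cmat_def inner_cmat_def inner_Basis cmat_eq_iff)
  show "(\<forall>u\<in>Basis. inner x u = 0) \<longleftrightarrow> x = 0"
    by (simp add: Basis_cmat_def inner_cmat_def cmat_eq_iff euclidean_all_zero_iff)
qed
end

text \<open>
  Scalar matrices are central, so multiplication by \<open>sc t\<close> serves as complex scalar multiplication, and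
  complex linearity of a real-linear map \<open>D\<close> is the equation \<open>D (sc t * H) = sc t * D H\<close>.
\<close>

definition sc :: "complex \<Rightarrow> 'n::finite cmat" where
  "sc t = cmat (mat t)"

lemma mat_mul_mscale: "mat t ** A = mscale t A"
  by (simp add: vec_eq_iff matrix_matrix_mult_def mat_def mscale_def if_distrib[of "\<lambda>x. x * _"]
      sum.If_cases cong: if_cong)

lemma raw_sc_mult [simp]: "raw (sc t * X) = mscale t (raw X)"
  by (simp add: sc_def mat_mul_mscale)

lemma sc_commute: "X * sc t = sc t * X"
proof -
  have "raw X ** mat t = mscale t (raw X)"
    by (simp add: vec_eq_iff matrix_matrix_mult_def mat_def mscale_def if_distrib[of "\<lambda>x. _ * x"]
      sum.If_cases mult.commute cong: if_cong)
  then show ?thesis by (simp add: cmat_eq_iff del: raw_simps(6) raw_sc_mult) (simp add: sc_def mat_mul_mscale)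
qed

lemma sc_left_commute: "X * (sc t * Y) = sc t * (X * Y)"
  by (metis mult.assoc sc_commute)

lemma sc_simps [simp]: "sc 0 = 0" "sc 1 = 1"
  by (auto simp: sc_def cmat_eq_iff mat_def vec_eq_iff)

lemma sc_add: "sc (s + t) = sc s + sc t" and sc_mult: "sc (s * t) = sc s * sc t"
  and sc_minus: "sc (- t) = - sc t" and sc_diff: "sc (s - t) = sc s - sc t"
  by (auto simp: sc_def cmat_eq_iff mat_def vec_eq_iff mat_mul_mscale[unfolded mat_def] mscale_def)

lemma sc_of_real: "sc (of_real r) * X = r *\<^sub>R X"
proof -
  have "of_real r * z = r *\<^sub>R z" for z :: complex
    by (simp add: scaleR_conv_of_real)
  then show ?thesis
    by (simp add: cmat_eq_iff mscale_def vec_eq_iff del: raw_simps(6))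
qed

lemma linear_sc: "linear sc"
proof
  show "sc (r *\<^sub>R t) = r *\<^sub>R sc t" for r t
    by (simp add: scaleR_conv_of_real sc_mult sc_of_real)
qed (simp add: sc_add)

lemma bounded_linear_sc: "bounded_linear sc"
  using linear_sc by (simp add: linear_conv_bounded_linear)

lemma norm_sc_mult: "norm (sc t * X) = norm t * norm X"
  by (simp add: norm_cmat_def mscale_def norm_vec_def norm_mult L2_set_right_distrib del: raw_simps(6))

section \<open>The matrix exponential\<close>

text \<open>
  The identity has Frobenius norm \<open>sqrt n\<close>, which is why the factor \<open>norm 1\<close> enters all estimates.
\<close>

lemma norm_cmat_power:
  fixes X :: "'n::finite cmat"
  shows "norm (X ^ n) \<le> norm (1 :: 'n cmat) * norm X ^ n"
proof (induct n)
  case (Suc n)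
  have "norm (X ^ Suc n) \<le> norm X * norm (X ^ n)"
    by (simp add: norm_mult_ineq)
  also have "\<dots> \<le> norm X * (norm (1 :: 'n cmat) * norm X ^ n)"
    by (rule mult_left_mono) (use Suc in auto)
  finally show ?case by (simp add: mult_ac)
qed simp

definition mexp :: "'n::finite cmat \<Rightarrow> 'n cmat" where
  "mexp X = (\<Sum>n. X ^ n /\<^sub>R fact n)"

lemma summable_norm_mexp:
  fixes X :: "'n::finite cmat"
  shows "summable (\<lambda>n. norm (X ^ n /\<^sub>R fact n))"
proof (rule summable_comparison_test')
  show "summable (\<lambda>n. norm (1 :: 'n cmat) * (inverse (fact n) * norm X ^ n))"
    by (intro summable_mult summable_exp)
  show "norm (norm (X ^ n /\<^sub>R fact n)) \<le> norm (1 :: 'n cmat) * (inverse (fact n) * norm X ^ n)"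
    if "n \<ge> 0" for n
    using mult_left_mono[OF norm_cmat_power[of X n], of "inverse (fact n)"] by (simp add: mult_ac)
qed

lemma mexp_sums: "(\<lambda>n. X ^ n /\<^sub>R fact n) sums mexp X"
  unfolding mexp_def by (rule summable_sums[OF summable_norm_cancel[OF summable_norm_mexp]])

lemma mexp_0 [simp]: "mexp 0 = 1"
proof -
  have "(\<lambda>n. (0::'a cmat) ^ n /\<^sub>R fact n) sums (\<Sum>n\<in>{0}. 0 ^ n /\<^sub>R fact n)"
    by (rule sums_finite) (auto simp: zero_power)
  from sums_unique2[OF mexp_sums this] show ?thesis by simp
qed

text \<open>
  Writing \<open>S Z n\<close> for the \<open>n\<close>-th term of the series, both sides satisfy the recursion
  \<open>(n + 1) S (X + Y) (n + 1) = (X + Y) S (X + Y) n\<close>.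
\<close>

lemma mexp_term_add:
  fixes X Y :: "'n::finite cmat"
  assumes comm: "X * Y = Y * X"
  shows "(X + Y) ^ n /\<^sub>R fact n = (\<Sum>i\<le>n. (X ^ i /\<^sub>R fact i) * (Y ^ (n - i) /\<^sub>R fact (n - i)))"
proof (induct n)
  case (Suc n)
  define S where "S Z n = Z ^ n /\<^sub>R fact n" for Z :: "'n cmat" and n
  have step: "Z * S Z n = real (Suc n) *\<^sub>R S Z (Suc n)" for Z n
  proof -
    have "real (Suc n) * inverse (fact (Suc n)) = inverse (fact n :: real)"
      by (simp add: divide_simps del: of_nat_Suc)
    then show ?thesis by (simp only: S_def scaleR_scaleR mult_scaleR_right power_Suc)
  qed
  have comm': "Y * S X i = S X i * Y" for i
    using power_commuting_commutes[OF comm, of i] by (simp add: S_def)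
  have IH: "S (X + Y) n = (\<Sum>i\<le>n. S X i * S Y (n - i))"
    using Suc by (simp add: S_def)
  have "real (Suc n) *\<^sub>R S (X + Y) (Suc n) = (X + Y) * (\<Sum>i\<le>n. S X i * S Y (n - i))"
    by (simp only: step[symmetric] IH)
  also have "\<dots> = (\<Sum>i\<le>n. (X * S X i) * S Y (n - i)) + (\<Sum>i\<le>n. S X i * (Y * S Y (n - i)))"
    by (simp only: distrib_right sum_distrib_left mult.assoc[symmetric] comm' sum.distrib)
  also have "(\<Sum>i\<le>n. (X * S X i) * S Y (n - i)) = (\<Sum>i\<le>n. real (Suc i) *\<^sub>R (S X (Suc i) * S Y (Suc n - Suc i)))"
    by (simp only: step mult_scaleR_left diff_Suc_Suc)
  also have "\<dots> = (\<Sum>i\<le>Suc n. real i *\<^sub>R (S X i * S Y (Suc n - i)))"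
    by (subst sum.atMost_Suc_shift) simp
  also have "(\<Sum>i\<le>n. S X i * (Y * S Y (n - i))) = (\<Sum>i\<le>n. real (Suc n - i) *\<^sub>R (S X i * S Y (Suc n - i)))"
    by (intro sum.cong refl) (simp add: step Suc_diff_le)
  also have "\<dots> = (\<Sum>i\<le>Suc n. real (Suc n - i) *\<^sub>R (S X i * S Y (Suc n - i)))"
    by simp
  also have "(\<Sum>i\<le>Suc n. real i *\<^sub>R (S X i * S Y (Suc n - i))) + \<dots>
      = (\<Sum>i\<le>Suc n. real (Suc n) *\<^sub>R (S X i * S Y (Suc n - i)))"
    unfolding sum.distrib[symmetric]
    by (intro sum.cong refl) (simp add: scaleR_add_left[symmetric] of_nat_diff)
  also have "\<dots> = real (Suc n) *\<^sub>R (\<Sum>i\<le>Suc n. S X i * S Y (Suc n - i))"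
    by (simp only: scaleR_sum_right)
  finally have "S (X + Y) (Suc n) = (\<Sum>i\<le>Suc n. S X i * S Y (Suc n - i))"
    by (simp only: scaleR_cancel_left) (simp del: of_nat_Suc)
  then show ?case by (simp only: S_def)
qed simp

lemma mexp_add:
  fixes X Y :: "'n::finite cmat"
  assumes "X * Y = Y * X"
  shows "mexp (X + Y) = mexp X * mexp Y"
  unfolding mexp_def mexp_term_add[OF assms]
  by (rule Cauchy_product[symmetric]) (rule summable_norm_mexp)+

lemma mexp_minus: "mexp X * mexp (- X) = 1" "mexp (- X) * mexp X = 1"
  using mexp_add[of X "- X"] mexp_add[of "- X" X] by auto

lemma mexp_scaleR_nat: "mexp (real n *\<^sub>R X) = mexp X ^ n"
proof (induct n)
  case (Suc n)
  have "mexp (real (Suc n) *\<^sub>R X) = mexp (X + real n *\<^sub>R X)"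
    by (simp add: scaleR_add_left)
  also have "\<dots> = mexp X * mexp (real n *\<^sub>R X)"
    by (rule mexp_add) simp
  finally show ?case by (simp add: Suc)
qed simp

text \<open>
  The powers of the conjugate are the conjugates of the powers, except that for exponent \<open>0\<close> this needs
  \<open>U * V = 1\<close>; for matrices a left inverse is a right inverse.
\<close>

lemma mexp_conj:
  assumes "V * U = 1"
  shows "mexp (U * X * V) = U * mexp X * V"
proof -
  have pow: "(U * X * V) ^ n = U * X ^ n * V" if "n > 0" for n
    using that
  proof (induct n rule: nat_induct_non_zero)
    case (Suc n)
    have "(U * X * V) ^ Suc n = U * X * V * (U * X ^ n * V)"
      by (simp only: power_Suc Suc)
    also have "\<dots> = U * X * (V * U) * (X ^ n * V)"
      by (simp only: mult.assoc)
    finally show ?case by (simp add: assms mult.assoc)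
  qed simp
  have bl: "bounded_linear (\<lambda>Z. U * Z * V)"
    by (intro bounded_linear_mult_const bounded_linear_const_mult bounded_linear_ident)
  have "(\<lambda>n. U * (X ^ n /\<^sub>R fact n) * V) sums (U * mexp X * V)"
    by (rule bounded_linear.sums[OF bl mexp_sums])
  moreover have "(\<lambda>n. (U * X * V) ^ n /\<^sub>R fact n - U * (X ^ n /\<^sub>R fact n) * V) sums
      (\<Sum>n\<in>{0}. (U * X * V) ^ n /\<^sub>R fact n - U * (X ^ n /\<^sub>R fact n) * V)"
    by (rule sums_finite) (auto simp: pow)
  ultimately have "(\<lambda>n. ((U * X * V) ^ n /\<^sub>R fact n - U * (X ^ n /\<^sub>R fact n) * V) + U * (X ^ n /\<^sub>R fact n) * V)
      sums ((\<Sum>n\<in>{0}. (U * X * V) ^ n /\<^sub>R fact n - U * (X ^ n /\<^sub>R fact n) * V) + U * mexp X * V)"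
    by (intro sums_add)
  then have "(\<lambda>n. (U * X * V) ^ n /\<^sub>R fact n) sums (1 - U * V + U * mexp X * V)"
    by simp
  with mexp_sums[of "U * X * V"] have "mexp (U * X * V) = 1 - U * V + U * mexp X * V"
    by (rule sums_unique2)
  moreover have "U * V = 1"
  proof -
    have "raw V ** raw U = mat 1" using arg_cong[OF assms, of raw] by simp
    then have "raw U ** raw V = mat 1" by (simp add: matrix_left_right_inverse)
    then show ?thesis by (simp add: cmat_eq_iff)
  qed
  ultimately show ?thesis by simp
qed

text \<open>
  Differentiating \<open>X ^ n\<close> in the direction \<open>H\<close> replaces each factor in turn by \<open>H\<close>.
\<close>

definition dpow :: "nat \<Rightarrow> 'n::finite cmat \<Rightarrow> 'n cmat \<Rightarrow> 'n cmat" where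
  "dpow n X H = (\<Sum>i<n. X ^ i * H * X ^ (n - 1 - i))"

definition dexp :: "'n::finite cmat \<Rightarrow> 'n cmat \<Rightarrow> 'n cmat" where
  "dexp X H = (\<Sum>n. dpow n X H /\<^sub>R fact n)"

lemma dpow_Suc: "dpow (Suc n) X H = X * dpow n X H + H * X ^ n"
  by (simp add: dpow_def sum.lessThan_Suc_shift sum_distrib_left mult.assoc add.commute del: sum.lessThan_Suc)

lemma has_derivative_cmat_power: "((\<lambda>X. X ^ n) has_derivative dpow n X) (at X within S)"
  for X :: "'n::finite cmat"
proof (induct n)
  case 0
  show ?case by (simp add: dpow_def)
next
  case (Suc n)
  have "((\<lambda>X. X * X ^ n) has_derivative (\<lambda>H. X * dpow n X H + H * X ^ n)) (at X within S)"
    by (rule has_derivative_mult[OF has_derivative_ident Suc])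
  then show ?case by (simp add: dpow_Suc[abs_def])
qed

text \<open>
  Apart from the factor \<open>(norm 1)\<^sup>2 * norm H\<close> this bounds the \<open>n\<close>-th term of \<open>dexp X H\<close> for
  \<open>norm X = r\<close>. It is the term-by-term derivative of the series of \<open>exp r\<close>, with sum \<open>exp r\<close> again.
\<close>

definition ebound :: "nat \<Rightarrow> real \<Rightarrow> real" where
  "ebound n r = real n * r ^ (n - 1) / fact n"

lemma ebound_Suc: "ebound (Suc n) r = inverse (fact n) * r ^ n"
  by (simp add: ebound_def divide_simps del: of_nat_Suc)

lemma ebound_sums: "(\<lambda>n. ebound n r) sums exp r"
proof -
  have "(\<lambda>n. ebound (Suc n) r) sums exp r"
    using exp_converges[of r] by (simp add: ebound_Suc mult.commute)
  then show ?thesis by (subst (asm) sums_Suc_iff) (simp add: ebound_def)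
qed

lemma ebound_mono: "0 \<le> r \<Longrightarrow> r \<le> r' \<Longrightarrow> ebound n r \<le> ebound n r'"
  by (simp add: ebound_def divide_right_mono mult_left_mono power_mono)

lemma norm_dpow_le:
  fixes X :: "'n::finite cmat"
  shows "norm (dpow n X H /\<^sub>R fact n) \<le> (norm (1::'n cmat))\<^sup>2 * norm H * ebound n (norm X)"
proof -
  let ?c = "norm (1::'n cmat)"
  have "norm (X ^ i * H * X ^ (n - 1 - i)) \<le> ?c\<^sup>2 * norm H * norm X ^ (n - 1)" if "i < n" for i
  proof -
    have "norm (X ^ i * H * X ^ (n - 1 - i)) \<le> norm (X ^ i) * norm H * norm (X ^ (n - 1 - i))"
      by (meson mult_right_mono norm_ge_zero norm_mult_ineq order_trans)
    also have "\<dots> \<le> (?c * norm X ^ i) * norm H * (?c * norm X ^ (n - 1 - i))"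
      by (intro mult_mono norm_cmat_power) auto
    also have "\<dots> = ?c\<^sup>2 * norm H * (norm X ^ i * norm X ^ (n - 1 - i))"
      by (simp add: power2_eq_square mult_ac)
    also have "norm X ^ i * norm X ^ (n - 1 - i) = norm X ^ (n - 1)"
      using that by (simp add: power_add[symmetric])
    finally show ?thesis .
  qed
  then have "norm (dpow n X H) \<le> (\<Sum>i<n. ?c\<^sup>2 * norm H * norm X ^ (n - 1))"
    unfolding dpow_def by (intro sum_norm_le) auto
  then have "norm (dpow n X H) \<le> ?c\<^sup>2 * norm H * (real n * norm X ^ (n - 1))"
    by (simp add: mult_ac)
  then have "norm (dpow n X H) / fact n \<le> ?c\<^sup>2 * norm H * (real n * norm X ^ (n - 1)) / fact n"
    by (rule divide_right_mono) simp
  then show ?thesis by (simp add: ebound_def divide_inverse mult_ac)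
qed

lemma summable_ebound_mult: "summable (\<lambda>n. c * ebound n r)"
  by (intro summable_mult sums_summable[OF ebound_sums])

lemma summable_dpow: "summable (\<lambda>n. dpow n X H /\<^sub>R fact n)"
  by (rule summable_comparison_test'[OF summable_ebound_mult norm_dpow_le])

lemma dexp_sc: "dexp X (sc t * H) = sc t * dexp X H"
proof -
  have "dpow n X (sc t * H) = sc t * dpow n X H" for n
    unfolding dpow_def sum_distrib_left
    by (intro sum.cong refl) (simp only: mult.assoc sc_left_commute[of _ t])
  moreover have "(\<Sum>n. sc t * (dpow n X H /\<^sub>R fact n)) = sc t * dexp X H"
    unfolding dexp_def
    by (rule bounded_linear.suminf[OF bounded_linear_mult_right summable_dpow, symmetric])
  ultimately show ?thesis by (simp add: dexp_def)
qed

text \<open>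
  Term-by-term differentiation is allowed because on the ball of radius \<open>r\<close> the tails of the series of
  derivatives are bounded by the tails of \<open>ebound\<close>, uniformly in the base point.
\<close>

lemma has_derivative_mexp:
  fixes X :: "'n::finite cmat"
  shows "(mexp has_derivative dexp X) (at X)"
proof -
  define r where "r = norm X + 1"
  define c where "c = (norm (1::'n cmat))\<^sup>2"
  let ?S = "ball (0::'n cmat) r"
  have "\<exists>g. \<forall>x\<in>?S. (\<lambda>n. x ^ n /\<^sub>R fact n) sums (g x) \<and> (g has_derivative dexp x) (at x within ?S)"
  proof (rule has_derivative_series[where f' = "\<lambda>n x h. dpow n x h /\<^sub>R fact n"])
    show "((\<lambda>X. X ^ n /\<^sub>R fact n) has_derivative (\<lambda>h. dpow n x h /\<^sub>R fact n)) (at x within ?S)" for n x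
      by (rule has_derivative_scaleR_right[OF has_derivative_cmat_power])
    show "X \<in> ?S" by (simp add: r_def)
    show "(\<lambda>n. X ^ n /\<^sub>R fact n) sums mexp X" by (rule mexp_sums)
    fix e :: real assume "e > 0"
    have "(\<lambda>n. c * (exp r - (\<Sum>i<n. ebound i r))) \<longlonglongrightarrow> c * (exp r - exp r)"
      using ebound_sums[of r] unfolding sums_def by (intro tendsto_intros)
    then have "\<forall>\<^sub>F n in sequentially. c * (exp r - (\<Sum>i<n. ebound i r)) < e"
      using \<open>e > 0\<close> by (simp add: order_tendstoD(2))
    then show "\<forall>\<^sub>F n in sequentially. \<forall>x\<in>?S. \<forall>h.
        norm ((\<Sum>i<n. dpow i x h /\<^sub>R fact i) - dexp x h) \<le> e * norm h"
    proof eventually_elim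
      case (elim n)
      show ?case
      proof (intro ballI allI)
        fix x h assume x: "x \<in> ?S"
        have "dexp x h = (\<Sum>i. dpow (i + n) x h /\<^sub>R fact (i + n)) + (\<Sum>i<n. dpow i x h /\<^sub>R fact i)"
          unfolding dexp_def by (rule suminf_split_initial_segment[OF summable_dpow])
        then have eq: "norm ((\<Sum>i<n. dpow i x h /\<^sub>R fact i) - dexp x h)
            = norm (\<Sum>i. dpow (i + n) x h /\<^sub>R fact (i + n))"
          by simp
        have le: "norm (\<Sum>i. dpow (i + n) x h /\<^sub>R fact (i + n)) \<le> (\<Sum>i. c * norm h * ebound (i + n) r)"
        proof (rule norm_suminf_le)
          fix i
          have "ebound (i + n) (norm x) \<le> ebound (i + n) r"
            using x by (intro ebound_mono) auto
          then have "c * norm h * ebound (i + n) (norm x) \<le> c * norm h * ebound (i + n) r"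
            by (rule mult_left_mono) (simp add: c_def)
          with norm_dpow_le[of "i + n" x h]
          show "norm (dpow (i + n) x h /\<^sub>R fact (i + n)) \<le> c * norm h * ebound (i + n) r"
            unfolding c_def by (rule order_trans)
          show "summable (\<lambda>i. c * norm h * ebound (i + n) r)"
            by (rule summable_ignore_initial_segment[OF summable_ebound_mult])
        qed
        have "(\<Sum>i. c * norm h * ebound (i + n) r) = c * norm h * (\<Sum>i. ebound (i + n) r)"
          by (rule suminf_mult) (rule summable_ignore_initial_segment[OF sums_summable[OF ebound_sums]])
        moreover have "(\<Sum>i. ebound (i + n) r) = exp r - (\<Sum>i<n. ebound i r)"
          using suminf_minus_initial_segment[OF sums_summable[OF ebound_sums[of r]], of n]
            sums_unique[OF ebound_sums[of r]] by simp
        moreover have "(c * (exp r - (\<Sum>i<n. ebound i r))) * norm h \<le> e * norm h"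
          by (rule mult_right_mono[OF less_imp_le[OF elim]]) simp
        moreover have "c * norm h * t = (c * t) * norm h" for t
          by simp
        ultimately have "(\<Sum>i. c * norm h * ebound (i + n) r) \<le> e * norm h"
          by metis
        with le show "norm ((\<Sum>i<n. dpow i x h /\<^sub>R fact i) - dexp x h) \<le> e * norm h"
          unfolding eq by (rule order_trans)
      qed
    qed
  qed (rule convex_ball)
  then obtain g where g: "\<forall>x\<in>?S. (\<lambda>n. x ^ n /\<^sub>R fact n) sums (g x) \<and> (g has_derivative dexp x) (at x within ?S)"
    by (elim exE)
  have X: "X \<in> ?S" by (simp add: r_def)
  have "(g has_derivative dexp X) (at X)"
    using conjunct2[OF bspec[OF g X]] by (simp only: at_within_open[OF X open_ball])
  moreover have "g x = mexp x" if "x \<in> ?S" for x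
    by (rule sums_unique2[OF conjunct1[OF bspec[OF g that]] mexp_sums])
  ultimately show ?thesis
    by (rule has_derivative_transform_within_open[OF _ open_ball X])
qed

text \<open>
  The terms with index \<open>0\<close> and \<open>1\<close> add up to \<open>H\<close>, and the remaining ones are estimated by \<open>ebound\<close>. The
  bound tends to \<open>0\<close> with \<open>X\<close>; this quantitative form of continuity gives a local inverse of
  maps built from the exponential.
\<close>

lemma dexp_near_id:
  fixes X :: "'n::finite cmat"
  shows "norm (dexp X H - H) \<le> (norm (1::'n cmat))\<^sup>2 * norm H * (exp (norm X) - 1)"
proof -
  let ?c = "(norm (1::'n cmat))\<^sup>2"
  have "dexp X H = (\<Sum>i. dpow (i + 2) X H /\<^sub>R fact (i + 2)) + (\<Sum>i<2. dpow i X H /\<^sub>R fact i)"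
    unfolding dexp_def by (rule suminf_split_initial_segment[OF summable_dpow])
  also have "(\<Sum>i<2. dpow i X H /\<^sub>R fact i) = H"
    by (simp add: dpow_def numeral_2_eq_2)
  finally have eq: "norm (dexp X H - H) = norm (\<Sum>i. dpow (i + 2) X H /\<^sub>R fact (i + 2))"
    by simp
  have le: "norm (\<Sum>i. dpow (i + 2) X H /\<^sub>R fact (i + 2)) \<le> (\<Sum>i. ?c * norm H * ebound (i + 2) (norm X))"
    by (rule norm_suminf_le[OF norm_dpow_le summable_ignore_initial_segment[OF summable_ebound_mult]])
  have "(\<Sum>i. ?c * norm H * ebound (i + 2) (norm X)) = ?c * norm H * (\<Sum>i. ebound (i + 2) (norm X))"
    by (rule suminf_mult) (rule summable_ignore_initial_segment[OF sums_summable[OF ebound_sums]])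
  moreover have "(\<Sum>i. ebound (i + 2) (norm X)) = exp (norm X) - (\<Sum>i<2. ebound i (norm X))"
    using suminf_minus_initial_segment[OF sums_summable[OF ebound_sums[of "norm X"]], of 2]
      sums_unique[OF ebound_sums[of "norm X"]] by simp
  moreover have "(\<Sum>i<2. ebound i (norm X)) = 1"
    by (simp add: ebound_def numeral_2_eq_2)
  ultimately show ?thesis using le unfolding eq by (simp only:)
qed

lemma dexp_0: "dexp 0 H = H"
  using dexp_near_id[of 0 H] by simp

lemma continuous_mexp: "continuous (at X) mexp"
  using has_derivative_mexp has_derivative_continuous by blast

lemma tendsto_mexp: "(f \<longlongrightarrow> X) F \<Longrightarrow> ((\<lambda>x. mexp (f x)) \<longlongrightarrow> mexp X) F"
  using isCont_tendsto_compose[OF continuous_mexp] by blast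

section \<open>Polynomial functions on matrices\<close>

lemma linear_form_iff:
  "Vector_Spaces.linear mscale (*) f \<longleftrightarrow>
    (\<forall>A B. f (A + B) = f A + f B) \<and> (\<forall>c A. f (mscale c A) = c * f A)"
  by (auto simp: Vector_Spaces.linear_iff vector_space_mscale vector_space_over_itself.vector_space_axioms)

lemma linear_form_raw:
  assumes "Vector_Spaces.linear mscale (*) f"
  shows "bounded_linear (\<lambda>X. f (raw X))" "f (raw (sc t * X)) = t * f (raw X)"
proof -
  have add: "f (A + B) = f A + f B" and scale: "f (mscale c A) = c * f A" for A B c
    using assms by (auto simp: linear_form_iff)
  have "linear (\<lambda>X. f (raw X))"
  proof (rule linearI)
    show "f (raw (r *\<^sub>R X)) = r *\<^sub>R f (raw X)" for r X
      by (subst sc_of_real[symmetric]) (simp add: scale scaleR_conv_of_real del: raw_simps(6))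
  qed (simp add: add)
  then show "bounded_linear (\<lambda>X. f (raw X))" by (simp add: linear_conv_bounded_linear)
  show "f (raw (sc t * X)) = t * f (raw X)" by (simp add: scale del: raw_simps(6))
qed

text \<open>
  Real differentiability with a complex-linear derivative. Composed with a curve of the same kind, such a
  function becomes holomorphic in the sense of one complex variable.
\<close>

definition cdiff :: "('n::finite cmat \<Rightarrow> complex) \<Rightarrow> 'n cmat \<Rightarrow> bool" where
  "cdiff f X \<longleftrightarrow> (\<exists>D. (f has_derivative D) (at X) \<and> (\<forall>t H. D (sc t * H) = t * D H))"

lemma cdiffI: "(f has_derivative D) (at X) \<Longrightarrow> (\<And>t H. D (sc t * H) = t * D H) \<Longrightarrow> cdiff f X"
  by (auto simp: cdiff_def)

lemma cdiff_const: "cdiff (\<lambda>_. c) X"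
  by (rule cdiffI[where D = "\<lambda>_. 0"]) auto

lemma cdiff_add: "cdiff f X \<Longrightarrow> cdiff g X \<Longrightarrow> cdiff (\<lambda>x. f x + g x) X"
  unfolding cdiff_def by (elim exE conjE) (rule exI, rule conjI, erule (1) has_derivative_add, simp add: distrib_left)

lemma cdiff_mult: "cdiff f X \<Longrightarrow> cdiff g X \<Longrightarrow> cdiff (\<lambda>x. f x * g x) X"
  unfolding cdiff_def
  by (elim exE conjE) (rule exI, rule conjI, erule (1) has_derivative_mult, simp add: algebra_simps)

lemma cdiff_inverse:
  assumes "cdiff f X" "f X \<noteq> 0"
  shows "cdiff (\<lambda>x. inverse (f x)) X"
proof -
  obtain D where D: "(f has_derivative D) (at X)" "\<And>t H. D (sc t * H) = t * D H"
    using assms(1) by (auto simp: cdiff_def)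
  show ?thesis
    by (rule cdiffI[OF Deriv.has_derivative_inverse[OF assms(2) D(1)]]) (simp add: D(2))
qed

lemma cdiff_power: "cdiff f X \<Longrightarrow> cdiff (\<lambda>x. f x ^ k) X"
  by (induct k) (auto intro: cdiff_const cdiff_mult)

lemma cdiff_poly_fun:
  assumes "p \<in> poly_fun mscale"
  shows "cdiff (\<lambda>X. p (raw X)) X"
  using assms
proof induct
  case (linear_form f)
  show ?case
    by (rule cdiffI[OF bounded_linear_imp_has_derivative]) (rule linear_form_raw[OF linear_form])+
qed (auto intro: cdiff_const cdiff_add cdiff_mult)

lemma cdiff_imp_isCont: "cdiff f X \<Longrightarrow> isCont f X"
  unfolding cdiff_def using has_derivative_continuous by blast

lemma isCont_poly_fun: "p \<in> poly_fun mscale \<Longrightarrow> isCont (\<lambda>X. p (raw X)) X"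
  by (rule cdiff_imp_isCont[OF cdiff_poly_fun])

lemma tendsto_poly_fun:
  assumes "p \<in> poly_fun mscale" "(f \<longlongrightarrow> X) F"
  shows "((\<lambda>x. p (raw (f x))) \<longlongrightarrow> p (raw X)) F"
  using isCont_tendsto_compose[OF isCont_poly_fun[OF assms(1)] assms(2)] .

lemma cdiff_field_derivative:
  assumes "cdiff f (\<gamma> t)" "(\<gamma> has_derivative (\<lambda>h. sc h * W)) (at t)"
  shows "\<exists>d. ((\<lambda>t. f (\<gamma> t)) has_field_derivative d) (at t)"
proof -
  obtain D where D: "(f has_derivative D) (at (\<gamma> t))" "\<And>t H. D (sc t * H) = t * D H"
    using assms(1) by (auto simp: cdiff_def)
  have "((\<lambda>t. f (\<gamma> t)) has_derivative (\<lambda>h. D (sc h * W))) (at t)"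
    using has_derivative_compose[OF assms(2) D(1)] .
  then show ?thesis
    unfolding has_field_derivative_def D(2) by (intro exI[of _ "D W"]) (simp add: mult.commute[of _ "D W"])
qed

lemma has_derivative_mexp_line:
  "((\<lambda>t. mexp (A + sc t * B)) has_derivative (\<lambda>h. sc h * dexp (A + sc t * B) B)) (at t)"
proof -
  have "((\<lambda>t. A + sc t * B) has_derivative (\<lambda>h. sc h * B)) (at t)"
    by (rule derivative_eq_intros bounded_linear_imp_has_derivative[OF bounded_linear_sc] refl)+ simp
  from has_derivative_compose[OF this has_derivative_mexp] show ?thesis
    by (simp add: dexp_sc)
qed

lemma holomorphic_poly_mexp_line:
  assumes "p \<in> poly_fun mscale"
  shows "(\<lambda>t. p (raw (mexp (A + sc t * B)))) holomorphic_on S"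
  unfolding holomorphic_on_def field_differentiable_def
  using cdiff_field_derivative[OF cdiff_poly_fun[OF assms] has_derivative_mexp_line]
  by (meson has_field_derivative_at_within)

text \<open>
  Near \<open>a\<close> the function \<open>f\<close> has no zero, so \<open>g\<close> vanishes there and hence everywhere.
\<close>

lemma holomorphic_product_zero:
  assumes f: "f holomorphic_on S" and g: "g holomorphic_on S" and S: "open S" "connected S"
    and z: "\<And>z. z \<in> S \<Longrightarrow> f z * g z = 0" and a: "a \<in> S" "f a \<noteq> 0" and w: "w \<in> S"
  shows "g w = 0"
proof (rule analytic_continuation[OF g S _ a(1) _ _ w])
  let ?U = "{z \<in> S. f z \<noteq> 0}"
  show "?U \<subseteq> S" by blast
  show "g z = 0" if "z \<in> ?U" for z using that z[of z] by auto
  have "open (S \<inter> f -` (- {0}))"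
    using f S(1) by (intro continuous_open_preimage holomorphic_on_imp_continuous_on) auto
  moreover have "S \<inter> f -` (- {0}) = ?U" by auto
  ultimately have "open ?U" by simp
  then show "a islimpt ?U" using a by (intro interior_limit_point) (simp add: interior_open)
qed

lemma poly_fun_entry: "(\<lambda>A. A $ i $ j) \<in> poly_fun mscale"
  by (rule poly_fun.linear_form) (simp add: linear_form_iff mscale_def)

lemma poly_fun_sum: "(\<And>i. i \<in> I \<Longrightarrow> f i \<in> poly_fun s) \<Longrightarrow> (\<lambda>x. \<Sum>i\<in>I. f i x) \<in> poly_fun s"
  by (induct I rule: infinite_finite_induct) (auto intro: poly_fun.const poly_fun.add)

lemma poly_fun_prod: "(\<And>i. i \<in> I \<Longrightarrow> f i \<in> poly_fun s) \<Longrightarrow> (\<lambda>x. \<Prod>i\<in>I. f i x) \<in> poly_fun s"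
  by (induct I rule: infinite_finite_induct) (auto intro: poly_fun.const poly_fun.mult)

lemma poly_fun_power: "f \<in> poly_fun s \<Longrightarrow> (\<lambda>x. f x ^ k) \<in> poly_fun s"
  by (induct k) (auto intro: poly_fun.const poly_fun.mult)

lemma poly_fun_diff_const: "f \<in> poly_fun s \<Longrightarrow> (\<lambda>x. f x - c) \<in> poly_fun s"
  using poly_fun.add[OF _ poly_fun.const, of f s "- c"] by simp

lemma poly_fun_det_of:
  fixes F :: "'v::ab_group_add \<Rightarrow> complex^'n^'n"
  assumes "\<And>i j. (\<lambda>A. F A $ i $ j) \<in> poly_fun s"
  shows "(\<lambda>A. det (F A)) \<in> poly_fun s"
  unfolding det_def using assms
  by (intro poly_fun_sum poly_fun.mult poly_fun.const poly_fun_prod) auto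

lemma poly_fun_det: "det \<in> poly_fun mscale"
  using poly_fun_det_of[of "\<lambda>A. A" mscale] poly_fun_entry by auto

lemma poly_fun_subst:
  assumes p: "p \<in> poly_fun mscale"
    and L: "\<And>A B. L (A + B) = L A + L B" "\<And>c A. L (mscale c A) = mscale c (L A)"
  shows "(\<lambda>A. p (L A)) \<in> poly_fun mscale"
  using p
proof induct
  case (linear_form f)
  then show ?case
    by (intro poly_fun.linear_form) (auto simp: linear_form_iff L)
qed (auto intro: poly_fun.intros)

lemma mscale_mult: "mscale c A ** B = mscale c (A ** B)" "A ** mscale c B = mscale c (A ** B)"
  by (simp_all add: mscale_def matrix_matrix_mult_def vec_eq_iff sum_distrib_left mult_ac)

lemma poly_fun_mult:
  fixes U V :: "complex^'n^'n"
  assumes "p \<in> poly_fun mscale"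
  shows "(\<lambda>A. p (U ** A ** V)) \<in> poly_fun mscale"
proof (rule poly_fun_subst[OF assms])
  have "cmat (U ** (A + B) ** V) = cmat U * (cmat A + cmat B) * cmat V" for A B
    by (simp add: cmat_eq_iff)
  then show "U ** (A + B) ** V = U ** A ** V + U ** B ** V" for A B
    by (simp add: cmat_eq_iff distrib_left distrib_right)
qed (simp add: mscale_mult)

lemma linear_form_expand:
  fixes f :: "complex^'n^'n \<Rightarrow> complex"
  assumes "Vector_Spaces.linear mscale (*) f"
  shows "f A = (\<Sum>i\<in>UNIV. \<Sum>j\<in>UNIV. A $ i $ j * f (axis i (axis j 1)))"
proof -
  have add: "f (A + B) = f A + f B" and scale: "f (mscale c A) = c * f A" for A B c
    using assms by (auto simp: linear_form_iff)
  have zero: "f 0 = 0" using add[of 0 0] by simp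
  have sum: "f (\<Sum>i\<in>I. g i) = (\<Sum>i\<in>I. f (g i))" for g :: "'n \<Rightarrow> _" and I
    by (induct I rule: infinite_finite_induct) (auto simp: zero add)
  have "A = (\<Sum>i\<in>UNIV. \<Sum>j\<in>UNIV. mscale (A $ i $ j) (axis i (axis j 1)))"
  proof -
    have "(\<Sum>a\<in>UNIV. \<Sum>b\<in>UNIV. A $ a $ b * axis a (axis b 1) $ i $ j) = A $ i $ j" for i j
    proof -
      have "(\<Sum>b\<in>UNIV. A $ a $ b * axis a (axis b 1) $ i $ j) = (if a = i then A $ i $ j else 0)" for a
        by (auto simp: axis_def if_distrib[of "(*) _"] cong: if_cong)
      then show ?thesis by simp
    qed
    then show ?thesis by (simp add: vec_eq_iff mscale_def)
  qed
  then have "f A = f (\<Sum>i\<in>UNIV. \<Sum>j\<in>UNIV. mscale (A $ i $ j) (axis i (axis j 1)))"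
    by simp
  then show ?thesis by (simp add: sum scale)
qed

lemma matrix_inv_mult_right:
  fixes A :: "complex^'n^'n"
  assumes "invertible A"
  shows "A ** matrix_inv A = mat 1" "matrix_inv A ** A = mat 1"
  using someI_ex[OF assms[unfolded invertible_def]] by (auto simp: matrix_inv_def)

text \<open>
  Cramer's rule for the \<open>j\<close>-th column of the inverse.
\<close>

lemma matrix_inv_entry:
  fixes A :: "complex^'n^'n"
  assumes A: "invertible A"
  shows "matrix_inv A $ i $ j * det A = det (\<chi> k l. if l = i then (if k = j then 1 else 0) else A $ k $ l)"
proof -
  have d: "det A \<noteq> 0" using A by (simp add: invertible_det_nz)
  have "A *v (matrix_inv A *v axis j 1) = axis j 1"
    by (simp add: matrix_vector_mul_assoc matrix_inv_mult_right[OF A])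
  then have "matrix_inv A *v axis j 1 = (\<chi> k. det (\<chi> i l. if l = k then axis j 1 $ i else A $ i $ l) / det A)"
    using cramer[OF d] by blast
  then have "(matrix_inv A *v axis j 1) $ i = det (\<chi> k l. if l = i then axis j 1 $ k else A $ k $ l) / det A"
    by simp
  moreover have "(matrix_inv A *v axis j 1) $ i = matrix_inv A $ i $ j"
    by (simp add: matrix_vector_mult_def axis_def if_distrib[of "(*) _"] cong: if_cong)
  moreover have "axis j 1 $ k = (if k = j then 1 else 0 :: complex)" for k
    by (simp add: axis_def)
  ultimately show ?thesis using d by (simp add: field_simps cong: if_cong)
qed

text \<open>
  By Cramer's rule the entries of the inverse are polynomials divided by the determinant, and a power of
  the determinant clears the denominators. A polynomial that vanishes on the inverses of a set is
  thereby turned into one that vanishes on the set.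
\<close>

lemma poly_fun_matrix_inv:
  fixes p :: "complex^'n^'n \<Rightarrow> complex"
  assumes "p \<in> poly_fun mscale"
  shows "\<exists>q\<in>poly_fun mscale. \<exists>k. \<forall>A. invertible A \<longrightarrow> p (matrix_inv A) * det A ^ k = q A"
  using assms
proof induct
  case (const c)
  show ?case by (rule bexI[of _ "\<lambda>_. c"], rule exI[of _ 0]) (auto intro: poly_fun.const)
next
  case (linear_form f)
  define q where "q A = (\<Sum>i\<in>UNIV. \<Sum>j\<in>UNIV.
    det (\<chi> k l. if l = i then (if k = j then 1 else 0) else A $ k $ l) * f (axis i (axis j 1)))"
    for A :: "complex^'n^'n"
  have "(\<lambda>A. (\<chi> k l. if l = i then (if k = j then 1 else 0) else A $ k $ l) $ a $ b) \<in> poly_fun mscale"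
    for i j a b :: 'n
    by (cases "b = i") (auto intro: poly_fun.const poly_fun_entry)
  then have "q \<in> poly_fun mscale"
    unfolding q_def[abs_def]
    by (intro poly_fun_sum poly_fun.mult poly_fun.const poly_fun_det_of)
  moreover have "f (matrix_inv A) * det A ^ 1 = q A" if "invertible A" for A
    unfolding linear_form_expand[OF linear_form, of "matrix_inv A"] q_def
      matrix_inv_entry[OF that, symmetric]
    by (simp add: sum_distrib_left mult_ac)
  ultimately show ?case by blast
next
  case (add f g)
  then obtain q k q' k' where *: "q \<in> poly_fun mscale" "q' \<in> poly_fun mscale"
    "\<And>A. invertible A \<Longrightarrow> f (matrix_inv A) * det A ^ k = q A"
    "\<And>A. invertible A \<Longrightarrow> g (matrix_inv A) * det A ^ k' = q' A" by metis
  have "(\<lambda>A. q A * det A ^ k' + q' A * det A ^ k) \<in> poly_fun mscale"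
    by (intro poly_fun.add poly_fun.mult poly_fun_power poly_fun_det *)
  moreover have "(f (matrix_inv A) + g (matrix_inv A)) * det A ^ (k + k') = q A * det A ^ k' + q' A * det A ^ k"
    if "invertible A" for A
    by (simp add: *(3,4)[OF that, symmetric] power_add algebra_simps)
  ultimately show ?case by (intro bexI exI allI impI)
next
  case (mult f g)
  then obtain q k q' k' where *: "q \<in> poly_fun mscale" "q' \<in> poly_fun mscale"
    "\<And>A. invertible A \<Longrightarrow> f (matrix_inv A) * det A ^ k = q A"
    "\<And>A. invertible A \<Longrightarrow> g (matrix_inv A) * det A ^ k' = q' A" by metis
  have "(\<lambda>A. q A * q' A) \<in> poly_fun mscale"
    by (intro poly_fun.mult *)
  moreover have "(f (matrix_inv A) * g (matrix_inv A)) * det A ^ (k + k') = q A * q' A"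
    if "invertible A" for A
    by (simp add: *(3,4)[OF that, symmetric] power_add algebra_simps)
  ultimately show ?case by (intro bexI exI allI impI)
qed

section \<open>Irreducible sets\<close>

lemma closedin_zariski:
  "closedin (zariski s) C \<longleftrightarrow> (\<exists>F\<subseteq>poly_fun s. C = {x. \<forall>f\<in>F. f x = 0})"
  by (simp add: closedin_def openin_zariski Diff_Diff_Int Compl_eq_Diff_UNIV[symmetric])

lemma irreducible_in_closure:
  assumes "irreducible_in X Y"
  shows "irreducible_in X (X closure_of Y)"
proof -
  have Y: "Y \<subseteq> topspace X" "Y \<noteq> {}" and
    irr: "\<And>A B. closedin X A \<Longrightarrow> closedin X B \<Longrightarrow> Y \<subseteq> A \<union> B \<Longrightarrow> Y \<subseteq> A \<or> Y \<subseteq> B"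
    using assms by (auto simp: irreducible_in_def)
  have sub: "Y \<subseteq> X closure_of Y" using Y(1) by (rule closure_of_subset)
  have "X closure_of Y \<subseteq> A \<or> X closure_of Y \<subseteq> B"
    if "closedin X A" "closedin X B" "X closure_of Y \<subseteq> A \<union> B" for A B
    using irr[OF that(1,2)] sub that by (meson closure_of_minimal order_trans)
  then show ?thesis using Y sub by (auto simp: irreducible_in_def closure_of_subset_topspace)
qed

lemma irreducible_in_subtopology:
  assumes "irreducible_in X Y" "Y \<subseteq> G"
  shows "irreducible_in (subtopology X G) Y"
  unfolding irreducible_in_def
proof (intro conjI allI impI)
  show "Y \<subseteq> topspace (subtopology X G)" "Y \<noteq> {}"
    using assms by (auto simp: irreducible_in_def)
  fix A B assume "closedin (subtopology X G) A" "closedin (subtopology X G) B" and sub: "Y \<subseteq> A \<union> B"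
  then obtain A' B' where *: "closedin X A'" "closedin X B'" "A = A' \<inter> G" "B = B' \<inter> G"
    by (auto simp: closedin_subtopology)
  then have "Y \<subseteq> A' \<union> B'" using sub by blast
  then have "Y \<subseteq> A' \<or> Y \<subseteq> B'" using assms(1) * by (auto simp: irreducible_in_def)
  then show "Y \<subseteq> A \<or> Y \<subseteq> B" using * assms(2) by blast
qed

lemma irreducible_in_imp_connectedin:
  assumes "irreducible_in X Y"
  shows "connectedin X Y"
  unfolding connectedin_closedin
proof (intro conjI notI; (elim exE conjE)?)
  show "Y \<subseteq> topspace X" using assms by (simp add: irreducible_in_def)
  fix A B assume *: "closedin X A" "closedin X B" "Y \<subseteq> A \<union> B" "A \<inter> B \<inter> Y = {}" "A \<inter> Y \<noteq> {}" "B \<inter> Y \<noteq> {}"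
  then have "Y \<subseteq> A \<or> Y \<subseteq> B" using assms by (simp add: irreducible_in_def)
  then show False using * by blast
qed

text \<open>
  If two closed sets cover \<open>Y\<close> and neither contains it, some polynomials \<open>f\<close> and \<open>e\<close> have product zero on
  \<open>Y\<close> while \<open>f\<close> does not vanish at some \<open>a\<close> and \<open>e\<close> does not vanish at some \<open>b\<close>. Along a holomorphic
  curve in \<open>Y\<close> from \<open>a\<close> to \<open>b\<close> the identity theorem forbids this.
\<close>

lemma irreducible_in_zariski_curves:
  fixes Y :: "'n::finite cmat set"
  assumes "Y \<noteq> {}"
    and "\<And>a b. a \<in> Y \<Longrightarrow> b \<in> Y \<Longrightarrow> \<exists>S \<gamma> s t. open S \<and> connected S \<and> \<gamma> ` S \<subseteq> Y \<and> s \<in> S \<and> t \<in> S \<and>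
        \<gamma> s = a \<and> \<gamma> t = b \<and> (\<forall>p\<in>poly_fun mscale. (\<lambda>z. p (raw (\<gamma> z))) holomorphic_on S)"
  shows "irreducible_in (zariski mscale) (raw ` Y)"
  unfolding irreducible_in_def
proof (intro conjI allI impI)
  show "raw ` Y \<subseteq> topspace (zariski mscale)" "raw ` Y \<noteq> {}" using assms(1) by auto
  fix A B :: "(complex^'n^'n) set"
  assume A: "closedin (zariski mscale) A" and B: "closedin (zariski mscale) B" and sub: "raw ` Y \<subseteq> A \<union> B"
  obtain F where F: "F \<subseteq> poly_fun mscale" "A = {x. \<forall>f\<in>F. f x = 0}"
    using A by (auto simp: closedin_zariski)
  obtain E where E: "E \<subseteq> poly_fun mscale" "B = {x. \<forall>f\<in>E. f x = 0}"
    using B by (auto simp: closedin_zariski)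
  show "raw ` Y \<subseteq> A \<or> raw ` Y \<subseteq> B"
  proof (rule ccontr)
    assume "\<not> ?thesis"
    then obtain a b where a: "a \<in> Y" "raw a \<notin> A" and b: "b \<in> Y" "raw b \<notin> B" by blast
    obtain f where f: "f \<in> F" "f (raw a) \<noteq> 0" using a F by auto
    obtain e where e: "e \<in> E" "e (raw b) \<noteq> 0" using b E by auto
    obtain S \<gamma> s t where c: "open S" "connected S" "\<gamma> ` S \<subseteq> Y" "s \<in> S" "t \<in> S"
        "\<gamma> s = a" "\<gamma> t = b" and hol: "\<And>p. p \<in> poly_fun mscale \<Longrightarrow> (\<lambda>z. p (raw (\<gamma> z))) holomorphic_on S"
      using assms(2)[OF a(1) b(1)] by metis
    have "e (raw (\<gamma> t)) = 0"
    proof (rule holomorphic_product_zero[OF hol hol c(1,2) _ c(4) _ c(5)])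
      show "f \<in> poly_fun mscale" "e \<in> poly_fun mscale" using f e F E by auto
      show "f (raw (\<gamma> s)) \<noteq> 0" using f c by simp
      show "f (raw (\<gamma> z)) * e (raw (\<gamma> z)) = 0" if "z \<in> S" for z
      proof -
        have "raw (\<gamma> z) \<in> A \<union> B" using c(3) sub that by blast
        then show ?thesis using f(1) e(1) F(2) E(2) by auto
      qed
    qed
    then show False using e c by simp
  qed
qed

section \<open>The Lie algebra of a closed subgroup\<close>

lemma has_vector_derivative_mexp_0:
  "((\<lambda>s::real. mexp (s *\<^sub>R X)) has_vector_derivative X) (at 0)"
proof -
  have "((\<lambda>s::real. s *\<^sub>R X) has_derivative (\<lambda>s. s *\<^sub>R X)) (at 0)"
    by (rule bounded_linear_imp_has_derivative) (rule bounded_linear_scaleR_left)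
  from has_derivative_compose[OF this has_derivative_mexp]
  show ?thesis by (simp add: has_vector_derivative_def dexp_0)
qed

lemma has_vector_derivative_quotient_tendsto:
  fixes \<gamma> :: "real \<Rightarrow> 'a::real_normed_vector"
  assumes "(\<gamma> has_vector_derivative Z) (at 0)" "e \<longlonglongrightarrow> 0" "\<And>i. e i > 0"
  shows "(\<lambda>i. inverse (e i) *\<^sub>R (\<gamma> (e i) - \<gamma> 0)) \<longlonglongrightarrow> Z"
proof -
  have "((\<lambda>s. (\<gamma> s - \<gamma> 0 - s *\<^sub>R Z) /\<^sub>R norm s) \<longlongrightarrow> 0) (at 0)"
    using assms(1) by (simp add: has_vector_derivative_def has_derivative_at_within)
  moreover have "filterlim e (at 0) sequentially"
    using assms(2,3) by (intro filterlim_atI) (auto simp: less_imp_neq[symmetric] intro: always_eventually)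
  ultimately have "(\<lambda>i. (\<gamma> (e i) - \<gamma> 0 - e i *\<^sub>R Z) /\<^sub>R norm (e i)) \<longlonglongrightarrow> 0"
    by (rule filterlim_compose)
  then have "(\<lambda>i. (\<gamma> (e i) - \<gamma> 0 - e i *\<^sub>R Z) /\<^sub>R norm (e i) + Z) \<longlonglongrightarrow> 0 + Z"
    by (intro tendsto_intros)
  moreover have "(\<gamma> (e i) - \<gamma> 0 - e i *\<^sub>R Z) /\<^sub>R norm (e i) + Z = inverse (e i) *\<^sub>R (\<gamma> (e i) - \<gamma> 0)" for i
    using assms(3)[of i] by (simp add: scaleR_diff_right)
  ultimately show ?thesis by simp
qed

lemma subspace_vector_derivative:
  fixes \<gamma> :: "real \<Rightarrow> 'a::euclidean_space"
  assumes S: "subspace S" and \<gamma>: "(\<gamma> has_vector_derivative Z) (at 0)" "\<And>s. \<gamma> s \<in> S"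
  shows "Z \<in> S"
proof (rule closed_sequentially[OF closed_subspace[OF S]])
  show "(\<lambda>i. inverse (inverse (real (Suc i))) *\<^sub>R (\<gamma> (inverse (real (Suc i))) - \<gamma> 0)) \<longlonglongrightarrow> Z"
    by (rule has_vector_derivative_quotient_tendsto[OF \<gamma>(1) LIMSEQ_inverse_real_of_nat]) simp
  show "inverse (inverse (real (Suc i))) *\<^sub>R (\<gamma> (inverse (real (Suc i))) - \<gamma> 0) \<in> S" for i
    by (intro subspace_scale[OF S] subspace_diff[OF S] \<gamma>(2))
qed

text \<open>
  Telescoping. Multiplication by a matrix \<open>x\<close> increases norms at most by the factor
  \<open>1 + norm (x - 1)\<close>; for \<open>x\<close> near the identity this is much better than \<open>norm x\<close>, which is about
  \<open>norm 1\<close>, so that powers stay under control.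
\<close>

lemma norm_power_diff_le:
  fixes a b :: "'n::finite cmat"
  assumes a: "norm (a - 1) \<le> r" and b: "norm (b - 1) \<le> r"
  shows "norm (a ^ N - b ^ N) \<le> real N * (1 + r) ^ N * norm (1::'n cmat) * norm (a - b)"
proof -
  have r: "0 \<le> r" using a norm_ge_zero order_trans by blast
  have mult: "norm (x * Y) \<le> (1 + r) * norm Y" if "norm (x - 1) \<le> r" for x Y :: "'n cmat"
  proof -
    have "norm (x * Y) = norm (Y + (x - 1) * Y)" by (simp add: algebra_simps)
    also have "\<dots> \<le> norm Y + norm (x - 1) * norm Y"
      by (meson add_left_mono norm_mult_ineq norm_triangle_ineq order_trans)
    also have "\<dots> \<le> norm Y + r * norm Y" using that by (simp add: mult_right_mono)
    finally show ?thesis by (simp add: algebra_simps)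
  qed
  have pow: "norm (b ^ N) \<le> (1 + r) ^ N * norm (1::'n cmat)" for N
  proof (induct N)
    case (Suc N)
    have "norm (b ^ Suc N) \<le> (1 + r) * norm (b ^ N)" using mult[OF b] by simp
    also have "\<dots> \<le> (1 + r) * ((1 + r) ^ N * norm (1::'n cmat))"
      using Suc r by (intro mult_left_mono) auto
    finally show ?case by simp
  qed simp
  show ?thesis
  proof (induct N)
    case (Suc N)
    let ?c = "norm (1::'n cmat)" and ?d = "norm (a - b)"
    have "a ^ Suc N - b ^ Suc N = a * (a ^ N - b ^ N) + (a - b) * b ^ N"
      by (simp add: algebra_simps)
    then have "norm (a ^ Suc N - b ^ Suc N) \<le> norm (a * (a ^ N - b ^ N)) + norm ((a - b) * b ^ N)"
      by (metis norm_triangle_ineq)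
    also have "norm (a * (a ^ N - b ^ N)) \<le> (1 + r) * (real N * (1 + r) ^ N * ?c * ?d)"
      using mult[OF a, of "a ^ N - b ^ N"] Suc r
      by (meson add_nonneg_nonneg mult_left_mono order_trans zero_le_one)
    also have "norm ((a - b) * b ^ N) \<le> ?d * ((1 + r) ^ N * ?c)"
      using norm_mult_ineq[of "a - b" "b ^ N"] mult_left_mono[OF pow[of N], of ?d] by simp
    also have "?d * ((1 + r) ^ N * ?c) \<le> (1 + r) * (?d * ((1 + r) ^ N * ?c))"
      using r mult_right_mono[of 1 "1 + r" "?d * ((1 + r) ^ N * ?c)"] by simp
    finally show ?case by (simp add: algebra_simps)
  qed simp
qed

text \<open>
  Up to an error of smaller order, \<open>h i\<close> agrees with \<open>mexp (e i *\<^sub>R Z)\<close>, and about \<open>t / e i\<close> factors of the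
  latter multiply to \<open>mexp (t *\<^sub>R Z)\<close>. The accumulated error is at most \<open>t / e i\<close> times the individual
  one, up to a constant.
\<close>

lemma power_tendsto_mexp:
  fixes Z :: "'n::finite cmat"
  assumes h: "(\<lambda>i. inverse (e i) *\<^sub>R (h i - 1)) \<longlonglongrightarrow> Z" and e: "e \<longlonglongrightarrow> 0" "\<And>i. e i > 0"
    and t: "t \<ge> 0"
  shows "(\<lambda>i. h i ^ nat \<lfloor>t / e i\<rfloor>) \<longlonglongrightarrow> mexp (t *\<^sub>R Z)"
proof -
  define N where "N i = nat \<lfloor>t / e i\<rfloor>" for i
  define b where "b i = mexp (e i *\<^sub>R Z)" for i
  have b: "(\<lambda>i. inverse (e i) *\<^sub>R (b i - 1)) \<longlonglongrightarrow> Z"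
    using has_vector_derivative_quotient_tendsto[OF has_vector_derivative_mexp_0[of Z] e] by (simp add: b_def)
  obtain K1 where K1: "\<And>i. norm (inverse (e i) *\<^sub>R (h i - 1)) \<le> K1"
    using convergent_imp_Bseq[OF convergentI[OF h]] unfolding Bseq_def by auto
  obtain K2 where K2: "\<And>i. norm (inverse (e i) *\<^sub>R (b i - 1)) \<le> K2"
    using convergent_imp_Bseq[OF convergentI[OF b]] unfolding Bseq_def by auto
  define K where "K = max 0 (max K1 K2)"
  have Ne: "real (N i) * e i \<le> t" "t - e i \<le> real (N i) * e i" for i
  proof -
    have "0 \<le> t / e i" using t e(2)[of i] by simp
    then have "real (N i) = of_int \<lfloor>t / e i\<rfloor>" by (simp add: N_def)
    then have "real (N i) \<le> t / e i" "t / e i - 1 \<le> real (N i)" by linarith+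
    then show "real (N i) * e i \<le> t" "t - e i \<le> real (N i) * e i"
      using e(2)[of i] by (simp_all add: field_simps)
  qed
  have bound: "norm (h i ^ N i - b i ^ N i)
      \<le> t * exp (t * K) * norm (1::'n cmat) * norm (inverse (e i) *\<^sub>R (h i - 1) - inverse (e i) *\<^sub>R (b i - 1))" for i
  proof -
    have "norm (h i - 1) \<le> e i * K" "norm (b i - 1) \<le> e i * K"
    proof -
      have "norm x \<le> e i * K" if "norm (inverse (e i) *\<^sub>R x) \<le> K" for x :: "'n cmat"
        using that e(2)[of i] by (simp add: divide_simps mult.commute)
      moreover have "norm (inverse (e i) *\<^sub>R (h i - 1)) \<le> K" "norm (inverse (e i) *\<^sub>R (b i - 1)) \<le> K"
        using K1[of i] K2[of i] unfolding K_def by linarith+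
      ultimately show "norm (h i - 1) \<le> e i * K" "norm (b i - 1) \<le> e i * K" by blast+
    qed
    then have "norm (h i ^ N i - b i ^ N i)
        \<le> real (N i) * (1 + e i * K) ^ N i * norm (1::'n cmat) * norm (h i - b i)"
      by (rule norm_power_diff_le)
    also have "norm (h i - b i) = e i * norm (inverse (e i) *\<^sub>R (h i - 1) - inverse (e i) *\<^sub>R (b i - 1))"
      using e(2)[of i] by (simp add: scaleR_diff_right[symmetric])
    also have "real (N i) * (1 + e i * K) ^ N i * norm (1::'n cmat) * (e i * norm (inverse (e i) *\<^sub>R (h i - 1) - inverse (e i) *\<^sub>R (b i - 1)))
       = (real (N i) * e i) * (1 + e i * K) ^ N i * norm (1::'n cmat) * norm (inverse (e i) *\<^sub>R (h i - 1) - inverse (e i) *\<^sub>R (b i - 1))"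
      by (simp only: mult_ac)
    also have "\<dots> \<le> t * exp (t * K) * norm (1::'n cmat) * norm (inverse (e i) *\<^sub>R (h i - 1) - inverse (e i) *\<^sub>R (b i - 1))"
    proof (intro mult_right_mono mult_mono Ne(1))
      have K0: "K \<ge> 0" by (simp add: K_def)
      have "(1 + e i * K) ^ N i \<le> exp (e i * K) ^ N i"
        using K0 e(2)[of i] by (intro power_mono exp_ge_add_one_self) auto
      also have "\<dots> = exp ((real (N i) * e i) * K)" by (simp add: exp_of_nat_mult[symmetric] mult_ac)
      also have "\<dots> \<le> exp (t * K)" using mult_right_mono[OF Ne(1)[of i] K0] by simp
      finally show "(1 + e i * K) ^ N i \<le> exp (t * K)" .
      show "0 \<le> (1 + e i * K) ^ N i" using K0 e(2)[of i] by simp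
    qed (use t in auto)
    finally show ?thesis .
  qed
  have "(\<lambda>i. t * exp (t * K) * norm (1::'n cmat) * norm (inverse (e i) *\<^sub>R (h i - 1) - inverse (e i) *\<^sub>R (b i - 1)))
      \<longlonglongrightarrow> t * exp (t * K) * norm (1::'n cmat) * norm (Z - Z)"
    by (intro tendsto_intros h b)
  then have d: "(\<lambda>i. h i ^ N i - b i ^ N i) \<longlonglongrightarrow> 0"
    by (intro Lim_null_comparison[OF always_eventually[OF allI[OF bound]]]) simp
  have "(\<lambda>i. t - e i) \<longlonglongrightarrow> t - 0" by (intro tendsto_intros e)
  then have "(\<lambda>i. real (N i) * e i) \<longlonglongrightarrow> t"
    by (intro tendsto_sandwich[OF always_eventually[OF allI[OF Ne(2)]] always_eventually[OF allI[OF Ne(1)]] _ tendsto_const]) simp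
  then have "(\<lambda>i. mexp ((real (N i) * e i) *\<^sub>R Z)) \<longlonglongrightarrow> mexp (t *\<^sub>R Z)"
    by (intro tendsto_mexp tendsto_intros)
  moreover have "mexp ((real (N i) * e i) *\<^sub>R Z) = b i ^ N i" for i
    by (simp add: b_def mexp_scaleR_nat[symmetric])
  ultimately have "(\<lambda>i. b i ^ N i) \<longlonglongrightarrow> mexp (t *\<^sub>R Z)" by simp
  from tendsto_add[OF d this] show ?thesis by (simp add: N_def)
qed

lemma invertible_raw_iff: "invertible (raw X) \<longleftrightarrow> (\<exists>Y. X * Y = 1 \<and> Y * X = 1)"
proof
  assume "invertible (raw X)"
  then obtain A where "raw X ** A = mat 1" "A ** raw X = mat 1" by (auto simp: invertible_def)
  then have "X * cmat A = 1 \<and> cmat A * X = 1" by (simp add: cmat_eq_iff)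
  then show "\<exists>Y. X * Y = 1 \<and> Y * X = 1" by (rule exI)
qed (auto simp: invertible_def cmat_eq_iff)

lemma invertible_mexp: "invertible (raw (mexp X))"
  unfolding invertible_raw_iff by (intro exI[of _ "mexp (- X)"] conjI mexp_minus)

text \<open>
  The function is entire in \<open>t\<close> and vanishes on the nonnegative reals.
\<close>

lemma poly_zero_on_ray_imp_zero:
  assumes p: "p \<in> poly_fun mscale" and z: "\<And>r::real. r \<ge> 0 \<Longrightarrow> p (raw (mexp (r *\<^sub>R X))) = 0"
  shows "p (raw (mexp (sc t * X))) = 0"
proof -
  have hol: "(\<lambda>t. p (raw (mexp (0 + sc t * X)))) holomorphic_on UNIV"
    by (rule holomorphic_poly_mexp_line[OF p])
  have "(\<lambda>t. p (raw (mexp (0 + sc t * X)))) t = 0"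
  proof (rule analytic_continuation[OF hol, where U = "of_real ` {0..}" and \<xi> = 0])
    show "0 islimpt complex_of_real ` {0..}"
      unfolding islimpt_approachable
    proof (intro allI impI)
      fix e :: real assume "e > 0"
      then show "\<exists>x'\<in>complex_of_real ` {0..}. x' \<noteq> 0 \<and> dist x' 0 < e"
        by (intro bexI[OF _ imageI[of "e/2"]]) auto
    qed
    show "p (raw (mexp (0 + sc z * X))) = 0" if "z \<in> complex_of_real ` {0..}" for z
      using that z by (auto simp: sc_of_real)
  qed auto
  then show ?thesis by simp
qed

locale algebraic_matrix_group =
  fixes G :: "(complex^'n^'n) set"
  assumes linear_algebraic_group: "linear_algebraic_group G"
begin

definition GM :: "'n cmat set" where "GM = {X. raw X \<in> G}"

lemma raw_GM: "raw ` GM = G"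
proof
  show "G \<subseteq> raw ` GM"
  proof
    fix A assume "A \<in> G"
    then have "cmat A \<in> GM" by (simp add: GM_def)
    then have "raw (cmat A) \<in> raw ` GM" by (rule imageI)
    then show "A \<in> raw ` GM" by simp
  qed
qed (auto simp: GM_def)

lemma subgroup_G: "subgroup G GL"
  using linear_algebraic_group by (simp add: linear_algebraic_group_def)

text \<open>
  Among the invertible matrices, a closed set is cut out by all polynomials that vanish on it.
\<close>

lemma mem_G_iff: "A \<in> G \<longleftrightarrow> invertible A \<and> (\<forall>p\<in>poly_fun mscale. (\<forall>B\<in>G. p B = 0) \<longrightarrow> p A = 0)"
proof -
  obtain C where C: "closedin (zariski mscale) C" "G = C \<inter> {A. invertible A}"
    using linear_algebraic_group by (auto simp: linear_algebraic_group_def closedin_subtopology GL_def)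
  obtain F where F: "F \<subseteq> poly_fun mscale" "C = {x. \<forall>f\<in>F. f x = 0}"
    using C(1) by (auto simp: closedin_zariski)
  have G: "G = {A. invertible A \<and> (\<forall>f\<in>F. f A = 0)}" using C F by auto
  show ?thesis using F(1) unfolding G by blast
qed

lemma one_GM: "1 \<in> GM"
  using subgroup.one_closed[OF subgroup_G] by (simp add: GM_def GL_def)

lemma mult_GM: "X \<in> GM \<Longrightarrow> Y \<in> GM \<Longrightarrow> X * Y \<in> GM"
  using subgroup.m_closed[OF subgroup_G] by (simp add: GM_def GL_def)

lemma inverse_GM:
  assumes "X \<in> GM"
  obtains Y where "Y \<in> GM" "X * Y = 1" "Y * X = 1"
proof -
  have X: "raw X \<in> G" using assms by (simp add: GM_def)
  then have Xc: "raw X \<in> carrier GL" using subgroup.subset[OF subgroup_G] by blast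
  let ?I = "inv\<^bsub>GL\<^esub> (raw X)"
  have "?I \<in> G" by (rule subgroup.m_inv_closed[OF subgroup_G X])
  moreover have "raw X ** ?I = mat 1" "?I ** raw X = mat 1"
    using group.r_inv[OF group_GL Xc] group.l_inv[OF group_GL Xc] by (simp_all add: GL_def)
  ultimately show ?thesis by (intro that[of "cmat ?I"]) (simp_all add: GM_def cmat_eq_iff)
qed

lemma power_GM: "X \<in> GM \<Longrightarrow> X ^ k \<in> GM"
  by (induct k) (auto intro: one_GM mult_GM)

lemma GM_limit:
  assumes "\<And>i. h i \<in> GM" "h \<longlonglongrightarrow> X" "invertible (raw X)"
  shows "X \<in> GM"
proof -
  have "p (raw X) = 0" if p: "p \<in> poly_fun mscale" "\<forall>B\<in>G. p B = 0" for p
  proof -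
    have "(\<lambda>i. p (raw (h i))) \<longlonglongrightarrow> p (raw X)" by (rule tendsto_poly_fun[OF p(1) assms(2)])
    moreover have "p (raw (h i)) = 0" for i using assms(1)[of i] p(2) by (simp add: GM_def)
    ultimately show ?thesis by (simp add: LIMSEQ_const_iff)
  qed
  then show ?thesis using assms(3) mem_G_iff[of "raw X"] by (simp add: GM_def)
qed

text \<open>
  The parameter is complex, so that \<open>lie\<close> is visibly stable under complex scalars. It is enough to test
  nonnegative real parameters, by \<open>poly_zero_on_ray_imp_zero\<close>.
\<close>

definition lie :: "'n cmat set" where "lie = {X. \<forall>t. mexp (sc t * X) \<in> GM}"

lemma lie_exp: "X \<in> lie \<Longrightarrow> mexp (sc t * X) \<in> GM"
  by (simp add: lie_def)

lemma lie_exp_real: "X \<in> lie \<Longrightarrow> mexp (r *\<^sub>R X) \<in> GM"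
  using lie_exp[of X "of_real r"] by (simp add: sc_of_real)

lemma mexp_lie_in_GM: "X \<in> lie \<Longrightarrow> mexp X \<in> GM"
  using lie_exp[of X 1] by simp

lemma lieI_real:
  assumes "\<And>r. r \<ge> 0 \<Longrightarrow> mexp (r *\<^sub>R X) \<in> GM"
  shows "X \<in> lie"
proof -
  have "raw (mexp (sc t * X)) \<in> G" for t
  proof (subst mem_G_iff, intro conjI ballI impI invertible_mexp)
    fix p assume p: "p \<in> poly_fun mscale" "\<forall>B\<in>G. p B = 0"
    have "p (raw (mexp (r *\<^sub>R X))) = 0" if "r \<ge> 0" for r
      by (rule bspec[OF p(2)]) (use assms[OF that] in \<open>simp only: GM_def mem_Collect_eq\<close>)
    then show "p (raw (mexp (sc t * X))) = 0"
      by (rule poly_zero_on_ray_imp_zero[OF p(1)])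
  qed
  then show ?thesis by (simp add: lie_def GM_def)
qed

text \<open>
  A limit of secant directions at the identity is tangent to the group: powers of the \<open>h i\<close> stay in the
  group and converge to \<open>mexp (r *\<^sub>R Z)\<close>. This one criterion yields that \<open>lie\<close> is closed under addition
  and also that nothing transversal to \<open>lie\<close> belongs to the group near the identity.
\<close>

lemma lieI_sequence:
  assumes "\<And>i. h i \<in> GM" "(\<lambda>i. inverse (e i) *\<^sub>R (h i - 1)) \<longlonglongrightarrow> Z" "e \<longlonglongrightarrow> 0" "\<And>i. e i > 0"
  shows "Z \<in> lie"
proof (rule lieI_real)
  fix r :: real assume "r \<ge> 0"
  from power_tendsto_mexp[OF assms(2-4) this]
  show "mexp (r *\<^sub>R Z) \<in> GM"
    by (rule GM_limit[OF power_GM[OF assms(1)] _ invertible_mexp])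
qed

lemma lieI_curve:
  assumes "(\<gamma> has_vector_derivative Z) (at 0)" "\<gamma> 0 = 1" "\<And>s. \<gamma> s \<in> GM"
  shows "Z \<in> lie"
  using has_vector_derivative_quotient_tendsto[OF assms(1) LIMSEQ_inverse_real_of_nat]
  by (intro lieI_sequence[OF assms(3) _ LIMSEQ_inverse_real_of_nat]) (simp_all add: assms(2))

lemma lie_sc: "X \<in> lie \<Longrightarrow> sc t * X \<in> lie"
  by (auto simp: lie_def mult.assoc[symmetric] sc_mult[symmetric])

lemma lie_add:
  assumes "X \<in> lie" "Y \<in> lie"
  shows "X + Y \<in> lie"
proof (rule lieI_curve)
  have "((\<lambda>s. mexp (s *\<^sub>R X) * mexp (s *\<^sub>R Y)) has_vector_derivative
      (mexp (0 *\<^sub>R X) * Y + X * mexp (0 *\<^sub>R Y))) (at 0)"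
    by (rule has_vector_derivative_mult) (rule has_vector_derivative_mexp_0)+
  then show "((\<lambda>s. mexp (s *\<^sub>R X) * mexp (s *\<^sub>R Y)) has_vector_derivative (X + Y)) (at 0)"
    by (simp add: add.commute)
qed (auto intro: mult_GM lie_exp_real assms)

lemma lie_0: "0 \<in> lie"
  by (simp add: lie_def one_GM)

lemma subspace_lie: "subspace lie"
  unfolding subspace_def using lie_0 lie_add lie_sc[of _ "of_real _"] by (auto simp: sc_of_real)

lemma left_inverse_GM:
  assumes "g \<in> GM" "h * g = 1"
  shows "h \<in> GM" "g * h = 1"
proof -
  obtain h' where h': "h' \<in> GM" "g * h' = 1" using inverse_GM[OF assms(1)] by blast
  have "h = h * (g * h')" using h' by simp
  also have "\<dots> = h'" using assms(2) by (simp add: mult.assoc[symmetric])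
  finally show "h \<in> GM" "g * h = 1" using h' by simp_all
qed

lemma lie_Ad:
  assumes "g \<in> GM" "h * g = 1" "X \<in> lie"
  shows "g * X * h \<in> lie"
proof -
  have h: "h \<in> GM" by (rule left_inverse_GM[OF assms(1,2)])
  have "mexp (sc t * (g * X * h)) = g * mexp (sc t * X) * h" for t
    using mexp_conj[OF assms(2), of "sc t * X"] by (simp add: sc_left_commute mult.assoc)
  then show ?thesis using assms h by (auto simp: lie_def intro: mult_GM)
qed

lemma Ad_vector_derivative:
  "((\<lambda>s. mexp (s *\<^sub>R X) * Z * mexp (s *\<^sub>R (- X))) has_vector_derivative (X * Z - Z * X)) (at 0)"
proof -
  have "((\<lambda>s. mexp (s *\<^sub>R X) * Z) has_vector_derivative (X * Z)) (at 0)"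
    by (rule bounded_linear.has_vector_derivative[OF bounded_linear_mult_left has_vector_derivative_mexp_0])
  then have "((\<lambda>s. mexp (s *\<^sub>R X) * Z * mexp (s *\<^sub>R (- X))) has_vector_derivative
      (mexp (0 *\<^sub>R X) * Z * (- X) + X * Z * mexp (0 *\<^sub>R (- X)))) (at 0)"
    by (rule has_vector_derivative_mult) (rule has_vector_derivative_mexp_0)
  then show ?thesis by simp
qed

text \<open>
  The bracket with \<open>X\<close> is the derivative of the conjugation by \<open>mexp (s *\<^sub>R X)\<close>, and a stable subspace
  contains the derivatives of its curves.
\<close>

lemma Ad_stable_bracket:
  assumes a: "subspace a" and st: "\<And>g h X. g \<in> GM \<Longrightarrow> h * g = 1 \<Longrightarrow> X \<in> a \<Longrightarrow> g * X * h \<in> a"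
    and "X \<in> lie" "Z \<in> a"
  shows "X * Z - Z * X \<in> a"
proof (rule subspace_vector_derivative[OF a Ad_vector_derivative])
  show "mexp (s *\<^sub>R X) * Z * mexp (s *\<^sub>R (- X)) \<in> a" for s
    by (rule st[OF lie_exp_real[OF assms(3)] _ assms(4)]) (simp add: mexp_minus)
qed

lemma lie_bracket: "X \<in> lie \<Longrightarrow> Y \<in> lie \<Longrightarrow> X * Y - Y * X \<in> lie"
  by (rule Ad_stable_bracket[OF subspace_lie]) (auto intro: lie_Ad)

end

context algebraic_matrix_group
begin

section \<open>Abelian ideals and the radical\<close>

lemma poly_fun_commutator: "(\<lambda>A. (A ** B) $ i $ j - (B ** A) $ i $ j) \<in> poly_fun mscale"
  for B :: "complex^'n^'n"
proof (rule poly_fun.linear_form, unfold linear_form_iff, intro conjI allI)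
  fix C D :: "complex^'n^'n" and c
  have "cmat ((C + D) ** B) = cmat C * cmat B + cmat D * cmat B"
    "cmat (B ** (C + D)) = cmat B * cmat C + cmat B * cmat D"
    using distrib_right[of "cmat C" "cmat D" "cmat B"] distrib_left[of "cmat B" "cmat C" "cmat D"]
    by (simp_all add: cmat_eq_iff)
  then have "(C + D) ** B = C ** B + D ** B" "B ** (C + D) = B ** C + B ** D"
    by (simp_all add: cmat_eq_iff)
  then show "((C + D) ** B) $ i $ j - (B ** (C + D)) $ i $ j
      = (C ** B) $ i $ j - (B ** C) $ i $ j + ((D ** B) $ i $ j - (B ** D) $ i $ j)"
    by simp
  show "(mscale c C ** B) $ i $ j - (B ** mscale c C) $ i $ j = c * ((C ** B) $ i $ j - (B ** C) $ i $ j)"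
    by (simp only: mscale_mult) (simp add: mscale_def right_diff_distrib)
qed

lemma raw_eqI: "X * Y = 1 \<Longrightarrow> raw X ** raw Y = mat 1"
  using raw_simps(6)[of X Y] by simp

text \<open>
  As \<open>a\<close> is abelian, \<open>mexp\<close> maps it onto an abelian group, and this group is normalised by \<open>G\<close>. The
  Zariski closure \<open>H\<close> of the image in \<open>G\<close> inherits these properties, since each of them is a polynomial
  condition. The image is covered by entire curves \<open>z \<mapsto> mexp (X + z (Z - X))\<close>, so it and its closure are
  irreducible, hence connected. So \<open>H\<close> is contained in the radical; if that is trivial, \<open>mexp\<close> is constant
  on \<open>a\<close>.
\<close>

theorem abelian_ideal_trivial:
  assumes rad: "radical G = {mat 1}"
    and a: "subspace a" "a \<subseteq> lie"
    and sc: "\<And>t X. X \<in> a \<Longrightarrow> sc t * X \<in> a"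
    and Ad: "\<And>g h X. g \<in> GM \<Longrightarrow> h * g = 1 \<Longrightarrow> X \<in> a \<Longrightarrow> g * X * h \<in> a"
    and comm: "\<And>X Y. X \<in> a \<Longrightarrow> Y \<in> a \<Longrightarrow> X * Y = Y * X"
    and X: "X \<in> a"
  shows "X = 0"
proof -
  define I where "I = {p \<in> poly_fun mscale. \<forall>X\<in>a. p (raw (mexp X)) = 0}"
  define H where "H = {Y \<in> GM. \<forall>p\<in>I. p (raw Y) = 0}"
  have I: "p \<in> poly_fun mscale" "X \<in> a \<Longrightarrow> p (raw (mexp X)) = 0" if "p \<in> I" for p X
    using that by (simp_all add: I_def)
  have II: "p \<in> I" if "p \<in> poly_fun mscale" "\<And>X. X \<in> a \<Longrightarrow> p (raw (mexp X)) = 0" for p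
    using that by (simp add: I_def)
  have H: "Y \<in> GM" "p \<in> I \<Longrightarrow> p (raw Y) = 0" if "Y \<in> H" for p Y
    using that by (simp_all add: H_def)
  have HI: "Y \<in> H" if "Y \<in> GM" "\<And>p. p \<in> I \<Longrightarrow> p (raw Y) = 0" for Y
    using that by (simp add: H_def)
  have K: "mexp X \<in> H" if "X \<in> a" for X
    by (rule HI) (use that a(2) I mexp_lie_in_GM in auto)
  have addK: "mexp X * mexp Y = mexp (X + Y)" if "X \<in> a" "Y \<in> a" for X Y
    by (rule mexp_add[symmetric]) (rule comm[OF that])
  have one: "1 \<in> H" using K[OF subspace_0[OF a(1)]] by simp
  have multK: "mexp X * Y \<in> H" if XY: "X \<in> a" "Y \<in> H" for X Y
  proof (rule HI)
    show "mexp X * Y \<in> GM" using K[OF XY(1)] XY(2) H(1) mult_GM by blast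
    fix p assume p: "p \<in> I"
    \<comment> \<open>Fixing one factor, the condition on the product is polynomial in the other factor. This is used first with a factor from the image of \<open>a\<close> and then with one from \<open>H\<close>.\<close>
    have "(\<lambda>A. p (raw (mexp X) ** A ** mat 1)) \<in> I"
    proof (rule II[OF poly_fun_mult[OF I(1)[OF p]]])
      fix Z assume "Z \<in> a"
      then show "p (raw (mexp X) ** raw (mexp Z) ** mat 1) = 0"
        using I(2)[OF p subspace_add[OF a(1) XY(1) \<open>Z \<in> a\<close>]] addK[OF XY(1) \<open>Z \<in> a\<close>, symmetric] by simp
    qed
    from H(2)[OF XY(2) this] show "p (raw (mexp X * Y)) = 0" by simp
  qed
  have mult: "Z * Y \<in> H" if ZY: "Z \<in> H" "Y \<in> H" for Z Y
  proof (rule HI)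
    show "Z * Y \<in> GM" using ZY H(1) mult_GM by blast
    fix p assume p: "p \<in> I"
    have "(\<lambda>A. p (mat 1 ** A ** raw Y)) \<in> I"
    proof (rule II[OF poly_fun_mult[OF I(1)[OF p]]])
      fix X assume "X \<in> a"
      from H(2)[OF multK[OF this ZY(2)] p] show "p (mat 1 ** raw (mexp X) ** raw Y) = 0" by simp
    qed
    from H(2)[OF ZY(1) this] show "p (raw (Z * Y)) = 0" by simp
  qed
  have inv: "W \<in> H" if Y: "Y \<in> H" and W: "W \<in> GM" "Y * W = 1" for Y W
  proof (rule HI[OF W(1)])
    fix p assume p: "p \<in> I"
    obtain q k where q: "q \<in> poly_fun mscale" "\<And>A. invertible A \<Longrightarrow> p (matrix_inv A) * det A ^ k = q A"
      using poly_fun_matrix_inv[OF I(1)[OF p]] by blast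
    have minv: "matrix_inv (raw U) = raw V" "invertible (raw U)" if UV: "U * V = 1" for U V :: "'n cmat"
    proof -
      have 1: "raw U ** raw V = mat 1" by (rule raw_eqI[OF UV])
      then have 2: "raw V ** raw U = mat 1" by (simp add: matrix_left_right_inverse)
      show inv: "invertible (raw U)" unfolding invertible_def using 1 2 by blast
      have "matrix_inv (raw U) = matrix_inv (raw U) ** (raw U ** raw V)" by (simp add: 1)
      also have "\<dots> = raw V" by (simp add: matrix_mul_assoc matrix_inv_mult_right[OF inv])
      finally show "matrix_inv (raw U) = raw V" .
    qed
    \<comment> \<open>The polynomial \<open>q\<close> vanishes on the image of \<open>a\<close>, because \<open>mexp (- X)\<close> is the inverse of \<open>mexp X\<close>.\<close>
    have "q \<in> I"
    proof (rule II[OF q(1)])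
      fix X assume "X \<in> a"
      then have "p (raw (mexp (- X))) = 0" by (rule I(2)[OF p subspace_neg[OF a(1)]])
      then show "q (raw (mexp X)) = 0"
        using q(2)[OF minv(2)[OF mexp_minus(1)], of X] minv(1)[OF mexp_minus(1), of X] by simp
    qed
    then have "q (raw Y) = 0" by (rule H(2)[OF Y])
    then have "p (raw W) * det (raw Y) ^ k = 0"
      using q(2)[OF minv(2)[OF W(2)]] minv(1)[OF W(2)] by simp
    moreover have "det (raw Y) \<noteq> 0" using minv(2)[OF W(2)] by (simp add: invertible_det_nz)
    ultimately show "p (raw W) = 0" by simp
  qed
  have conj: "g * Y * h \<in> H" if g: "g \<in> GM" "h \<in> GM" "h * g = 1" and Y: "Y \<in> H" for g h Y
  proof (rule HI)
    show "g * Y * h \<in> GM" using g Y H(1) mult_GM by blast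
    fix p assume p: "p \<in> I"
    have "(\<lambda>A. p (raw g ** A ** raw h)) \<in> I"
    proof (rule II[OF poly_fun_mult[OF I(1)[OF p]]])
      fix X assume "X \<in> a"
      from I(2)[OF p Ad[OF g(1,3) this]] mexp_conj[OF g(3), of X]
      show "p (raw g ** raw (mexp X) ** raw h) = 0" by simp
    qed
    from H(2)[OF Y this] show "p (raw (g * Y * h)) = 0" by simp
  qed
  have commH: "Y * Z = Z * Y" if YZ: "Y \<in> H" "Z \<in> H" for Y Z
  proof -
    have step: "Z * W = W * Z" if Z: "Z \<in> H" and W: "\<And>X. X \<in> a \<Longrightarrow> mexp X * W = W * mexp X" for Z W
    proof -
      have "(\<lambda>A. (A ** raw W) $ i $ j - (raw W ** A) $ i $ j) \<in> I" for i j
      proof (rule II[OF poly_fun_commutator])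
        fix X assume "X \<in> a"
        from arg_cong[OF W[OF this], of raw]
        show "(raw (mexp X) ** raw W) $ i $ j - (raw W ** raw (mexp X)) $ i $ j = 0" by simp
      qed
      from H(2)[OF Z this] have "(raw Z ** raw W) $ i $ j = (raw W ** raw Z) $ i $ j" for i j
        by simp
      then show ?thesis by (simp add: cmat_eq_iff vec_eq_iff)
    qed
    have "Z * mexp X = mexp X * Z" if "X \<in> a" for X
      by (rule step[OF YZ(2)]) (simp add: addK that add.commute)
    then show ?thesis by (intro step[OF YZ(1)]) simp
  qed
  let ?H = "raw ` H" and ?Gr = "GL\<lparr>carrier := G\<rparr>"
  have HG: "?H \<subseteq> G" using H(1) raw_GM by blast
  have grp: "group ?Gr" by (rule subgroup.subgroup_is_group[OF subgroup_G group_GL])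
  have carr: "carrier ?Gr = G" "x \<otimes>\<^bsub>?Gr\<^esub> y = x ** y" "\<one>\<^bsub>?Gr\<^esub> = mat 1" for x y
    by (simp_all add: GL_def)
  have invGr: "cmat (inv\<^bsub>?Gr\<^esub> raw Y) \<in> GM" "Y * cmat (inv\<^bsub>?Gr\<^esub> raw Y) = 1" "cmat (inv\<^bsub>?Gr\<^esub> raw Y) * Y = 1"
    if "Y \<in> GM" for Y
  proof -
    have "raw Y \<in> carrier ?Gr" using that by (simp add: GM_def)
    from group.inv_closed[OF grp this] group.r_inv[OF grp this] group.l_inv[OF grp this]
    show "cmat (inv\<^bsub>?Gr\<^esub> raw Y) \<in> GM" "Y * cmat (inv\<^bsub>?Gr\<^esub> raw Y) = 1" "cmat (inv\<^bsub>?Gr\<^esub> raw Y) * Y = 1"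
      unfolding carr by (simp_all add: GM_def cmat_eq_iff)
  qed
  have subH: "subgroup ?H ?Gr"
  proof (rule group.subgroupI[OF grp])
    show "?H \<subseteq> carrier ?Gr" "?H \<noteq> {}" using HG one by (auto simp: carr)
    show "inv\<^bsub>?Gr\<^esub> x \<in> ?H" if "x \<in> ?H" for x
    proof -
      obtain Y where Y: "Y \<in> H" "x = raw Y" using \<open>x \<in> ?H\<close> by blast
      have "cmat (inv\<^bsub>?Gr\<^esub> raw Y) \<in> H" by (rule inv[OF Y(1) invGr(1,2)[OF H(1)[OF Y(1)]]])
      from imageI[OF this, of raw] show ?thesis by (simp add: Y)
    qed
    show "x \<otimes>\<^bsub>?Gr\<^esub> y \<in> ?H" if "x \<in> ?H" "y \<in> ?H" for x y
    proof -
      obtain Y Z where "Y \<in> H" "x = raw Y" "Z \<in> H" "y = raw Z" using \<open>x \<in> ?H\<close> \<open>y \<in> ?H\<close> by blast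
      with imageI[OF mult, of Y Z raw] show ?thesis by (simp only: carr(2) raw_simps(6))
    qed
  qed
  have normal: "?H \<lhd> ?Gr"
    unfolding group.normal_inv_iff[OF grp]
  proof (intro conjI subH ballI)
    fix x y assume "x \<in> carrier ?Gr" "y \<in> ?H"
    then obtain Y where Y: "Y \<in> H" "y = raw Y" and x: "cmat x \<in> GM" by (auto simp: carr GM_def)
    have "cmat x * Y * cmat (inv\<^bsub>?Gr\<^esub> raw (cmat x)) \<in> H"
      by (rule conj[OF x invGr(1,3)[OF x] Y(1)])
    from imageI[OF this, of raw]
    show "x \<otimes>\<^bsub>?Gr\<^esub> y \<otimes>\<^bsub>?Gr\<^esub> inv\<^bsub>?Gr\<^esub> x \<in> ?H" by (simp only: carr(2) Y(2) raw_simps(6) raw_cmat)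
  qed
  have closed: "closedin (subtopology (zariski mscale) G) ?H"
    unfolding closedin_subtopology closedin_zariski
  proof (intro exI conjI)
    show "I \<subseteq> poly_fun mscale" using I(1) by blast
    show "{x. \<forall>f\<in>I. f x = 0} = {x. \<forall>f\<in>I. f x = 0}" ..
    show "?H = {x. \<forall>f\<in>I. f x = 0} \<inter> G"
    proof (intro equalityI subsetI)
      fix x assume x: "x \<in> {x. \<forall>f\<in>I. f x = 0} \<inter> G"
      then have "cmat x \<in> H" by (intro HI) (auto simp: GM_def)
      from imageI[OF this, of raw] show "x \<in> ?H" by simp
    qed (use H HG in auto)
  qed
  have irrK: "irreducible_in (zariski mscale) (raw ` mexp ` a)"
  proof (rule irreducible_in_zariski_curves)
    show "mexp ` a \<noteq> {}" using X by blast
    fix A B assume "A \<in> mexp ` a" "B \<in> mexp ` a"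
    then obtain X Z where XZ: "X \<in> a" "A = mexp X" "Z \<in> a" "B = mexp Z" by blast
    show "\<exists>S \<gamma> s t. open S \<and> connected S \<and> \<gamma> ` S \<subseteq> mexp ` a \<and> s \<in> S \<and> t \<in> S \<and>
        \<gamma> s = A \<and> \<gamma> t = B \<and> (\<forall>p\<in>poly_fun mscale. (\<lambda>z. p (raw (\<gamma> z))) holomorphic_on S)"
    proof (intro exI conjI ballI)
      show "(\<lambda>z. mexp (X + sc z * (Z - X))) ` UNIV \<subseteq> mexp ` a"
        using XZ by (auto intro!: imageI subspace_add[OF a(1)] sc subspace_diff[OF a(1)])
      show "(\<lambda>z. p (raw (mexp (X + sc z * (Z - X))))) holomorphic_on UNIV" if "p \<in> poly_fun mscale" for p
        by (rule holomorphic_poly_mexp_line[OF that])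
      show "mexp (X + sc 0 * (Z - X)) = A" "mexp (X + sc 1 * (Z - X)) = B" using XZ by simp_all
    qed (simp_all add: connected_UNIV)
  qed
  have irrH: "irreducible_in (zariski mscale) ?H"
    unfolding irreducible_in_def
  proof (intro conjI allI impI)
    show "?H \<subseteq> topspace (zariski mscale)" "?H \<noteq> {}" using one by auto
    fix A B assume A: "closedin (zariski mscale) A" and B: "closedin (zariski mscale) B" and sub: "?H \<subseteq> A \<union> B"
    have KH: "raw ` mexp ` a \<subseteq> ?H" using K by blast
    have ext: "?H \<subseteq> C" if C: "closedin (zariski mscale) C" "raw ` mexp ` a \<subseteq> C" for C
    proof -
      obtain F where F: "F \<subseteq> poly_fun mscale" "C = {x. \<forall>f\<in>F. f x = 0}"
        using C(1) unfolding closedin_zariski by blast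
      have "F \<subseteq> I" using F C(2) by (auto intro!: II)
      then show ?thesis using H(2) F(2) by blast
    qed
    have "raw ` mexp ` a \<subseteq> A \<union> B" using KH sub by (rule order_trans)
    then have "raw ` mexp ` a \<subseteq> A \<or> raw ` mexp ` a \<subseteq> B"
      using irrK A B unfolding irreducible_in_def by blast
    then show "?H \<subseteq> A \<or> ?H \<subseteq> B" using ext A B by blast
  qed
  have solv: "solvable (GL\<lparr>carrier := ?H\<rparr>)"
  proof -
    let ?L = "GL\<lparr>carrier := ?H\<rparr>"
    have grpL: "group ?L" using subgroup.subgroup_is_group[OF subH grp] by simp
    have carrL: "carrier ?L = ?H" by simp
    have multL: "x \<otimes>\<^bsub>?L\<^esub> y = x ** y" for x y by (simp add: GL_def)
    have commL: "x \<otimes>\<^bsub>?L\<^esub> y = y \<otimes>\<^bsub>?L\<^esub> x" if xy: "x \<in> carrier ?L" "y \<in> carrier ?L" for x y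
    proof -
      obtain Y Z where YZ: "Y \<in> H" "x = raw Y" "Z \<in> H" "y = raw Z" using xy unfolding carrL by blast
      from arg_cong[OF commH[OF YZ(1,3)], of raw] show ?thesis by (simp only: multL YZ raw_simps(6))
    qed
    interpret L: group ?L by (rule grpL)
    have "h1 \<otimes>\<^bsub>?L\<^esub> h2 \<otimes>\<^bsub>?L\<^esub> inv\<^bsub>?L\<^esub> h1 \<otimes>\<^bsub>?L\<^esub> inv\<^bsub>?L\<^esub> h2 = \<one>\<^bsub>?L\<^esub>"
      if h: "h1 \<in> carrier ?L" "h2 \<in> carrier ?L" for h1 h2
    proof -
      have "h1 \<otimes>\<^bsub>?L\<^esub> h2 \<otimes>\<^bsub>?L\<^esub> inv\<^bsub>?L\<^esub> h1 = h2 \<otimes>\<^bsub>?L\<^esub> (h1 \<otimes>\<^bsub>?L\<^esub> inv\<^bsub>?L\<^esub> h1)"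
        unfolding commL[OF h] by (rule L.m_assoc[OF h(2,1) L.inv_closed[OF h(1)]])
      also have "\<dots> = h2" using h by (simp only: L.r_inv L.r_one)
      finally show ?thesis using L.r_inv[OF h(2)] by simp
    qed
    then have ds: "derived_set ?L (carrier ?L) \<subseteq> {\<one>\<^bsub>?L\<^esub>}" by blast
    have "generate ?L (derived_set ?L (carrier ?L)) \<subseteq> {\<one>\<^bsub>?L\<^esub>}"
      by (rule L.generate_subgroup_incl[OF ds L.triv_subgroup])
    then have "derived ?L (carrier ?L) = {\<one>\<^bsub>?L\<^esub>}"
      unfolding derived_def using generate.one[of ?L] by blast
    then have "(derived ?L ^^ 1) (carrier ?L) = {\<one>\<^bsub>?L\<^esub>}" by simp
    from L.trivial_derived_seq_imp_solvable[OF L.subgroup_self this]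
    show ?thesis by (simp only: solvable_def)
  qed
  have sub: "?H \<subseteq> radical G"
    unfolding radical_def
    by (rule Union_upper) (use normal closed irreducible_in_imp_connectedin[OF irrH] solv in blast)
  have "mexp (s *\<^sub>R X) = 1" for s :: real
  proof -
    have "s *\<^sub>R X \<in> a" by (rule subspace_scale[OF a(1) X])
    from K[OF this] sub rad have "raw (mexp (s *\<^sub>R X)) = mat 1" by blast
    then show ?thesis by (simp add: cmat_eq_iff)
  qed
  then have "((\<lambda>s::real. 1) has_vector_derivative X) (at 0)"
    using has_vector_derivative_mexp_0[of X] by simp
  from vector_derivative_unique_at[OF this has_vector_derivative_const] show "X = 0" .
qed

end

section \<open>Nilpotent Lie algebras of matrices\<close>

text \<open>
  Nilpotency of the associative algebra without unit that \<open>S\<close> generates, in terms of words.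
\<close>

definition nil_words :: "'n::finite cmat set \<Rightarrow> nat \<Rightarrow> bool" where
  "nil_words S N \<longleftrightarrow> (\<forall>xs. set xs \<subseteq> S \<longrightarrow> N \<le> length xs \<longrightarrow> prod_list xs = 0)"

lemma nil_wordsI:
  assumes "\<And>xs. set xs \<subseteq> S \<Longrightarrow> length xs = N \<Longrightarrow> prod_list xs = 0"
  shows "nil_words S N"
  unfolding nil_words_def
proof (intro allI impI)
  fix xs assume xs: "set xs \<subseteq> S" "N \<le> length xs"
  have "prod_list (take N xs) = 0"
    using xs by (intro assms) (auto dest: in_set_takeD)
  moreover have "prod_list xs = prod_list (take N xs) * prod_list (drop N xs)"
    by (simp flip: prod_list.append)
  ultimately show "prod_list xs = 0" by simp
qed

text \<open>
  An iterated bracket of \<open>z\<close> with \<open>2 N\<close> elements of \<open>S\<close> is a combination of words \<open>u z v\<close> in which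
  \<open>u\<close> and \<open>v\<close> have \<open>2 N\<close> letters together, so one of them has at least \<open>N\<close> and the bracket is zero. A
  sequence of brackets that starts outside \<open>T\<close> therefore has to enter \<open>T\<close>; the last term outside \<open>T\<close> is
  the required \<open>y\<close>.
\<close>

lemma iterated_bracket_leaves:
  fixes S :: "'n::finite cmat set"
  assumes nil: "nil_words S N" and T: "0 \<in> T" and z: "z \<in> n" "z \<notin> T"
    and n: "\<And>x s. x \<in> n \<Longrightarrow> s \<in> S \<Longrightarrow> x * s - s * x \<in> n"
  shows "\<exists>y\<in>n. y \<notin> T \<and> (\<forall>s\<in>S. y * s - s * y \<in> T)"
proof -
  define Q where "Q k z \<longleftrightarrow> (\<forall>us vs. set us \<subseteq> S \<longrightarrow> set vs \<subseteq> S \<longrightarrow> k \<le> length us + length vs \<longrightarrow>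
      prod_list us * z * prod_list vs = 0)" for k z
  have "\<exists>y\<in>n. y \<notin> T \<and> (\<forall>s\<in>S. y * s - s * y \<in> T)" if "Q k z" "z \<in> n" "z \<notin> T" for k z
    using that
  proof (induct k arbitrary: z)
    case 0
    then have "prod_list [] * z * prod_list [] = 0" unfolding Q_def by (metis empty_subsetI list.set(1) le0)
    then show ?case using T 0 by simp
  next
    case (Suc k)
    show ?case
    proof (cases "\<forall>s\<in>S. z * s - s * z \<in> T")
      case True then show ?thesis using Suc by blast
    next
      case False
      then obtain s where s: "s \<in> S" "z * s - s * z \<notin> T" by blast
      have "Q k (z * s - s * z)"
        unfolding Q_def
      proof (intro allI impI)
        fix us vs assume w: "set us \<subseteq> S" "set vs \<subseteq> S" "k \<le> length us + length vs"
        have "prod_list us * z * prod_list (s # vs) = 0" "prod_list (us @ [s]) * z * prod_list vs = 0"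
          using Suc(2)[unfolded Q_def, rule_format, of us "s # vs"]
            Suc(2)[unfolded Q_def, rule_format, of "us @ [s]" vs] w s(1) by auto
        then show "prod_list us * (z * s - s * z) * prod_list vs = 0"
          by (simp add: algebra_simps)
      qed
      from Suc(1)[OF this n[OF Suc(3) s(1)] s(2)] show ?thesis .
    qed
  qed
  moreover have "Q (N + N) z"
    unfolding Q_def
  proof (intro allI impI)
    fix us vs assume w: "set us \<subseteq> S" "set vs \<subseteq> S" "N + N \<le> length us + length vs"
    then have "N \<le> length us \<or> N \<le> length vs" by linarith
    then have "prod_list us = 0 \<or> prod_list vs = 0" using nil w unfolding nil_words_def by blast
    then show "prod_list us * z * prod_list vs = 0" by auto
  qed
  ultimately show ?thesis using z by blast
qed

text \<open>
  Let \<open>W i\<close> be the span of all matrices with at least \<open>i\<close> left factors from \<open>S\<close>. Left multiplication by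
  elements of \<open>S\<close> raises this filtration by one, and \<open>y\<close> preserves it as \<open>y\<close> normalises \<open>S\<close>. Modulo maps
  that raise the filtration, a product of \<open>p\<close> elements of \<open>S + \<real> y\<close> is a multiple of \<open>y ^ p = 0\<close>. So \<open>p N\<close>
  factors map \<open>W 0\<close> into \<open>W N = 0\<close>.
\<close>

lemma nil_words_extend:
  fixes S :: "'n::finite cmat set"
  assumes S: "subspace S" and nil: "nil_words S N" and y: "y ^ p = 0"
    and br: "\<And>s. s \<in> S \<Longrightarrow> y * s - s * y \<in> S"
  shows "nil_words (span (insert y S)) (p * N)"
proof -
  define W where "W i = span {prod_list xs * m | xs m. set xs \<subseteq> S \<and> i \<le> length xs}" for i
  have Wsub: "subspace (W i)" for i by (simp add: W_def)
  have Wgen: "prod_list xs * m \<in> W i" if "set xs \<subseteq> S" "i \<le> length xs" for xs m i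
    unfolding W_def by (rule span_base) (use that in blast)
  have Wind: "f * w \<in> W j"
    if w: "w \<in> W i" and gen: "\<And>xs m. set xs \<subseteq> S \<Longrightarrow> i \<le> length xs \<Longrightarrow> f * (prod_list xs * m) \<in> W j" for f w i j
    using w unfolding W_def[of i]
  proof (induct rule: span_induct_alt)
    case base then show ?case by (simp add: subspace_0[OF Wsub])
  next
    case (step c x z)
    then obtain xs m where x: "x = prod_list xs * m" "set xs \<subseteq> S" "i \<le> length xs" by blast
    have "f * (c *\<^sub>R x + z) = c *\<^sub>R (f * x) + f * z" by (simp add: distrib_left)
    moreover have "f * x \<in> W j" unfolding x(1) by (rule gen[OF x(2,3)])
    ultimately show ?case using step by (simp add: subspace_add[OF Wsub] subspace_scale[OF Wsub])
  qed
  have sW: "s * w \<in> W (Suc i)" if "s \<in> S" "w \<in> W i" for s w i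
  proof (rule Wind[OF that(2)])
    fix xs m assume "set xs \<subseteq> S" "i \<le> length xs"
    then show "s * (prod_list xs * m) \<in> W (Suc i)"
      using Wgen[of "s # xs" "Suc i" m] that(1) by (simp add: mult.assoc)
  qed
  have Wdec: "W (Suc i) \<subseteq> W i" for i
    unfolding W_def by (rule span_mono) auto
  have yW0: "y * (prod_list xs * m) \<in> W (length xs)" if "set xs \<subseteq> S" for xs m
    using that
  proof (induct xs)
    case Nil
    then show ?case using Wgen[of "[]" 0 "y * m"] by simp
  next
    case (Cons s xs)
    have "y * (prod_list (s # xs) * m) = s * (y * (prod_list xs * m)) + prod_list ((y * s - s * y) # xs) * m"
      by (simp add: algebra_simps)
    moreover have "s * (y * (prod_list xs * m)) \<in> W (length (s # xs))"
      using Cons sW[of s "y * (prod_list xs * m)" "length xs"] by simp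
    moreover have "prod_list ((y * s - s * y) # xs) * m \<in> W (length (s # xs))"
      using Cons br by (intro Wgen) auto
    ultimately show ?case by (simp add: subspace_add[OF Wsub])
  qed
  have Wmono: "W j \<subseteq> W i" if "i \<le> j" for i j
    unfolding W_def by (rule span_mono) (use that in auto)
  have yW: "y * w \<in> W i" if "w \<in> W i" for w i
    by (rule Wind[OF that]) (use yW0 Wmono in blast)
  let ?S = "span (insert y S)"
  have dec: "\<exists>k s. s \<in> S \<and> u = s + k *\<^sub>R y" if u: "u \<in> ?S" for u
  proof -
    obtain k where "u - k *\<^sub>R y \<in> span S" using u unfolding span_breakdown_eq by blast
    then have "u - k *\<^sub>R y \<in> S" by (simp only: span_eq_iff[THEN iffD2, OF S])
    then show ?thesis by (intro exI[of _ k] exI[of _ "u - k *\<^sub>R y"]) simp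
  qed
  define R where "R = {f. \<forall>i. \<forall>w\<in>W i. f * w \<in> W (Suc i)}"
  have uW: "u * w \<in> W i" if u: "u \<in> ?S" and w: "w \<in> W i" for u w i
  proof -
    obtain k s where "s \<in> S" "u = s + k *\<^sub>R y" using dec[OF u] by blast
    moreover have "s * w \<in> W i" using sW[OF \<open>s \<in> S\<close> w] Wdec by blast
    ultimately show ?thesis using yW[OF w]
      by (simp add: distrib_right subspace_add[OF Wsub] subspace_scale[OF Wsub])
  qed
  have usW: "prod_list us * w \<in> W i" if "set us \<subseteq> ?S" "w \<in> W i" for us w i
    using that by (induct us) (auto simp: mult.assoc uW)
  have block: "\<exists>c. prod_list us - c *\<^sub>R y ^ length us \<in> R" if "set us \<subseteq> ?S" for us
    using that
  proof (induct us)
    case Nil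
    show ?case by (rule exI[of _ 1]) (simp add: R_def subspace_0[OF Wsub])
  next
    case (Cons u us)
    then obtain c where c: "prod_list us - c *\<^sub>R y ^ length us \<in> R" by auto
    obtain k s where ks: "s \<in> S" "u = s + k *\<^sub>R y" using dec[of u] Cons by auto
    let ?r = "prod_list us - c *\<^sub>R y ^ length us"
    have "prod_list (u # us) - (k * c) *\<^sub>R y ^ length (u # us) = s * prod_list us + k *\<^sub>R (y * ?r)"
      by (simp add: ks algebra_simps)
    moreover have "s * prod_list us + k *\<^sub>R (y * ?r) \<in> R"
      unfolding R_def
    proof (intro CollectI allI ballI)
      fix i w assume w: "w \<in> W i"
      have "s * (prod_list us * w) \<in> W (Suc i)"
        by (rule sW[OF ks(1) usW[OF _ w]]) (use Cons in simp)
      moreover have "?r * w \<in> W (Suc i)" using c w unfolding R_def by blast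
      then have "y * (?r * w) \<in> W (Suc i)" by (rule yW)
      moreover have "(s * prod_list us + k *\<^sub>R (y * ?r)) * w = s * (prod_list us * w) + k *\<^sub>R (y * (?r * w))"
        by (simp add: distrib_right mult.assoc)
      ultimately show "(s * prod_list us + k *\<^sub>R (y * ?r)) * w \<in> W (Suc i)"
        by (simp add: subspace_add[OF Wsub] subspace_scale[OF Wsub])
    qed
    ultimately show ?case by metis
  qed
  have blocks: "prod_list us * w \<in> W (i + k)" if "set us \<subseteq> ?S" "length us = p * k" "w \<in> W i" for us k w i
    using that
  proof (induct k arbitrary: us)
    case (Suc k)
    obtain c where "prod_list (take p us) - c *\<^sub>R y ^ length (take p us) \<in> R"
      using block[of "take p us"] Suc(2) set_take_subset[of p us] by blast
    then have "prod_list (take p us) \<in> R" using Suc(3) y by simp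
    moreover have "prod_list (drop p us) * w \<in> W (i + k)"
      by (rule Suc(1)[OF _ _ Suc(4)]) (use Suc(2,3) set_drop_subset[of p us] in auto)
    ultimately have "prod_list (take p us) * (prod_list (drop p us) * w) \<in> W (i + Suc k)"
      unfolding R_def by simp
    moreover have "prod_list us = prod_list (take p us) * prod_list (drop p us)"
      by (simp flip: prod_list.append)
    ultimately show ?case by (simp add: mult.assoc)
  qed simp
  show ?thesis
  proof (rule nil_wordsI)
    fix us assume us: "set us \<subseteq> ?S" "length us = p * N"
    have "1 \<in> W 0" using Wgen[of "[]" 0 1] by simp
    from blocks[OF us this] have "prod_list us \<in> W N" by simp
    moreover have "W N \<subseteq> {0}"
      unfolding W_def using nil by (intro span_minimal) (auto simp: nil_words_def)
    ultimately show "prod_list us = 0" by blast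
  qed
qed

text \<open>
  Among the subspaces of \<open>n\<close> with nilpotent words take one, \<open>S\<close>, of largest dimension. If it is proper,
  some \<open>y\<close> of \<open>n\<close> outside \<open>S\<close> normalises \<open>S\<close>, and \<open>S + \<real> y\<close> has nilpotent words as well.
\<close>

theorem Engel_nil_words:
  fixes n :: "'n::finite cmat set"
  assumes n: "subspace n" and br: "\<And>x y. x \<in> n \<Longrightarrow> y \<in> n \<Longrightarrow> x * y - y * x \<in> n"
    and nil: "\<And>x. x \<in> n \<Longrightarrow> \<exists>k. x ^ k = 0"
  shows "\<exists>N. nil_words n N"
proof -
  define P where "P S \<longleftrightarrow> subspace S \<and> S \<subseteq> n \<and> (\<exists>N. nil_words S N)" for S
  have P0: "P {0}"
  proof -
    have "nil_words {0 :: 'n cmat} 1"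
    proof (rule nil_wordsI)
      fix xs :: "'n cmat list" assume "set xs \<subseteq> {0}" "length xs = 1"
      then show "prod_list xs = 0" by (cases xs) auto
    qed
    then show ?thesis unfolding P_def using subspace_0[OF n] subspace_single_0 by blast
  qed
  have "\<exists>S. P S \<and> (\<forall>T. P T \<longrightarrow> dim T \<le> dim S)"
    by (rule ex_has_greatest_nat[of P _ _ "Suc DIM('n cmat)", OF P0]) (simp add: dim_subset_UNIV less_Suc_eq_le)
  then obtain S where S: "P S" "\<And>T. P T \<Longrightarrow> dim T \<le> dim S" by blast
  obtain N where N: "nil_words S N" and Ss: "subspace S" "S \<subseteq> n" using S(1) unfolding P_def by blast
  have "n \<subseteq> S"
  proof (rule ccontr)
    assume "\<not> n \<subseteq> S"
    then obtain z where z: "z \<in> n" "z \<notin> S" by blast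
    obtain y where y: "y \<in> n" "y \<notin> S" "\<And>s. s \<in> S \<Longrightarrow> y * s - s * y \<in> S"
      using iterated_bracket_leaves[OF N subspace_0[OF Ss(1)] z] br Ss(2) by blast
    obtain p where p: "y ^ p = 0" using nil[OF y(1)] by blast
    have "P (span (insert y S))"
      unfolding P_def
    proof (intro conjI exI)
      show "span (insert y S) \<subseteq> n" by (rule span_minimal) (use y Ss n in auto)
      show "nil_words (span (insert y S)) (p * N)" by (rule nil_words_extend[OF Ss(1) N p y(3)])
    qed simp
    from S(2)[OF this] have "dim (insert y S) \<le> dim S" by simp
    moreover have "y \<notin> span S" unfolding span_eq_iff[THEN iffD2, OF Ss(1)] by (rule y(2))
    ultimately show False by (simp add: dim_insert)
  qed
  then have "n = S" using Ss(2) by blast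
  then show ?thesis using N by blast
qed

text \<open>
  Bracket a nonzero element as long as the result is nonzero.
\<close>

lemma nilpotent_Lie_algebra_center:
  fixes n :: "'n::finite cmat set"
  assumes n: "subspace n" and br: "\<And>x y. x \<in> n \<Longrightarrow> y \<in> n \<Longrightarrow> x * y - y * x \<in> n"
    and nil: "\<And>x. x \<in> n \<Longrightarrow> \<exists>k. x ^ k = 0" and z: "z \<in> n" "z \<noteq> 0"
  shows "\<exists>y\<in>n. y \<noteq> 0 \<and> (\<forall>s\<in>n. y * s = s * y)"
proof -
  obtain N where "nil_words n N" using Engel_nil_words[OF n br nil] by blast
  from iterated_bracket_leaves[OF this, of "{0}" z n] br z
  obtain y where "y \<in> n" "y \<noteq> 0" "\<forall>s\<in>n. y * s = s * y" by auto
  then show ?thesis by blast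
qed

section \<open>Exponential polynomials\<close>

text \<open>
  Induction on the number of exponents and then on the degree of the coefficient of \<open>exp (\<nu> t)\<close>. The
  operator \<open>d/dt - \<nu>\<close> lowers this degree, while on the coefficient of \<open>exp (\<mu> t)\<close> with \<open>\<mu> \<noteq> \<nu>\<close> it acts as
  \<open>q \<mapsto> q' + (\<mu> - \<nu>) q\<close>, which is injective.
\<close>

lemma exp_polynomials_independent:
  fixes Q :: "complex \<Rightarrow> complex poly"
  assumes "finite S" "\<And>t. (\<Sum>\<mu>\<in>S. poly (Q \<mu>) t * exp (\<mu> * t)) = 0" "\<mu> \<in> S"
  shows "Q \<mu> = 0"
  using assms
proof (induct S arbitrary: Q \<mu> rule: finite_induct)
  case (insert \<nu> S)
  have main: "\<forall>\<mu>\<in>insert \<nu> S. Q \<mu> = 0"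
    if "(if Q \<nu> = 0 then 0 else Suc (degree (Q \<nu>))) = m"
      "\<And>t. (\<Sum>\<mu>\<in>insert \<nu> S. poly (Q \<mu>) t * exp (\<mu> * t)) = 0" for m and Q :: "complex \<Rightarrow> complex poly"
    using that
  proof (induct m arbitrary: Q rule: less_induct)
    case (less m)
    show ?case
    proof (cases "Q \<nu> = 0")
      case True
      then have "(\<Sum>\<mu>\<in>S. poly (Q \<mu>) t * exp (\<mu> * t)) = 0" for t
        using less(3)[of t] insert(1,2) by simp
      then show ?thesis using insert(3) True by blast
    next
      case False
      \<comment> \<open>The coefficients of the image of the sum under \<open>d/dt - \<nu>\<close>.\<close>
      define Q' where "Q' \<mu> = pderiv (Q \<mu>) + smult (\<mu> - \<nu>) (Q \<mu>)" for \<mu>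
      have "(\<Sum>\<mu>\<in>insert \<nu> S. poly (Q' \<mu>) t * exp (\<mu> * t)) = 0" for t
      proof -
        have "((\<lambda>t. \<Sum>\<mu>\<in>insert \<nu> S. poly (Q \<mu>) t * exp (\<mu> * t)) has_field_derivative
            (\<Sum>\<mu>\<in>insert \<nu> S. poly (pderiv (Q \<mu>)) t * exp (\<mu> * t) + \<mu> * exp (\<mu> * t) * poly (Q \<mu>) t)) (at t)"
        proof (rule DERIV_sum)
          fix \<mu>
          have "((\<lambda>t. exp (\<mu> * t)) has_field_derivative \<mu> * exp (\<mu> * t)) (at t)"
            by (auto intro!: derivative_eq_intros)
          from DERIV_mult[OF poly_DERIV this]
          show "((\<lambda>t. poly (Q \<mu>) t * exp (\<mu> * t)) has_field_derivative
            poly (pderiv (Q \<mu>)) t * exp (\<mu> * t) + \<mu> * exp (\<mu> * t) * poly (Q \<mu>) t) (at t)" .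
        qed
        moreover have "((\<lambda>t. \<Sum>\<mu>\<in>insert \<nu> S. poly (Q \<mu>) t * exp (\<mu> * t)) has_field_derivative 0) (at t)"
          by (simp only: less(3) DERIV_const)
        ultimately have "(\<Sum>\<mu>\<in>insert \<nu> S. poly (pderiv (Q \<mu>)) t * exp (\<mu> * t) + \<mu> * exp (\<mu> * t) * poly (Q \<mu>) t) = 0"
          by (rule DERIV_unique)
        moreover have "\<nu> * (\<Sum>\<mu>\<in>insert \<nu> S. poly (Q \<mu>) t * exp (\<mu> * t)) = 0"
          using less(3)[of t] by simp
        ultimately have "(\<Sum>\<mu>\<in>insert \<nu> S. poly (pderiv (Q \<mu>)) t * exp (\<mu> * t) + \<mu> * exp (\<mu> * t) * poly (Q \<mu>) t)
            - (\<Sum>\<mu>\<in>insert \<nu> S. \<nu> * (poly (Q \<mu>) t * exp (\<mu> * t))) = 0"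
          unfolding sum_distrib_left by simp
        then show ?thesis
          unfolding sum_subtractf[symmetric] Q'_def by (simp add: algebra_simps)
      qed
      moreover have "(if Q' \<nu> = 0 then 0 else Suc (degree (Q' \<nu>))) < m"
      proof -
        have "Q' \<nu> = pderiv (Q \<nu>)" by (simp add: Q'_def)
        moreover have "degree (Q \<nu>) = 0 \<Longrightarrow> pderiv (Q \<nu>) = 0" by (simp add: pderiv_eq_0_iff)
        ultimately show ?thesis using less(2) False by (cases "degree (Q \<nu>) = 0") (auto simp: degree_pderiv)
      qed
      ultimately have Q'0: "\<forall>\<mu>\<in>insert \<nu> S. Q' \<mu> = 0" by (intro less(1)[OF _ refl]) auto
      have QS: "Q \<mu> = 0" if "\<mu> \<in> S" for \<mu>
      proof (rule ccontr)
        assume "Q \<mu> \<noteq> 0"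
        have ne: "\<mu> - \<nu> \<noteq> 0" using that insert(2) by auto
        have eq: "pderiv (Q \<mu>) + smult (\<mu> - \<nu>) (Q \<mu>) = 0" using Q'0 that by (simp add: Q'_def)
        then have "smult (\<mu> - \<nu>) (Q \<mu>) = - pderiv (Q \<mu>)" by (simp add: eq_neg_iff_add_eq_0 add.commute)
        then have "degree (smult (\<mu> - \<nu>) (Q \<mu>)) = degree (pderiv (Q \<mu>))" by simp
        then have "degree (Q \<mu>) = degree (Q \<mu>) - 1" using ne by (simp add: degree_pderiv)
        then have "degree (Q \<mu>) = 0" by simp
        then have "pderiv (Q \<mu>) = 0" by (simp add: pderiv_eq_0_iff)
        with eq ne \<open>Q \<mu> \<noteq> 0\<close> show False by simp
      qed
      have "poly (Q \<nu>) t = 0" for t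
        using less(3)[of t] insert(1,2) QS by simp
      then have "Q \<nu> = 0" using poly_all_0_iff_0 by blast
      then show ?thesis using QS by blast
    qed
  qed
  show ?case using main[OF refl insert(4)] insert(5) by blast
qed simp

text \<open>
  \<open>F1\<close> is an exponential polynomial, and \<open>F2\<close> is obtained from an expression for it by setting \<open>t = 0\<close> in the
  coefficients and conjugating the exponents. Both evaluations respect sums and products, the second one
  because conjugation is additive. By \<open>exp_conjugate_zero\<close> the function \<open>F1\<close> determines \<open>F2\<close>.
\<close>

definition exp_conjugate :: "(complex \<Rightarrow> complex) \<Rightarrow> (complex \<Rightarrow> complex) \<Rightarrow> bool" where
  "exp_conjugate F1 F2 \<longleftrightarrow> (\<exists>L :: (complex \<times> complex poly) list.
    (\<forall>t. F1 t = (\<Sum>(\<mu>, q)\<leftarrow>L. poly q t * exp (\<mu> * t))) \<and>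
    (\<forall>s. F2 s = (\<Sum>(\<mu>, q)\<leftarrow>L. poly q 0 * exp (cnj \<mu> * s))))"

lemma exp_conjugate_single: "exp_conjugate (\<lambda>t. poly q t * exp (\<mu> * t)) (\<lambda>s. poly q 0 * exp (cnj \<mu> * s))"
  unfolding exp_conjugate_def by (rule exI[of _ "[(\<mu>, q)]"]) simp

lemma exp_conjugate_const: "exp_conjugate (\<lambda>_. c) (\<lambda>_. c)"
  using exp_conjugate_single[of "[:c:]" 0] by simp

lemma exp_conjugate_add:
  assumes "exp_conjugate F1 F2" "exp_conjugate E1 E2"
  shows "exp_conjugate (\<lambda>t. F1 t + E1 t) (\<lambda>t. F2 t + E2 t)"
proof -
  obtain L M where
    "\<And>t. F1 t = (\<Sum>(\<mu>, q)\<leftarrow>L. poly q t * exp (\<mu> * t))" "\<And>s. F2 s = (\<Sum>(\<mu>, q)\<leftarrow>L. poly q 0 * exp (cnj \<mu> * s))"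
    "\<And>t. E1 t = (\<Sum>(\<mu>, q)\<leftarrow>M. poly q t * exp (\<mu> * t))" "\<And>s. E2 s = (\<Sum>(\<mu>, q)\<leftarrow>M. poly q 0 * exp (cnj \<mu> * s))"
    using assms unfolding exp_conjugate_def by auto
  then show ?thesis unfolding exp_conjugate_def by (intro exI[of _ "L @ M"]) simp
qed

lemma exp_conjugate_mult:
  assumes "exp_conjugate F1 F2" "exp_conjugate E1 E2"
  shows "exp_conjugate (\<lambda>t. F1 t * E1 t) (\<lambda>t. F2 t * E2 t)"
proof -
  obtain L M where *:
    "\<And>t. F1 t = (\<Sum>(\<mu>, q)\<leftarrow>L. poly q t * exp (\<mu> * t))" "\<And>s. F2 s = (\<Sum>(\<mu>, q)\<leftarrow>L. poly q 0 * exp (cnj \<mu> * s))"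
    "\<And>t. E1 t = (\<Sum>(\<mu>, q)\<leftarrow>M. poly q t * exp (\<mu> * t))" "\<And>s. E2 s = (\<Sum>(\<mu>, q)\<leftarrow>M. poly q 0 * exp (cnj \<mu> * s))"
    using assms unfolding exp_conjugate_def by auto
  define pr where "pr \<mu> q M = map (\<lambda>(\<nu>, r). (\<mu> + \<nu>, q * r)) M" for \<mu> :: complex and q :: "complex poly" and M
  have 1: "(\<Sum>(\<mu>, q)\<leftarrow>pr \<mu> q M. poly q t * exp (\<mu> * t)) = poly q t * exp (\<mu> * t) * (\<Sum>(\<mu>, q)\<leftarrow>M. poly q t * exp (\<mu> * t))"
    for \<mu> q M t
    by (induct M) (auto simp: pr_def distrib_left distrib_right exp_add)
  have 2: "(\<Sum>(\<mu>, q)\<leftarrow>pr \<mu> q M. poly q 0 * exp (cnj \<mu> * t)) = poly q 0 * exp (cnj \<mu> * t) * (\<Sum>(\<mu>, q)\<leftarrow>M. poly q 0 * exp (cnj \<mu> * t))"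
    for \<mu> q M t
    by (induct M) (auto simp: pr_def distrib_left distrib_right exp_add)
  have 3: "(\<Sum>(\<mu>, q)\<leftarrow>concat (map (\<lambda>(\<mu>, q). pr \<mu> q M) L). poly q t * exp (\<mu> * t))
      = (\<Sum>(\<mu>, q)\<leftarrow>L. poly q t * exp (\<mu> * t)) * (\<Sum>(\<mu>, q)\<leftarrow>M. poly q t * exp (\<mu> * t))" for t
    by (induct L) (auto simp: 1 distrib_right)
  have 4: "(\<Sum>(\<mu>, q)\<leftarrow>concat (map (\<lambda>(\<mu>, q). pr \<mu> q M) L). poly q 0 * exp (cnj \<mu> * t))
      = (\<Sum>(\<mu>, q)\<leftarrow>L. poly q 0 * exp (cnj \<mu> * t)) * (\<Sum>(\<mu>, q)\<leftarrow>M. poly q 0 * exp (cnj \<mu> * t))" for t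
    by (induct L) (auto simp: 2 distrib_right)
  show ?thesis
    unfolding exp_conjugate_def * 3[symmetric] 4[symmetric] by blast
qed

lemma exp_conjugate_sum:
  assumes "\<And>i. i \<in> I \<Longrightarrow> exp_conjugate (F i) (E i)"
  shows "exp_conjugate (\<lambda>t. \<Sum>i\<in>I. F i t) (\<lambda>s. \<Sum>i\<in>I. E i s)"
  using assms
  by (induct I rule: infinite_finite_induct) (simp_all add: exp_conjugate_const exp_conjugate_add)

text \<open>
  After collecting equal exponents, all coefficients vanish by \<open>exp_polynomials_independent\<close>.
\<close>

lemma exp_conjugate_zero:
  assumes "exp_conjugate F1 F2" "\<And>t. F1 t = 0"
  shows "F2 s = 0"
proof -
  obtain L where L:
    "\<And>t. F1 t = (\<Sum>(\<mu>, q)\<leftarrow>L. poly q t * exp (\<mu> * t))" "\<And>s. F2 s = (\<Sum>(\<mu>, q)\<leftarrow>L. poly q 0 * exp (cnj \<mu> * s))"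
    using assms(1) unfolding exp_conjugate_def by auto
  define n where "n = length L"
  define m where "m i = fst (L ! i)" for i
  define Q where "Q \<mu> = (\<Sum>i\<in>{i \<in> {0..<n}. m i = \<mu>}. snd (L ! i))" for \<mu>
  have group: "(\<Sum>(\<mu>, q)\<leftarrow>L. h q * e \<mu>) = (\<Sum>\<mu>\<in>m ` {0..<n}. (\<Sum>i\<in>{i \<in> {0..<n}. m i = \<mu>}. h (snd (L ! i))) * e \<mu>)"
    for h e :: "_ \<Rightarrow> complex"
  proof -
    have "(\<Sum>(\<mu>, q)\<leftarrow>L. h q * e \<mu>) = (\<Sum>i\<in>{0..<n}. h (snd (L ! i)) * e (m i))"
      by (simp add: sum_list_sum_nth n_def m_def case_prod_beta)
    also have "\<dots> = (\<Sum>\<mu>\<in>m ` {0..<n}. \<Sum>i\<in>{i \<in> {0..<n}. m i = \<mu>}. h (snd (L ! i)) * e (m i))"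
      by (rule sum.image_gen) simp
    also have "\<dots> = (\<Sum>\<mu>\<in>m ` {0..<n}. (\<Sum>i\<in>{i \<in> {0..<n}. m i = \<mu>}. h (snd (L ! i))) * e \<mu>)"
      by (rule sum.cong[OF refl]) (simp add: sum_distrib_right)
    finally show ?thesis .
  qed
  have "Q \<mu> = 0" if "\<mu> \<in> m ` {0..<n}" for \<mu>
  proof (rule exp_polynomials_independent[OF _ _ that])
    show "finite (m ` {0..<n})" by simp
    show "(\<Sum>\<mu>\<in>m ` {0..<n}. poly (Q \<mu>) t * exp (\<mu> * t)) = 0" for t
      using assms(2)[of t] unfolding L(1) group[of "\<lambda>q. poly q t" "\<lambda>\<mu>. exp (\<mu> * t)"]
      by (simp add: Q_def poly_sum)
  qed
  then have "(\<Sum>\<mu>\<in>m ` {0..<n}. poly (Q \<mu>) 0 * exp (cnj \<mu> * s)) = 0"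
    by (intro sum.neutral) simp
  then show ?thesis
    unfolding L(2) group[of "\<lambda>q. poly q 0" "\<lambda>\<mu>. exp (cnj \<mu> * s)"] by (simp add: Q_def poly_sum)
qed

section \<open>Spectral decomposition\<close>

text \<open>
  The powers of \<open>x\<close> are linearly dependent, and the resulting polynomial splits into linear factors.
\<close>

lemma matrix_root_product:
  fixes x :: "'n::finite cmat"
  shows "\<exists>\<mu>s. prod_list (map (\<lambda>\<mu>. x - sc \<mu>) \<mu>s) = 0"
proof -
  define E where "E n p = (\<Sum>i\<le>n. sc (coeff p i) * x ^ i)" for n p
  have factor: "E (Suc n) ([:- \<mu>, 1:] * q) = (x - sc \<mu>) * E n q" if "degree q \<le> n" for n \<mu> q
  proof -
    have 1: "E (Suc n) (pCons 0 q) = x * E n q"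
      unfolding E_def sum.atMost_Suc_shift by (simp add: sum_distrib_left sc_left_commute)
    have "coeff q (Suc n) = 0" using that by (simp add: coeff_eq_0)
    then have 2: "E (Suc n) q = E n q" by (simp add: E_def)
    have "[:- \<mu>, 1:] * q = pCons 0 q - smult \<mu> q" by simp
    then have "E (Suc n) ([:- \<mu>, 1:] * q) = E (Suc n) (pCons 0 q) - sc \<mu> * E (Suc n) q"
      unfolding E_def by (simp only: coeff_diff coeff_smult sc_diff sc_mult left_diff_distrib sum_subtractf
          sum_distrib_left mult.assoc)
    then show ?thesis by (simp add: 1 2 left_diff_distrib)
  qed
  have split: "\<exists>c \<mu>s. c \<noteq> 0 \<and> E d p = sc c * prod_list (map (\<lambda>\<mu>. x - sc \<mu>) \<mu>s)"
    if "degree p = d" "p \<noteq> 0" for d p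
    using that
  proof (induct d arbitrary: p)
    case 0
    from 0(1) obtain c where "p = [:c:]" by (rule degree_eq_zeroE)
    then show ?case using 0 by (intro exI[of _ c] exI[of _ "[]"]) (simp add: E_def)
  next
    case (Suc d)
    then have "\<not> constant (poly p)" by (simp add: constant_degree)
    then obtain \<mu> where "poly p \<mu> = 0" using Fundamental_Theorem_Algebra.fundamental_theorem_of_algebra by blast
    then obtain q where q: "p = [:- \<mu>, 1:] * q" by (auto simp: poly_eq_0_iff_dvd elim: dvdE)
    then have "q \<noteq> 0" using Suc(3) by auto
    then have deg: "degree q = d" using Suc(2) degree_mult_eq[of "[:- \<mu>, 1:]" q] by (simp add: q)
    obtain c \<mu>s where c: "c \<noteq> 0" "E d q = sc c * prod_list (map (\<lambda>\<mu>. x - sc \<mu>) \<mu>s)"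
      using Suc(1)[OF deg \<open>q \<noteq> 0\<close>] by blast
    have "E (Suc d) p = sc c * prod_list (map (\<lambda>\<mu>. x - sc \<mu>) (\<mu> # \<mu>s))"
      unfolding q using factor[of q d \<mu>] deg by (simp add: c(2) sc_left_commute)
    then show ?case using c(1) by blast
  qed
  have "\<exists>p. p \<noteq> 0 \<and> E (degree p) p = 0"
  proof -
    have deg: "E n p = E (degree p) p" if "degree p \<le> n" for n p
      unfolding E_def by (rule sum.mono_neutral_right) (use that in \<open>auto simp: coeff_eq_0\<close>)
    let ?D = "DIM('n cmat)"
    show ?thesis
    proof (cases "inj_on (\<lambda>i. x ^ i) {..?D}")
      case False
      then obtain i j where ij: "i \<le> ?D" "j \<le> ?D" "i \<noteq> j" "x ^ i = x ^ j" by (auto simp: inj_on_def)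
      define p where "p = monom (1::complex) i - monom 1 j"
      have "coeff p i = 1" using ij by (simp add: p_def)
      then have "p \<noteq> 0" by auto
      have "degree p \<le> ?D" unfolding p_def by (rule degree_diff_le) (use ij in \<open>auto simp: degree_monom_eq\<close>)
      moreover have "E ?D p = 0"
      proof -
        have "E ?D p = (\<Sum>k\<le>?D. (if k = i then x ^ i else 0)) - (\<Sum>k\<le>?D. (if k = j then x ^ j else 0))"
          unfolding E_def sum_subtractf[symmetric] by (rule sum.cong) (auto simp: p_def sc_diff sc_minus)
        then show ?thesis using ij by simp
      qed
      ultimately show ?thesis using \<open>p \<noteq> 0\<close> deg by metis
    next
      case True
      have "dependent ((\<lambda>i. x ^ i) ` {..?D})"
        by (rule dependent_biggerset) (simp add: card_image[OF True])
      then obtain u where u: "\<exists>v\<in>(\<lambda>i. x ^ i) ` {..?D}. u v \<noteq> 0" "(\<Sum>v\<in>(\<lambda>i. x ^ i) ` {..?D}. u v *\<^sub>R v) = 0"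
        using dependent_finite[of "(\<lambda>i. x ^ i) ` {..?D}"] by auto
      define p where "p = (\<Sum>i\<le>?D. monom (complex_of_real (u (x ^ i))) i)"
      have cp: "coeff p i = of_real (u (x ^ i))" if "i \<le> ?D" for i
        using that by (simp add: p_def coeff_sum)
      have "p \<noteq> 0" using u(1) cp by auto
      have "degree p \<le> ?D"
        unfolding p_def by (rule degree_sum_le) (auto intro: order_trans[OF degree_monom_le])
      moreover have "E ?D p = 0"
      proof -
        have "E ?D p = (\<Sum>i\<le>?D. u (x ^ i) *\<^sub>R x ^ i)"
          unfolding E_def by (rule sum.cong) (auto simp: cp sc_of_real)
        also have "\<dots> = (\<Sum>v\<in>(\<lambda>i. x ^ i) ` {..?D}. u v *\<^sub>R v)"
          by (simp add: sum.reindex[OF True])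
        finally show ?thesis using u(2) by simp
      qed
      ultimately show ?thesis using \<open>p \<noteq> 0\<close> deg by metis
    qed
  qed
  then obtain p where "p \<noteq> 0" "E (degree p) p = 0" by blast
  with split[OF refl, of p] obtain c \<mu>s where c: "c \<noteq> 0" "sc c * prod_list (map (\<lambda>\<mu>. x - sc \<mu>) \<mu>s) = 0" by auto
  then have "sc (inverse c) * (sc c * prod_list (map (\<lambda>\<mu>. x - sc \<mu>) \<mu>s)) = 0" by simp
  then have "prod_list (map (\<lambda>\<mu>. x - sc \<mu>) \<mu>s) = 0"
    using c(1) by (simp add: mult.assoc[symmetric] sc_mult[symmetric])
  then show ?thesis by blast
qed

text \<open>
  Everything happens in the ring \<open>R\<close> of all matrices that commute with whatever commutes with \<open>x\<close>. It
  is commutative and contains \<open>x\<close> and the scalars. For \<open>\<mu> \<noteq> \<nu>\<close> the elements \<open>x - \<mu>\<close> and \<open>x - \<nu>\<close> are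
  comaximal in \<open>R\<close>, and so are products of them without a common root; a relation \<open>u a + w b = 1\<close> splits
  an idempotent that is annihilated by \<open>a b\<close> into one annihilated by \<open>a\<close> and one annihilated by \<open>b\<close>. Splitting
  off one root at a time gives the projections.
\<close>

lemma spectral_decomposition:
  fixes x :: "'n::finite cmat"
  obtains S :: "complex set" and P :: "complex \<Rightarrow> 'n cmat" where
    "finite S" "(\<Sum>\<mu>\<in>S. P \<mu>) = 1"
    "\<And>\<mu> \<nu>. \<mu> \<in> S \<Longrightarrow> \<nu> \<in> S \<Longrightarrow> \<mu> \<noteq> \<nu> \<Longrightarrow> P \<mu> * P \<nu> = 0"
    "\<And>\<mu>. \<mu> \<in> S \<Longrightarrow> x * P \<mu> = P \<mu> * x"
    "\<And>\<mu>. \<mu> \<in> S \<Longrightarrow> \<exists>N. (x - sc \<mu>) ^ N * P \<mu> = 0"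
proof -
  define R where "R = {z. \<forall>w. w * x = x * w \<longrightarrow> z * w = w * z}"
  have Rx: "z * x = x * z" if "z \<in> R" for z using that unfolding R_def by blast
  have Rc: "z * z' = z' * z" if "z \<in> R" "z' \<in> R" for z z'
    using that(1) Rx[OF that(2)] unfolding R_def by blast
  have lc: "a * (b * z) = b * (a * z)" if "a * b = b * a" for a b z :: "'n cmat"
    by (simp add: mult.assoc[symmetric] that)
  have Radd: "z + z' \<in> R" "z - z' \<in> R" "z * z' \<in> R" if "z \<in> R" "z' \<in> R" for z z'
  proof -
    have c: "z * w = w * z" "z' * w = w * z'" if "w * x = x * w" for w
      using that \<open>z \<in> R\<close> \<open>z' \<in> R\<close> unfolding R_def by auto
    show "z + z' \<in> R" "z - z' \<in> R" by (auto simp: R_def algebra_simps c)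
    have "z * z' * w = w * (z * z')" if "w * x = x * w" for w
      by (simp add: mult.assoc c(2)[OF that] lc[OF c(1)[OF that]])
    then show "z * z' \<in> R" by (auto simp: R_def)
  qed
  have Rsc: "sc c \<in> R" for c by (simp add: R_def sc_commute)
  have R1: "1 \<in> R" using Rsc[of 1] by simp
  have Rf: "x - sc c \<in> R" for c by (rule Radd(2)[OF _ Rsc]) (simp add: R_def)
  have Rpow: "z ^ k \<in> R" if "z \<in> R" for z k by (induct k) (auto intro: R1 Radd that)
  have Rprod: "prod_list (map (\<lambda>\<mu>. x - sc \<mu>) \<mu>s) \<in> R" for \<mu>s
    by (induct \<mu>s) (auto intro: R1 Radd Rf)
  define comax where "comax a b \<longleftrightarrow> (\<exists>u\<in>R. \<exists>w\<in>R. u * a + w * b = 1)" for a b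
  have comax_sym: "comax b a" if "comax a b" for a b
    using that unfolding comax_def by (metis add.commute)
  have comax_mult: "comax a (b * c)" if "comax a b" "comax a c" and R: "a \<in> R" "b \<in> R" "c \<in> R" for a b c
  proof -
    obtain u w where 1: "u \<in> R" "w \<in> R" "u * a + w * b = 1" using \<open>comax a b\<close> unfolding comax_def by blast
    obtain u' w' where 2: "u' \<in> R" "w' \<in> R" "u' * a + w' * c = 1" using \<open>comax a c\<close> unfolding comax_def by blast
    have "1 = (u * a + w * b) * (u' * a + w' * c)" by (simp add: 1 2)
    also have "\<dots> = (u * a) * (u' * a) + (u * a) * (w' * c) + (w * b) * (u' * a) + (w * b) * (w' * c)"
      by (simp add: distrib_left distrib_right add.assoc)
    also have "(u * a) * (w' * c) = u * w' * c * a"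
      using Rc[OF R(1) Radd(3)[OF 2(2) R(3)]] by (simp add: mult.assoc)
    also have "(w * b) * (w' * c) = w * w' * (b * c)"
      by (simp add: mult.assoc lc[OF Rc[OF R(2) 2(2)]])
    finally have "(u * a * u' + u * w' * c + w * b * u') * a + (w * w') * (b * c) = 1"
      by (simp add: distrib_right mult.assoc)
    moreover have "u * a * u' + u * w' * c + w * b * u' \<in> R" "w * w' \<in> R"
      using 1 2 R by (auto intro!: Radd)
    ultimately show ?thesis unfolding comax_def by blast
  qed
  have comax1: "comax a 1" for a
    unfolding comax_def using R1 Rsc[of 0] by (intro bexI[of _ 0] bexI[of _ 1]) auto
  have comax_lin: "comax (x - sc \<mu>) (x - sc \<nu>)" if "\<mu> \<noteq> \<nu>" for \<mu> \<nu>
    unfolding comax_def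
  proof (intro bexI[OF _ Rsc])
    let ?c = "inverse (\<nu> - \<mu>)"
    have "sc ?c * (x - sc \<mu>) + sc (- ?c) * (x - sc \<nu>) = sc ?c * sc (\<nu> - \<mu>)"
      by (simp add: sc_minus sc_diff algebra_simps)
    also have "\<dots> = 1" using that by (simp add: sc_mult[symmetric])
    finally show "sc ?c * (x - sc \<mu>) + sc (- ?c) * (x - sc \<nu>) = 1" .
  qed
  have comax_prod: "comax (x - sc \<nu>) (prod_list (map (\<lambda>\<mu>. x - sc \<mu>) \<mu>s))" if "\<nu> \<notin> set \<mu>s" for \<nu> \<mu>s
    using that
    by (induct \<mu>s) (simp_all add: comax1 comax_mult comax_lin Rf Rprod)
  have comax_pow: "comax (a ^ k) b" if "comax a b" "a \<in> R" "b \<in> R" for a b k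
  proof -
    have "comax b (a ^ k)"
      by (induct k) (simp_all add: comax1 comax_mult comax_sym that Rpow)
    then show ?thesis by (rule comax_sym)
  qed
  have collect: "\<exists>k. prod_list (map (\<lambda>\<mu>. x - sc \<mu>) \<mu>s) = (x - sc \<nu>) ^ k * prod_list (map (\<lambda>\<mu>. x - sc \<mu>) (removeAll \<nu> \<mu>s))" for \<nu> \<mu>s
  proof (induct \<mu>s)
    case Nil show ?case by (rule exI[of _ 0]) simp
  next
    case (Cons \<mu> \<mu>s)
    then obtain k where k: "prod_list (map (\<lambda>\<mu>. x - sc \<mu>) \<mu>s) = (x - sc \<nu>) ^ k * prod_list (map (\<lambda>\<mu>. x - sc \<mu>) (removeAll \<nu> \<mu>s))" by blast
    show ?case
    proof (cases "\<mu> = \<nu>")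
      case True
      then show ?thesis by (intro exI[of _ "Suc k"]) (simp add: k mult.assoc)
    next
      case False
      have "(x - sc \<mu>) * ((x - sc \<nu>) ^ k * z) = (x - sc \<nu>) ^ k * ((x - sc \<mu>) * z)" for z
        by (rule lc[OF Rc[OF Rf Rpow[OF Rf]]])
      then show ?thesis using False by (intro exI[of _ k]) (simp add: k)
    qed
  qed
  have main: "\<exists>S Pf. finite S \<and> S \<subseteq> set \<mu>s \<and> (\<Sum>\<mu>\<in>S. Pf \<mu>) = P \<and>
      (\<forall>\<mu>\<in>S. Pf \<mu> \<in> R \<and> P * Pf \<mu> = Pf \<mu> \<and> (\<exists>N. (x - sc \<mu>) ^ N * Pf \<mu> = 0)) \<and>
      (\<forall>\<mu>\<in>S. \<forall>\<nu>\<in>S. \<mu> \<noteq> \<nu> \<longrightarrow> Pf \<mu> * Pf \<nu> = 0)"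
    if "P \<in> R" "P * P = P" "prod_list (map (\<lambda>\<mu>. x - sc \<mu>) \<mu>s) * P = 0" for \<mu>s P
    using that
  proof (induct \<mu>s arbitrary: P rule: length_induct)
    case (1 \<mu>s)
    note IH = 1(1) and P = 1(2,3,4)
    show ?case
    proof (cases \<mu>s)
      case Nil
      then show ?thesis using P by (intro exI[of _ "{}"]) auto
    next
      case (Cons \<nu> rest)
      define os where "os = removeAll \<nu> \<mu>s"
      obtain k where k: "prod_list (map (\<lambda>\<mu>. x - sc \<mu>) \<mu>s) = (x - sc \<nu>) ^ k * prod_list (map (\<lambda>\<mu>. x - sc \<mu>) os)"
        using collect[of \<mu>s \<nu>] unfolding os_def by blast
      define a where "a = (x - sc \<nu>) ^ k"
      define b where "b = prod_list (map (\<lambda>\<mu>. x - sc \<mu>) os)"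
      have aR: "a \<in> R" unfolding a_def by (rule Rpow[OF Rf])
      have bR: "b \<in> R" unfolding b_def by (rule Rprod)
      have "comax a b"
        unfolding a_def b_def by (rule comax_pow[OF comax_prod Rf Rprod]) (simp add: os_def)
      then obtain u w where uw: "u \<in> R" "w \<in> R" "u * a + w * b = 1" unfolding comax_def by blast
      have abP: "a * b * P = 0" using P(3) k by (simp add: a_def b_def)
      \<comment> \<open>The part of \<open>P\<close> on which \<open>x - \<nu>\<close> is nilpotent, and its complement, to which the induction hypothesis applies.\<close>
      define P1 where "P1 = w * (b * P)"
      define P2 where "P2 = u * (a * P)"
      have P1R: "P1 \<in> R" and P2R: "P2 \<in> R" unfolding P1_def P2_def by (intro Radd uw aR bR P)+
      have "P1 + P2 = (u * a + w * b) * P"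
        by (simp add: P1_def P2_def distrib_right mult.assoc add.commute)
      then have sum: "P1 + P2 = P" by (simp add: uw)
      have aP1: "a * P1 = 0"
      proof -
        have "a * P1 = w * (a * b * P)" unfolding P1_def by (simp add: mult.assoc lc[OF Rc[OF aR uw(2)]])
        then show ?thesis by (simp add: abP)
      qed
      have bP2: "b * P2 = 0"
      proof -
        have "b * P2 = u * (b * a * P)" unfolding P2_def by (simp add: mult.assoc lc[OF Rc[OF bR uw(1)]])
        also have "b * a = a * b" by (rule Rc[OF bR aR])
        finally show ?thesis by (simp add: abP)
      qed
      have P12: "P1 * P2 = 0"
      proof -
        have "P1 * P2 = w * (P * (b * P2))" unfolding P1_def by (simp add: mult.assoc lc[OF Rc[OF bR P(1)]])
        then show ?thesis by (simp add: bP2)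
      qed
      have P21: "P2 * P1 = 0" using P12 Rc[OF P1R P2R] by simp
      have PP1: "P * P1 = P1"
        unfolding P1_def by (simp add: lc[OF Rc[OF P(1) uw(2)]] lc[OF Rc[OF P(1) bR]] P(2))
      have PP2: "P * P2 = P2"
        unfolding P2_def by (simp add: lc[OF Rc[OF P(1) uw(1)]] lc[OF Rc[OF P(1) aR]] P(2))
      have "P2 * P2 = (P1 + P2) * P2" by (simp add: distrib_right P12)
      then have P22: "P2 * P2 = P2" by (simp add: sum PP2)
      have len: "length os < length \<mu>s" unfolding os_def by (simp add: Cons length_removeAll_less_eq le_imp_less_Suc)
      obtain S Pf where S: "finite S" "S \<subseteq> set os" "(\<Sum>\<mu>\<in>S. Pf \<mu>) = P2"
        "\<forall>\<mu>\<in>S. Pf \<mu> \<in> R \<and> P2 * Pf \<mu> = Pf \<mu> \<and> (\<exists>N. (x - sc \<mu>) ^ N * Pf \<mu> = 0)"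
        "\<forall>\<mu>\<in>S. \<forall>\<nu>\<in>S. \<mu> \<noteq> \<nu> \<longrightarrow> Pf \<mu> * Pf \<nu> = 0"
        using IH[rule_format, OF len P2R P22 bP2[unfolded b_def]] by (elim exE conjE) (rule that)
      have nS: "\<nu> \<notin> S" using S(2) unfolding os_def by auto
      have o1: "P1 * Pf \<mu> = 0" "Pf \<mu> * P1 = 0" "P * Pf \<mu> = Pf \<mu>" if "\<mu> \<in> S" for \<mu>
      proof -
        have e: "P2 * Pf \<mu> = Pf \<mu>" "Pf \<mu> \<in> R" using S(4) that by blast+
        have "P1 * (P2 * Pf \<mu>) = 0" by (simp add: mult.assoc[symmetric] P12)
        then show 1: "P1 * Pf \<mu> = 0" by (simp add: e)
        then show "Pf \<mu> * P1 = 0" using Rc[OF P1R e(2)] by simp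
        have "P * (P2 * Pf \<mu>) = P2 * Pf \<mu>" by (simp add: mult.assoc[symmetric] PP2)
        then show "P * Pf \<mu> = Pf \<mu>" by (simp add: e)
      qed
      show ?thesis
      proof (intro exI[of _ "insert \<nu> S"] exI[of _ "Pf(\<nu> := P1)"] conjI ballI impI)
        show "finite (insert \<nu> S)" using S by simp
        show "insert \<nu> S \<subseteq> set \<mu>s" using S(2) unfolding os_def Cons by auto
        have "(\<Sum>\<mu>\<in>S. (Pf(\<nu> := P1)) \<mu>) = (\<Sum>\<mu>\<in>S. Pf \<mu>)" by (rule sum.cong) (use nS in auto)
        then show "(\<Sum>\<mu>\<in>insert \<nu> S. (Pf(\<nu> := P1)) \<mu>) = P" using S(1,3) nS sum by simp
        fix \<mu> assume \<mu>: "\<mu> \<in> insert \<nu> S"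
        show "(Pf(\<nu> := P1)) \<mu> \<in> R" using \<mu> S(4) P1R by auto
        show "P * (Pf(\<nu> := P1)) \<mu> = (Pf(\<nu> := P1)) \<mu>" using \<mu> o1(3) PP1 by auto
        show "\<exists>N. (x - sc \<mu>) ^ N * (Pf(\<nu> := P1)) \<mu> = 0" using \<mu> S(4) aP1 unfolding a_def by auto
        fix \<mu>' assume "\<mu>' \<in> insert \<nu> S" "\<mu> \<noteq> \<mu>'"
        then show "(Pf(\<nu> := P1)) \<mu> * (Pf(\<nu> := P1)) \<mu>' = 0" using \<mu> o1(1,2) S(5) by auto
      qed
    qed
  qed
  obtain \<mu>s where "prod_list (map (\<lambda>\<mu>. x - sc \<mu>) \<mu>s) = 0" using matrix_root_product by blast
  then have "prod_list (map (\<lambda>\<mu>. x - sc \<mu>) \<mu>s) * 1 = 0" by simp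
  from main[OF R1 _ this] obtain S Pf where S: "finite S" "(\<Sum>\<mu>\<in>S. Pf \<mu>) = 1"
    "\<forall>\<mu>\<in>S. Pf \<mu> \<in> R \<and> (\<exists>N. (x - sc \<mu>) ^ N * Pf \<mu> = 0)"
    "\<forall>\<mu>\<in>S. \<forall>\<nu>\<in>S. \<mu> \<noteq> \<nu> \<longrightarrow> Pf \<mu> * Pf \<nu> = 0" by auto
  show ?thesis by (rule that[OF S(1,2)]) (use S Rx in auto)
qed

section \<open>Conjugating the semisimple part of an element\<close>

lemma orthogonal_summand_of_one_idempotent:
  fixes P :: "'a \<Rightarrow> 'b::ring_1"
  assumes S: "finite S" "(\<Sum>\<mu>\<in>S. P \<mu>) = 1"
    and orth: "\<And>\<mu> \<nu>. \<mu> \<in> S \<Longrightarrow> \<nu> \<in> S \<Longrightarrow> \<mu> \<noteq> \<nu> \<Longrightarrow> P \<mu> * P \<nu> = 0"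
    and \<mu>: "\<mu> \<in> S"
  shows "P \<mu> * P \<mu> = P \<mu>"
proof -
  have "P \<mu> = (\<Sum>\<nu>\<in>S. P \<nu>) * P \<mu>" by (simp add: S)
  also have "\<dots> = (\<Sum>\<nu>\<in>S. if \<nu> = \<mu> then P \<mu> * P \<mu> else 0)"
    unfolding sum_distrib_right by (rule sum.cong) (use orth \<mu> in auto)
  also have "\<dots> = P \<mu> * P \<mu>" using S(1) \<mu> by simp
  finally show ?thesis by simp
qed

lemma mexp_eigen:
  fixes X P :: "'n::finite cmat"
  assumes "X * P = sc c * P"
  shows "mexp X * P = sc (exp c) * P"
proof -
  have pow: "X ^ n * P = sc (c ^ n) * P" for n
  proof (induct n)
    case (Suc n)
    have "X ^ Suc n * P = X * (X ^ n * P)" by (simp add: mult.assoc)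
    also have "\<dots> = sc (c ^ n) * (X * P)" by (simp only: Suc sc_left_commute[of X])
    also have "\<dots> = sc (c ^ Suc n) * P" by (simp add: assms mult.assoc[symmetric] sc_mult[symmetric] mult.commute)
    finally show ?case .
  qed simp
  have "(\<lambda>n. (X ^ n /\<^sub>R fact n) * P) sums (mexp X * P)"
    by (rule bounded_linear.sums[OF bounded_linear_mult_left mexp_sums])
  moreover have "(\<lambda>n. sc (c ^ n /\<^sub>R fact n) * P) sums (sc (exp c) * P)"
    by (rule bounded_linear.sums[OF bounded_linear_mult_left bounded_linear.sums[OF bounded_linear_sc exp_converges]])
  moreover have "(X ^ n /\<^sub>R fact n) * P = sc (c ^ n /\<^sub>R fact n) * P" for n
  proof -
    have "(sc (c ^ n /\<^sub>R fact n) :: 'n cmat) = sc (c ^ n) /\<^sub>R fact n"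
      by (rule linear_scale[OF linear_sc])
    then show ?thesis by (simp only: mult_scaleR_left pow)
  qed
  ultimately show ?thesis by (simp only: sums_unique2)
qed

text \<open>
  On a generalised eigenspace the exponential series breaks off, which makes it polynomial in \<open>t\<close>.
\<close>

lemma mexp_nilpotent:
  fixes X P :: "'n::finite cmat"
  assumes "X ^ N * P = 0"
  shows "mexp (sc t * X) * P = (\<Sum>k<N. sc (t ^ k / fact k) * (X ^ k * P))"
proof -
  have pow: "(sc t * X) ^ k = sc (t ^ k) * X ^ k" for k
  proof (induct k)
    case (Suc k)
    have "(sc t * X) ^ Suc k = sc t * (X * (sc (t ^ k) * X ^ k))" by (simp add: Suc mult.assoc)
    also have "\<dots> = sc (t ^ Suc k) * X ^ Suc k" by (simp add: sc_left_commute[of X] mult.assoc sc_mult)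
    finally show ?case .
  qed simp
  have zero: "X ^ k * P = 0" if "k \<ge> N" for k
  proof -
    have "X ^ k * P = X ^ (k - N) * (X ^ N * P)" using that by (simp add: mult.assoc[symmetric] power_add[symmetric])
    then show ?thesis by (simp add: assms)
  qed
  have eq: "((sc t * X) ^ k /\<^sub>R fact k) * P = sc (t ^ k / fact k) * (X ^ k * P)" for k
  proof -
    have "inverse (fact k :: complex) = of_real (inverse (fact k))" by simp
    then have "sc (t ^ k / fact k) * (X ^ k * P) = sc (of_real (inverse (fact k))) * (sc (t ^ k) * (X ^ k * P))"
      by (simp only: divide_inverse sc_mult[symmetric] mult.assoc[symmetric] mult.commute[of "t ^ k"])
    then show ?thesis by (simp only: sc_of_real pow mult_scaleR_left mult.assoc)
  qed
  have "(\<lambda>k. ((sc t * X) ^ k /\<^sub>R fact k) * P) sums (mexp (sc t * X) * P)"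
    by (rule bounded_linear.sums[OF bounded_linear_mult_left mexp_sums])
  moreover have "(\<lambda>k. ((sc t * X) ^ k /\<^sub>R fact k) * P) sums (\<Sum>k<N. ((sc t * X) ^ k /\<^sub>R fact k) * P)"
    by (rule sums_finite) (auto simp only: eq zero finite_lessThan lessThan_iff not_less mult_zero_right)
  ultimately have "mexp (sc t * X) * P = (\<Sum>k<N. ((sc t * X) ^ k /\<^sub>R fact k) * P)" by (rule sums_unique2)
  then show ?thesis by (simp only: eq)
qed

lemma mexp_sc_scalar_mult:
  fixes Y :: "'n::finite cmat"
  shows "mexp (sc (t * \<mu>) + Y) = sc (exp (t * \<mu>)) * mexp Y"
proof -
  have "mexp (sc (t * \<mu>) + Y) = mexp (sc (t * \<mu>)) * mexp Y"
    by (rule mexp_add) (simp add: sc_commute)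
  moreover have "mexp (sc (t * \<mu>)) * 1 = sc (exp (t * \<mu>)) * (1 :: 'n cmat)"
    by (rule mexp_eigen) simp
  ultimately show ?thesis by simp
qed

context algebraic_matrix_group
begin

text \<open>
  Let \<open>y\<close> be the sum in question. On the range of \<open>P \<mu>\<close> the matrix \<open>mexp (t x)\<close> is \<open>exp (\<mu> t)\<close> times a
  polynomial in \<open>t\<close> with constant term \<open>1\<close>, and \<open>mexp (s y)\<close> is \<open>exp (cnj \<mu> s)\<close>. So for every polynomial
  \<open>p\<close> the functions \<open>p (mexp (t x))\<close> and \<open>p (mexp (s y))\<close> are related by \<open>exp_conjugate\<close>: this holds for linear
  forms and is preserved by sums and products. If \<open>p\<close> vanishes on \<open>G\<close> the first function is zero, hence so
  is the second.
\<close>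

lemma conjugate_semisimple_part_in_lie:
  fixes x :: "'n cmat"
  assumes x: "x \<in> lie" and S: "finite S" "(\<Sum>\<mu>\<in>S. P \<mu>) = 1"
    and orth: "\<And>\<mu> \<nu>. \<mu> \<in> S \<Longrightarrow> \<nu> \<in> S \<Longrightarrow> \<mu> \<noteq> \<nu> \<Longrightarrow> P \<mu> * P \<nu> = 0"
    and nil: "\<And>\<mu>. \<mu> \<in> S \<Longrightarrow> \<exists>N. (x - sc \<mu>) ^ N * P \<mu> = 0"
  shows "(\<Sum>\<mu>\<in>S. sc (cnj \<mu>) * P \<mu>) \<in> lie"
proof -
  define y where "y = (\<Sum>\<mu>\<in>S. sc (cnj \<mu>) * P \<mu>)"
  obtain N where N: "\<And>\<mu>. \<mu> \<in> S \<Longrightarrow> (x - sc \<mu>) ^ N \<mu> * P \<mu> = 0" using nil by metis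
  have idem: "P \<mu> * P \<mu> = P \<mu>" if "\<mu> \<in> S" for \<mu>
    by (rule orthogonal_summand_of_one_idempotent[OF S orth that])
  have yP: "y * P \<mu> = sc (cnj \<mu>) * P \<mu>" if "\<mu> \<in> S" for \<mu>
  proof -
    have "y * P \<mu> = (\<Sum>\<nu>\<in>S. if \<nu> = \<mu> then sc (cnj \<mu>) * P \<mu> else 0)"
      unfolding y_def sum_distrib_right by (rule sum.cong) (use orth that idem in \<open>auto simp: mult.assoc\<close>)
    also have "\<dots> = sc (cnj \<mu>) * P \<mu>" using S(1) that by simp
    finally show ?thesis .
  qed
  have E1: "mexp (sc t * x) = (\<Sum>\<mu>\<in>S. sc (exp (\<mu> * t)) * (\<Sum>k<N \<mu>. sc (t ^ k / fact k) * ((x - sc \<mu>) ^ k * P \<mu>)))" for t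
  proof -
    have "mexp (sc t * x) = (\<Sum>\<mu>\<in>S. mexp (sc t * x) * P \<mu>)" by (simp add: sum_distrib_left[symmetric] S)
    also have "\<dots> = (\<Sum>\<mu>\<in>S. sc (exp (t * \<mu>)) * (mexp (sc t * (x - sc \<mu>)) * P \<mu>))"
    proof (rule sum.cong[OF refl])
      fix \<mu>
      have "sc t * x = sc (t * \<mu>) + sc t * (x - sc \<mu>)" by (simp add: right_diff_distrib sc_mult)
      then have "mexp (sc t * x) = sc (exp (t * \<mu>)) * mexp (sc t * (x - sc \<mu>))"
        by (simp only: mexp_sc_scalar_mult)
      then show "mexp (sc t * x) * P \<mu> = sc (exp (t * \<mu>)) * (mexp (sc t * (x - sc \<mu>)) * P \<mu>)"
        by (simp only: mult.assoc)
    qed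
    also have "\<dots> = (\<Sum>\<mu>\<in>S. sc (exp (\<mu> * t)) * (\<Sum>k<N \<mu>. sc (t ^ k / fact k) * ((x - sc \<mu>) ^ k * P \<mu>)))"
      by (rule sum.cong[OF refl]) (simp only: mexp_nilpotent[OF N] mult.commute[of t])
    finally show ?thesis .
  qed
  have E2: "mexp (sc s * y) = (\<Sum>\<mu>\<in>S. sc (exp (cnj \<mu> * s)) * P \<mu>)" for s
  proof -
    have "mexp (sc s * y) = (\<Sum>\<mu>\<in>S. mexp (sc s * y) * P \<mu>)" by (simp add: sum_distrib_left[symmetric] S)
    also have "\<dots> = (\<Sum>\<mu>\<in>S. sc (exp (cnj \<mu> * s)) * P \<mu>)"
    proof (rule sum.cong[OF refl], rule mexp_eigen)
      fix \<mu> assume "\<mu> \<in> S"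
      have "sc s * y * P \<mu> = sc s * (sc (cnj \<mu>) * P \<mu>)" by (simp only: mult.assoc yP[OF \<open>\<mu> \<in> S\<close>])
      also have "\<dots> = sc (cnj \<mu> * s) * P \<mu>" by (simp only: mult.assoc[symmetric] sc_mult[symmetric] mult.commute)
      finally show "sc s * y * P \<mu> = sc (cnj \<mu> * s) * P \<mu>" .
    qed
    finally show ?thesis .
  qed
  have conj: "exp_conjugate (\<lambda>t. p (raw (mexp (sc t * x)))) (\<lambda>s. p (raw (mexp (sc s * y))))"
    if "p \<in> poly_fun mscale" for p
    using that
  proof induct
    case (linear_form f)
    note f = linear_form_raw[OF linear_form]
    have fsum: "f (raw (\<Sum>i\<in>I. Z i)) = (\<Sum>i\<in>I. f (raw (Z i)))" for Z :: "_ \<Rightarrow> 'n cmat" and I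
      using linear_sum[OF bounded_linear.linear[OF f(1)]] .
    define q where "q \<mu> = (\<Sum>k<N \<mu>. monom (f (raw ((x - sc \<mu>) ^ k * P \<mu>)) / fact k) k)" for \<mu>
    have F1: "f (raw (mexp (sc t * x))) = (\<Sum>\<mu>\<in>S. poly (q \<mu>) t * exp (\<mu> * t))" for t
    proof -
      have "f (raw (\<Sum>k<N \<mu>. sc (t ^ k / fact k) * ((x - sc \<mu>) ^ k * P \<mu>))) = poly (q \<mu>) t" for \<mu>
        unfolding fsum f(2) by (simp add: q_def poly_sum poly_monom mult_ac)
      then show ?thesis unfolding E1 fsum f(2) by (simp add: mult.commute)
    qed
    have q0: "poly (q \<mu>) 0 = f (raw (P \<mu>))" if "\<mu> \<in> S" for \<mu>
    proof (cases "N \<mu>")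
      case 0
      then have "P \<mu> = 0" using N[OF that] by simp
      then show ?thesis using 0 linear_0[OF bounded_linear.linear[OF f(1)]] by (simp add: q_def)
    next
      case (Suc m)
      have "poly (q \<mu>) 0 = (\<Sum>k<N \<mu>. if k = 0 then f (raw (P \<mu>)) else 0)"
        unfolding q_def poly_sum by (rule sum.cong) (auto simp: poly_monom)
      then show ?thesis using Suc by simp
    qed
    have F2: "f (raw (mexp (sc s * y))) = (\<Sum>\<mu>\<in>S. poly (q \<mu>) 0 * exp (cnj \<mu> * s))" for s
      unfolding E2 fsum f(2) by (simp add: q0 mult.commute)
    show ?case unfolding F1 F2 by (intro exp_conjugate_sum exp_conjugate_single)
  qed (auto intro: exp_conjugate_const exp_conjugate_add exp_conjugate_mult)
  have "raw (mexp (sc s * y)) \<in> G" for s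
  proof (subst mem_G_iff, intro conjI ballI impI invertible_mexp)
    fix p assume p: "p \<in> poly_fun mscale" "\<forall>B\<in>G. p B = 0"
    have "p (raw (mexp (sc t * x))) = 0" for t
      by (rule bspec[OF p(2)]) (use lie_exp[OF x, of t] in \<open>simp only: GM_def mem_Collect_eq\<close>)
    then show "p (raw (mexp (sc s * y))) = 0" by (rule exp_conjugate_zero[OF conj[OF p(1)]])
  qed
  then have "y \<in> lie" by (simp only: lie_def GM_def mem_Collect_eq) simp
  then show ?thesis by (simp only: y_def)
qed

end

section \<open>Traces\<close>

text \<open>
  The trace may be computed on any subspace that contains the range.
\<close>

lemma trace_in_basis:
  fixes A :: "complex^'n^'n"
  assumes B: "vec.independent B" and sub: "\<And>v. A *v v \<in> vec.span B"
  shows "trace A = (\<Sum>b\<in>B. vec.representation B (A *v b) b)"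
proof -
  have fin: "finite B" by (rule vec.finiteI_independent[OF B])
  have "trace A = (\<Sum>i\<in>UNIV. (A *v axis i 1) $ i)"
    unfolding trace_def by (simp add: matrix_vector_mult_def axis_def if_distrib[of "(*) _"] cong: if_cong)
  also have "\<dots> = (\<Sum>i\<in>UNIV. \<Sum>b\<in>B. vec.representation B (A *v axis i 1) b * b $ i)"
  proof (rule sum.cong[OF refl])
    fix i
    have "A *v axis i 1 = (\<Sum>b\<in>B. vec.representation B (A *v axis i 1) b *s b)"
      by (rule vec.sum_representation_eq[OF B sub fin order_refl, symmetric])
    then have "(A *v axis i 1) $ i = (\<Sum>b\<in>B. vec.representation B (A *v axis i 1) b *s b) $ i" by simp
    then show "(A *v axis i 1) $ i = (\<Sum>b\<in>B. vec.representation B (A *v axis i 1) b * b $ i)" by simp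
  qed
  also have "\<dots> = (\<Sum>b\<in>B. \<Sum>i\<in>UNIV. vec.representation B (A *v axis i 1) b * b $ i)" by (rule sum.swap)
  also have "\<dots> = (\<Sum>b\<in>B. vec.representation B (A *v b) b)"
  proof (rule sum.cong[OF refl])
    fix b :: "complex^'n"
    have "b = (\<Sum>i\<in>UNIV. b $ i *s axis i 1)"
      by (rule basis_expansion[symmetric])
    then have "A *v b = A *v (\<Sum>i\<in>UNIV. b $ i *s axis i 1)" by simp
    also have "\<dots> = (\<Sum>i\<in>UNIV. b $ i *s (A *v axis i 1))"
      by (simp only: vec.linear_sum[OF matrix_vector_mul_linear_gen] vec.linear_scale[OF matrix_vector_mul_linear_gen])
    finally have "vec.representation B (A *v b) b = (\<Sum>i\<in>UNIV. b $ i * vec.representation B (A *v axis i 1) b)"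
      by (simp add: vec.representation_sum[OF B] vec.representation_scale[OF B] vec.span_scale sub)
    then show "(\<Sum>i\<in>UNIV. vec.representation B (A *v axis i 1) b * b $ i) = vec.representation B (A *v b) b"
      by (simp add: mult.commute)
  qed
  finally show ?thesis .
qed

definition tr :: "'n::finite cmat \<Rightarrow> complex" where "tr X = trace (raw X)"

lemma tr_add: "tr (X + Y) = tr X + tr Y" and tr_sc: "tr (sc c * X) = c * tr X"
  and tr_0: "tr 0 = 0" and tr_diff: "tr (X - Y) = tr X - tr Y"
  by (simp_all add: tr_def trace_def sum.distrib sum_subtractf mscale_def sum_distrib_left del: raw_simps(6))

lemma tr_sum: "tr (\<Sum>i\<in>I. X i) = (\<Sum>i\<in>I. tr (X i))"
  by (induct I rule: infinite_finite_induct) (simp_all add: tr_0 tr_add)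

lemma tr_commute: "tr (X * Y) = tr (Y * X)"
  unfolding tr_def raw_simps by (rule trace_mul_sym)

lemma tr_scaleR: "tr (r *\<^sub>R X) = of_real r * tr X"
  by (simp only: sc_of_real[symmetric] tr_sc)

text \<open>
  On its range an idempotent is the identity, so \<open>r\<close> is the rank.
\<close>

lemma tr_idempotent:
  fixes P :: "'n::finite cmat"
  assumes "P * P = P"
  shows "\<exists>r::nat. tr P = of_nat r \<and> (r = 0 \<longrightarrow> P = 0)"
proof -
  let ?A = "raw P"
  have AA: "?A *v (?A *v v) = ?A *v v" for v
    using arg_cong[OF assms, of raw] by (simp only: raw_simps matrix_vector_mul_assoc)
  obtain B where B: "B \<subseteq> range ((*v) ?A)" "vec.independent B" "range ((*v) ?A) \<subseteq> vec.span B"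
    by (rule vec.maximal_independent_subset)
  have "tr P = (\<Sum>b\<in>B. vec.representation B (?A *v b) b)"
    unfolding tr_def by (rule trace_in_basis[OF B(2) subsetD[OF B(3) rangeI]])
  also have "\<dots> = (\<Sum>b\<in>B. 1)"
  proof (rule sum.cong[OF refl])
    fix b assume b: "b \<in> B"
    from subsetD[OF B(1) this] obtain v where "b = ?A *v v" by (rule rangeE)
    then have "?A *v b = b" by (simp add: AA)
    then show "vec.representation B (?A *v b) b = 1" using vec.representation_basis[OF B(2) b] by simp
  qed
  also have "\<dots> = of_nat (card B)" by simp
  finally have t: "tr P = of_nat (card B)" .
  moreover have "P = 0" if "card B = 0"
  proof -
    have "B = {}" using that vec.finiteI_independent[OF B(2)] by simp
    then have "?A *v v = 0" for v using subsetD[OF B(3) rangeI, of v] by simp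
    then have "?A = 0" unfolding matrix_eq by simp
    then show ?thesis by (simp add: cmat_eq_iff)
  qed
  ultimately show ?thesis by (intro exI[of _ "card B"] conjI impI)
qed

text \<open>
  Choose a basis adapted to the ranges \<open>U j\<close> of the powers \<open>X ^ j\<close>, starting from \<open>U k = 0\<close> and
  extending downwards in \<open>j\<close>. As \<open>X\<close> maps \<open>U j\<close> into \<open>U (j + 1)\<close>, all diagonal coefficients are zero.
\<close>

lemma tr_nilpotent:
  fixes X :: "'n::finite cmat"
  assumes "X ^ k = 0"
  shows "tr X = 0"
proof -
  let ?A = "raw X"
  define U where "U j = range ((*v) (raw (X ^ j)))" for j
  have AU: "?A *v v \<in> U (Suc j)" if v: "v \<in> U j" for v j
  proof -
    obtain w where "v = raw (X ^ j) *v w" using v unfolding U_def by blast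
    then have "?A *v v = raw (X ^ Suc j) *v w" by (simp add: matrix_vector_mul_assoc)
    then show ?thesis unfolding U_def by blast
  qed
  have Udec: "U (Suc j) \<subseteq> U j" for j
  proof
    fix v assume "v \<in> U (Suc j)"
    then obtain w where "v = raw (X ^ Suc j) *v w" unfolding U_def by blast
    then have "v = raw (X ^ j) *v (?A *v w)" by (simp add: matrix_vector_mul_assoc power_commutes flip: raw_simps(6))
    then show "v \<in> U j" unfolding U_def by blast
  qed
  have "\<exists>B. vec.independent B \<and> B \<subseteq> U (k - m) \<and> U (k - m) \<subseteq> vec.span B \<and>
      (\<forall>b\<in>B. ?A *v b \<in> vec.span B \<and> vec.representation B (?A *v b) b = 0)" if "m \<le> k" for m
    using that
  proof (induct m)
    case 0
    have "U k \<subseteq> {0}" by (auto simp: U_def assms)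
    then show ?case by (intro exI[of _ "{}"]) (auto simp: vec.independent_empty)
  next
    case (Suc m)
    let ?j = "k - Suc m"
    have j: "k - m = Suc ?j" using Suc(2) by simp
    obtain B where B: "vec.independent B" "B \<subseteq> U (Suc ?j)" "U (Suc ?j) \<subseteq> vec.span B"
      "\<And>b. b \<in> B \<Longrightarrow> ?A *v b \<in> vec.span B \<and> vec.representation B (?A *v b) b = 0"
      using Suc unfolding j by auto
    obtain B' where B': "B \<subseteq> B'" "B' \<subseteq> U ?j" "vec.independent B'" "U ?j \<subseteq> vec.span B'"
      using vec.maximal_independent_subset_extend[OF order_trans[OF B(2) Udec] B(1)] by blast
    show ?case
    proof (intro exI[of _ B'] conjI ballI B')
      fix b assume b: "b \<in> B'"
      have mem: "?A *v b \<in> vec.span B" using AU[of b ?j] b B'(2) B(3) by blast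
      then show "?A *v b \<in> vec.span B'" using vec.span_mono[OF B'(1)] by blast
      have "vec.representation B' (?A *v b) = vec.representation B (?A *v b)"
        by (rule vec.representation_extend[OF B'(3) mem B'(1)])
      moreover have "vec.representation B (?A *v b) b = 0"
        using B(4)[of b] vec.representation_ne_zero[of B "?A *v b" b] by blast
      ultimately show "vec.representation B' (?A *v b) b = 0" by simp
    qed
  qed
  from this[OF order_refl] obtain B where B: "vec.independent B" "U 0 \<subseteq> vec.span B"
      "\<And>b. b \<in> B \<Longrightarrow> vec.representation B (?A *v b) b = 0" by auto
  have "v \<in> vec.span B" for v
    using B(2) unfolding U_def by auto
  then have "tr X = (\<Sum>b\<in>B. vec.representation B (?A *v b) b)"
    unfolding tr_def by (intro trace_in_basis[OF B(1)])
  then show ?thesis using B(3) by simp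
qed

context algebraic_matrix_group
begin

section \<open>Perfectness of the Lie algebra\<close>

text \<open>
  The form of Cartan's criterion for Lie algebras of algebraic groups. The pairing of \<open>x\<close> with the conjugate of its
  semisimple part is \<open>\<Sum>\<mu>. |\<mu>|\<^sup>2 r \<mu>\<close>, where \<open>r \<mu>\<close> is the dimension of the generalised eigenspace; if it is
  zero, then \<open>0\<close> is the only eigenvalue.
\<close>

lemma trace_orthogonal_imp_nilpotent:
  assumes x: "x \<in> lie" and orth: "\<And>y. y \<in> lie \<Longrightarrow> tr (x * y) = 0"
  shows "\<exists>k. x ^ k = 0"
proof -
  obtain S P where S: "finite S" "(\<Sum>\<mu>\<in>S. P \<mu>) = 1"
    and or: "\<And>\<mu> \<nu>. \<mu> \<in> S \<Longrightarrow> \<nu> \<in> S \<Longrightarrow> \<mu> \<noteq> \<nu> \<Longrightarrow> P \<mu> * P \<nu> = 0"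
    and cm: "\<And>\<mu>. \<mu> \<in> S \<Longrightarrow> x * P \<mu> = P \<mu> * x"
    and nil: "\<And>\<mu>. \<mu> \<in> S \<Longrightarrow> \<exists>N. (x - sc \<mu>) ^ N * P \<mu> = 0"
    using spectral_decomposition[of x] by metis
  have idem: "P \<mu> * P \<mu> = P \<mu>" if "\<mu> \<in> S" for \<mu>
    by (rule orthogonal_summand_of_one_idempotent[OF S or that])
  have trP: "tr (x * P \<mu>) = \<mu> * tr (P \<mu>)" if \<mu>: "\<mu> \<in> S" for \<mu>
  proof -
    obtain N where N: "(x - sc \<mu>) ^ N * P \<mu> = 0" using nil[OF \<mu>] by blast
    have c: "(x - sc \<mu>) * P \<mu> = P \<mu> * (x - sc \<mu>)" by (simp add: left_diff_distrib right_diff_distrib cm[OF \<mu>] sc_commute)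
    have "((x - sc \<mu>) * P \<mu>) ^ Suc k = (x - sc \<mu>) * ((x - sc \<mu>) ^ k * P \<mu>)" for k
    proof (induct k)
      case (Suc k)
      have "P \<mu> * (x - sc \<mu>) ^ Suc k = (x - sc \<mu>) ^ Suc k * P \<mu>"
        by (rule power_commuting_commutes[OF c, symmetric])
      then have e: "P \<mu> * ((x - sc \<mu>) ^ Suc k * P \<mu>) = (x - sc \<mu>) ^ Suc k * P \<mu>"
        by (simp only: mult.assoc[symmetric]) (simp only: mult.assoc idem[OF \<mu>])
      have "((x - sc \<mu>) * P \<mu>) ^ Suc (Suc k) = ((x - sc \<mu>) * P \<mu>) * ((x - sc \<mu>) * ((x - sc \<mu>) ^ k * P \<mu>))"
        by (simp only: power_Suc[of _ "Suc k"] Suc)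
      also have "\<dots> = (x - sc \<mu>) * (P \<mu> * ((x - sc \<mu>) ^ Suc k * P \<mu>))"
        by (simp only: power_Suc mult.assoc)
      finally show ?case by (simp only: e)
    qed simp
    then have "tr ((x - sc \<mu>) * P \<mu>) = 0" by (intro tr_nilpotent[of _ "Suc N"]) (simp only: N mult_zero_right)
    then show ?thesis by (simp add: left_diff_distrib tr_diff tr_sc)
  qed
  have "tr (x * (\<Sum>\<mu>\<in>S. sc (cnj \<mu>) * P \<mu>)) = 0"
    by (rule orth[OF conjugate_semisimple_part_in_lie[OF x S or nil]])
  then have z: "(\<Sum>\<mu>\<in>S. cnj \<mu> * (\<mu> * tr (P \<mu>))) = 0"
    by (simp add: sum_distrib_left tr_sum sc_left_commute tr_sc trP)
  have "\<forall>\<mu>. \<exists>r::nat. \<mu> \<in> S \<longrightarrow> tr (P \<mu>) = of_nat r \<and> (r = 0 \<longrightarrow> P \<mu> = 0)"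
    using tr_idempotent[OF idem] by blast
  then obtain r :: "complex \<Rightarrow> nat" where r: "\<And>\<mu>. \<mu> \<in> S \<Longrightarrow> tr (P \<mu>) = of_nat (r \<mu>) \<and> (r \<mu> = 0 \<longrightarrow> P \<mu> = 0)"
    by metis
  have "of_real (\<Sum>\<mu>\<in>S. (cmod \<mu>)\<^sup>2 * real (r \<mu>)) = (\<Sum>\<mu>\<in>S. cnj \<mu> * (\<mu> * tr (P \<mu>)))"
    unfolding of_real_sum
    by (rule sum.cong) (simp_all add: r complex_norm_square mult_ac del: of_real_power)
  then have "(\<Sum>\<mu>\<in>S. (cmod \<mu>)\<^sup>2 * real (r \<mu>)) = 0" by (simp only: z of_real_eq_0_iff)
  then have "\<forall>\<mu>\<in>S. (cmod \<mu>)\<^sup>2 * real (r \<mu>) = 0"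
    by (subst (asm) sum_nonneg_eq_0_iff[OF S(1)]) auto
  then have P0: "P \<mu> = 0" if "\<mu> \<in> S" "\<mu> \<noteq> 0" for \<mu> using r[OF that(1)] that by auto
  show ?thesis
  proof (cases "0 \<in> S")
    case True
    have "P 0 = 1" using S P0 by (simp add: sum.remove[OF S(1) True])
    then show ?thesis using nil[OF True] by simp
  next
    case False
    then have "(\<Sum>\<mu>\<in>S. P \<mu>) = 0" using P0 by (intro sum.neutral) metis
    then show ?thesis using S(2) by simp
  qed
qed

text \<open>
  The centre of a stable ideal is an abelian stable ideal.
\<close>

lemma center_trivial:
  assumes rad: "radical G = {mat 1}" and n: "subspace n" "n \<subseteq> lie" "\<And>t X. X \<in> n \<Longrightarrow> sc t * X \<in> n"
    and Ad: "\<And>g h X. g \<in> GM \<Longrightarrow> h * g = 1 \<Longrightarrow> X \<in> n \<Longrightarrow> g * X * h \<in> n"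
    and y: "y \<in> n" "\<And>s. s \<in> n \<Longrightarrow> y * s = s * y"
  shows "y = 0"
proof (rule abelian_ideal_trivial[OF rad, of "{y \<in> n. \<forall>s\<in>n. y * s = s * y}"])
  let ?c = "{y \<in> n. \<forall>s\<in>n. y * s = s * y}"
  show "subspace ?c"
    unfolding subspace_def using n(1)
    by (auto simp: subspace_0 subspace_add subspace_scale distrib_left distrib_right)
  show "?c \<subseteq> lie" "y \<in> ?c" using n(2) y by auto
  show "sc t * X \<in> ?c" if "X \<in> ?c" for t X
    using that n(3) by (auto simp: mult.assoc sc_left_commute)
  show "X * Y = Y * X" if "X \<in> ?c" "Y \<in> ?c" for X Y using that by blast
  show "g * X * h \<in> ?c" if g: "g \<in> GM" "h * g = 1" and X: "X \<in> ?c" for g h X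
  proof (intro CollectI conjI ballI)
    show "g * X * h \<in> n" using Ad g X by blast
    fix s assume s: "s \<in> n"
    have gh: "h \<in> GM" "g * h = 1" using left_inverse_GM[OF g] by auto
    have c: "X * (h * s * g) = (h * s * g) * X" using X Ad[OF gh s] by blast
    have "g * X * h * s = g * X * h * s * (g * h)" by (simp add: gh)
    also have "\<dots> = g * (X * (h * s * g)) * h" by (simp add: mult.assoc)
    also have "\<dots> = g * ((h * s * g) * X) * h" by (simp only: c)
    also have "\<dots> = (g * h) * s * (g * X * h)" by (simp add: mult.assoc)
    finally show "g * X * h * s = s * (g * X * h)" by (simp add: gh)
  qed
qed

text \<open>
  The radical of the trace form is a stable ideal of nilpotent matrices, so by Engel's theorem it is zero
  or has a nonzero central element.
\<close>

lemma trace_form_nondegenerate: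
  assumes rad: "radical G = {mat 1}" and x: "x \<in> lie" "\<And>y. y \<in> lie \<Longrightarrow> tr (x * y) = 0"
  shows "x = 0"
proof (rule ccontr)
  assume "x \<noteq> 0"
  define n where "n = {x \<in> lie. \<forall>y\<in>lie. tr (x * y) = 0}"
  have n: "X \<in> lie" "Y \<in> lie \<Longrightarrow> tr (X * Y) = 0" if "X \<in> n" for X Y using that by (auto simp: n_def)
  have nsub: "subspace n"
    unfolding subspace_def n_def using subspace_lie
    by (auto simp: subspace_0 subspace_add subspace_scale tr_0 tr_add tr_scaleR distrib_right)
  have Ad: "g * X * h \<in> n" if g: "g \<in> GM" "h * g = 1" and X: "X \<in> n" for g h X
    unfolding n_def
  proof (intro CollectI conjI ballI)
    show "g * X * h \<in> lie" by (rule lie_Ad[OF g n(1)[OF X]])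
    fix y assume y: "y \<in> lie"
    have "tr (g * X * h * y) = tr (g * (X * h * y))" by (simp add: mult.assoc)
    also have "\<dots> = tr (X * (h * y * g))" by (subst tr_commute) (simp add: mult.assoc)
    also have "\<dots> = 0" by (rule n(2)[OF X lie_Ad[OF left_inverse_GM[OF g] y]])
    finally show "tr (g * X * h * y) = 0" .
  qed
  have xn: "x \<in> n" using x by (auto simp: n_def)
  have br: "X * Y - Y * X \<in> n" if "X \<in> n" "Y \<in> n" for X Y
    by (rule Ad_stable_bracket[OF nsub _ n(1)[OF that(1)] that(2)]) (rule Ad)
  have nilp: "\<exists>k. X ^ k = 0" if "X \<in> n" for X
    by (rule trace_orthogonal_imp_nilpotent[OF n(1)[OF that] n(2)[OF that]])
  have "\<exists>y\<in>n. y \<noteq> 0 \<and> (\<forall>s\<in>n. y * s = s * y)"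
    by (rule nilpotent_Lie_algebra_center[OF nsub _ _ xn \<open>x \<noteq> 0\<close>], erule (1) br, erule nilp)
  then obtain y where y: "y \<in> n" "y \<noteq> 0" "\<forall>s\<in>n. y * s = s * y" by (elim bexE conjE)
  have "y = 0"
  proof (rule center_trivial[OF rad nsub _ _ Ad y(1) bspec[OF y(3)]])
    show "n \<subseteq> lie" using n(1) by blast
    show "sc t * X \<in> n" if "X \<in> n" for t X
      unfolding n_def by (intro CollectI conjI ballI lie_sc n(1)[OF that]) (simp only: mult.assoc tr_sc n(2)[OF that] mult_zero_right)
  qed
  then show False using y(2) by simp
qed

text \<open>
  If the brackets spanned a smaller space \<open>D\<close>, a dimension count would give a nonzero \<open>z\<close> in \<open>lie\<close> that is
  orthogonal to \<open>D\<close> for the real part of the trace form. By invariance \<open>tr (z [x, y]) = tr ([z, x] y)\<close>,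
  so \<open>[z, x]\<close> is orthogonal to \<open>lie\<close>, hence zero for every \<open>x\<close>, and \<open>z\<close> is central.
\<close>

lemma lie_perfect:
  assumes rad: "radical G = {mat 1}"
  shows "lie \<subseteq> span {x * y - y * x | x y. x \<in> lie \<and> y \<in> lie}"
proof (rule ccontr)
  define D where "D = span {x * y - y * x | x y. x \<in> lie \<and> y \<in> lie}"
  assume "\<not> lie \<subseteq> span {x * y - y * x | x y. x \<in> lie \<and> y \<in> lie}"
  then have ns: "\<not> lie \<subseteq> D" by (simp add: D_def)
  have Dlie: "D \<subseteq> lie" unfolding D_def by (rule span_minimal) (use lie_bracket subspace_lie in auto)
  have Dsub: "subspace D" by (simp add: D_def)
  obtain C where C: "C \<subseteq> D" "independent C" "D \<subseteq> span C" "card C = dim D" by (rule basis_exists)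
  have finC: "finite C" by (rule independent_imp_finite[OF C(2)])
  define \<psi> where "\<psi> z = (\<Sum>c\<in>C. Re (tr (z * c)) *\<^sub>R c)" for z
  have lin: "linear \<psi>"
    by (rule linearI) (simp_all add: \<psi>_def distrib_right tr_add tr_scaleR scaleR_add_left sum.distrib scaleR_sum_right)
  have "\<exists>z\<in>lie. z \<noteq> 0 \<and> \<psi> z = 0"
  proof (rule ccontr)
    assume "\<not> ?thesis"
    then have "inj_on \<psi> lie"
      unfolding linear_inj_on_iff_eq_0[OF lin subspace_lie] by blast
    then have inj: "inj_on \<psi> (span lie)" by (simp only: span_eq_iff[THEN iffD2, OF subspace_lie])
    have "dim lie = dim (\<psi> ` lie)" by (rule dim_image_eq[OF lin inj, symmetric])
    also have "\<psi> ` lie \<subseteq> D"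
      using C(1) Dsub by (auto simp: \<psi>_def intro!: subspace_sum subspace_scale)
    then have "dim (\<psi> ` lie) \<le> dim D" by (rule dim_subset)
    finally have "D = lie" by (rule subspace_dim_equal[OF Dsub subspace_lie Dlie])
    then show False using ns by simp
  qed
  then obtain z where z: "z \<in> lie" "z \<noteq> 0" "\<psi> z = 0" by blast
  have zC: "Re (tr (z * c)) = 0" if "c \<in> C" for c
  proof (rule ccontr)
    assume ne: "Re (tr (z * c)) \<noteq> 0"
    have "(\<Sum>c\<in>C. Re (tr (z * c)) *\<^sub>R c) = 0" using z(3) by (simp add: \<psi>_def)
    then have "dependent C"
      unfolding dependent_finite[OF finC] by (intro exI[of _ "\<lambda>c. Re (tr (z * c))"] conjI bexI[where x = c] ne that)
    then show False using C(2) by blast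
  qed
  have zD: "Re (tr (z * d)) = 0" if "d \<in> D" for d
  proof -
    have "d \<in> span C" using C(3) that by blast
    then show ?thesis
      by (induct rule: span_induct_alt) (simp_all add: tr_0 distrib_left tr_add tr_scaleR zC)
  qed
  have Rez: "Re (tr ((z * x - x * z) * y)) = 0" if "x \<in> lie" "y \<in> lie" for x y
  proof -
    have "x * y - y * x \<in> D" unfolding D_def by (rule span_base) (use that in blast)
    from zD[OF this] have 1: "Re (tr (z * x * y)) = Re (tr (z * y * x))" by (simp add: right_diff_distrib tr_diff mult.assoc)
    have 2: "tr (z * y * x) = tr (x * z * y)" by (subst tr_commute) (simp only: mult.assoc)
    show ?thesis unfolding left_diff_distrib tr_diff minus_complex.sel 1 2 by simp
  qed
  have "z * x - x * z = 0" if x: "x \<in> lie" for x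
  proof (rule trace_form_nondegenerate[OF rad lie_bracket[OF z(1) x]])
    fix y assume y: "y \<in> lie"
    have "Re (tr ((z * x - x * z) * (sc \<i> * y))) = 0" by (rule Rez[OF x lie_sc[OF y]])
    then have "Im (tr ((z * x - x * z) * y)) = 0" by (simp add: sc_left_commute[of "z * x - x * z"] tr_sc)
    then show "tr ((z * x - x * z) * y) = 0" using Rez[OF x y] by (simp add: complex_eq_iff)
  qed
  then have "z = 0"
    by (intro center_trivial[OF rad subspace_lie _ lie_sc lie_Ad z(1)]) auto
  then show False using z(2) by simp
qed

end

section \<open>A lower bound for the Krull dimension of a group\<close>

context algebraic_matrix_group
begin

text \<open>
  Let \<open>P\<close> be the projection onto the span of the \<open>X j\<close> along the common kernel of the \<open>l j\<close>. The map
  \<open>F A = P (mexp (P A)) + (A - P A)\<close> has derivative the identity at \<open>0\<close> and a holomorphic local inverse \<open>g\<close>.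
  So \<open>\<phi> u = mexp (P (g u))\<close> is a holomorphic map into \<open>G\<close> with \<open>l j (\<phi> u) = l j u\<close>.
  Fixing the values of \<open>l j\<close> for \<open>k \<le> j\<close> gives convex slices \<open>sl k\<close> of a ball. Their images under \<open>\<phi>\<close> are
  irreducible, being joined by holomorphic curves, and \<open>l k\<close> is constant on the \<open>k\<close>-th image but not on
  the next one. Hence their closures form a strict chain of length \<open>m\<close>.
\<close>

theorem lie_dim_le_group_dim:
  fixes X :: "nat \<Rightarrow> 'n cmat" and l :: "nat \<Rightarrow> complex^'n^'n \<Rightarrow> complex"
  assumes X: "\<And>j. j < m \<Longrightarrow> X j \<in> lie"
    and l: "\<And>j. j < m \<Longrightarrow> Vector_Spaces.linear mscale (*) (l j)"
    and dual: "\<And>i j. i < m \<Longrightarrow> j < m \<Longrightarrow> l i (raw (X j)) = (if i = j then 1 else 0)"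
  shows "enat m \<le> group_dim G"
proof -
  have l_add: "l j (raw A + raw B) = l j (raw A) + l j (raw B)"
    and l_sc: "l j (raw (sc t * A)) = t * l j (raw A)" if "j < m" for j A B t
    using l[OF that] linear_form_raw(2)[OF l[OF that]] by (auto simp: linear_form_iff)
  have l_sum: "l j (raw (\<Sum>i\<in>I. A i)) = (\<Sum>i\<in>I. l j (raw (A i)))" if "j < m" for j I and A :: "nat \<Rightarrow> 'n cmat"
    using linear_sum[OF bounded_linear.linear[OF linear_form_raw(1)[OF l[OF that]]]] .
  define P where "P Z = (\<Sum>j<m. sc (l j (raw Z)) * X j)" for Z
  have P_add: "P (A + B) = P A + P B" for A B
    unfolding P_def sum.distrib[symmetric] by (rule sum.cong) (simp_all add: l_add sc_add distrib_right)
  have P_sc: "P (sc t * A) = sc t * P A" for t A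
    unfolding P_def sum_distrib_left by (rule sum.cong) (simp_all only: lessThan_iff l_sc sc_mult mult.assoc)
  have P_lin: "linear P"
    by (rule linearI) (simp_all only: P_add P_sc sc_of_real[symmetric])
  have P_bl: "bounded_linear P" using P_lin by (simp add: linear_conv_bounded_linear)
  have P_diff: "P (A - B) = P A - P B" for A B by (rule linear_diff[OF P_lin])
  have lP: "l i (raw (P Z)) = l i (raw Z)" if "i < m" for i Z
  proof -
    have "l i (raw (P Z)) = (\<Sum>j<m. l j (raw Z) * (if i = j then 1 else 0))"
      unfolding P_def l_sum[OF that] by (rule sum.cong) (simp_all only: lessThan_iff l_sc[OF that] dual[OF that])
    also have "\<dots> = (\<Sum>j<m. if j = i then l i (raw Z) else 0)"
      by (rule sum.cong) auto
    also have "\<dots> = l i (raw Z)" using that by simp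
    finally show ?thesis .
  qed
  have PP: "P (P Z) = P Z" for Z
  proof -
    have "P (P Z) = (\<Sum>j<m. sc (l j (raw (P Z))) * X j)" by (rule P_def)
    also have "\<dots> = (\<Sum>j<m. sc (l j (raw Z)) * X j)" by (rule sum.cong) (simp_all only: lessThan_iff lP)
    also have "\<dots> = P Z" by (rule P_def[symmetric])
    finally show ?thesis .
  qed
  have P_lie: "P Z \<in> lie" for Z
    unfolding P_def by (rule subspace_sum[OF subspace_lie]) (simp add: lie_sc X)
  define F where "F A = P (mexp (P A)) + (A - P A)" for A
  define F' where "F' A H = P (dexp (P A) (P H)) + (H - P H)" for A H
  have FD: "(F has_derivative F' A) (at A)" for A
  proof -
    have "((\<lambda>A. mexp (P A)) has_derivative (\<lambda>H. dexp (P A) (P H))) (at A)"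
      by (rule has_derivative_compose[OF bounded_linear_imp_has_derivative[OF P_bl] has_derivative_mexp])
    from bounded_linear.has_derivative[OF P_bl this]
    show ?thesis unfolding F_def[abs_def] F'_def[abs_def]
      by (rule has_derivative_add[OF _ has_derivative_diff[OF has_derivative_ident bounded_linear_imp_has_derivative[OF P_bl]]])
  qed
  obtain K where K: "\<And>A. norm (P A) \<le> norm A * K" "K > 0" using bounded_linear.pos_bounded[OF P_bl] by blast
  \<comment> \<open>An upper bound for the distance of \<open>F' A\<close> from the identity when \<open>norm A \<le> r\<close>; the radius \<open>\<delta>\<close> is chosen to make it at most \<open>1/2\<close>.\<close>
  define b where "b r = K * K * (norm (1::'n cmat))\<^sup>2 * (exp (r * K) - 1)" for r
  have "isCont b 0" unfolding b_def[abs_def] by (intro continuous_intros)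
  moreover have "b 0 = 0" by (simp add: b_def)
  ultimately have "(b \<longlongrightarrow> 0) (at 0)" by (simp add: isCont_def)
  then obtain \<delta>0 where d0: "\<delta>0 > 0" "\<And>r. r \<noteq> 0 \<Longrightarrow> norm r < \<delta>0 \<Longrightarrow> norm (b r) < 1/2"
    using LIM_D[of b 0 0 "1/2"] by auto
  define \<delta> where "\<delta> = \<delta>0 / 2"
  have d: "\<delta> > 0" "b \<delta> \<le> 1/2"
    using d0(1) d0(2)[of \<delta>] by (auto simp: \<delta>_def)
  have near: "norm (F' A H - H) \<le> 1/2 * norm H" if A: "norm A < \<delta>" for A H
  proof -
    have "F' A H - H = P (dexp (P A) (P H) - P H)" by (simp add: F'_def P_diff PP)
    then have "norm (F' A H - H) \<le> norm (dexp (P A) (P H) - P H) * K" using K(1) by simp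
    also have "\<dots> \<le> ((norm (1::'n cmat))\<^sup>2 * norm (P H) * (exp (norm (P A)) - 1)) * K"
      by (rule mult_right_mono[OF dexp_near_id]) (use K(2) in simp)
    also have "\<dots> \<le> ((norm (1::'n cmat))\<^sup>2 * (norm H * K) * (exp (\<delta> * K) - 1)) * K"
    proof (intro mult_right_mono mult_mono order_refl K(1))
      have "norm (P A) \<le> norm A * K" by (rule K(1))
      also have "\<dots> \<le> \<delta> * K" using A K(2) by (intro mult_right_mono) auto
      finally show "exp (norm (P A)) - 1 \<le> exp (\<delta> * K) - 1" by simp
    qed (use K(2) in auto)
    also have "\<dots> = b \<delta> * norm H" by (simp add: b_def mult_ac)
    also have "\<dots> \<le> 1/2 * norm H" by (rule mult_right_mono[OF d(2)]) simp
    finally show ?thesis .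
  qed
  let ?B = "ball (0::'n cmat) \<delta>"
  have inj: "inj_on F ?B"
  proof (rule inj_onI)
    fix A B assume AB: "A \<in> ?B" "B \<in> ?B" "F A = F B"
    have "norm ((F A - A) - (F B - B)) \<le> 1/2 * norm (A - B)"
    proof (rule differentiable_bound[where f = "\<lambda>A. F A - A" and f' = "\<lambda>A H. F' A H - H" and S = ?B])
      show "((\<lambda>A. F A - A) has_derivative (\<lambda>H. F' x H - H)) (at x within ?B)" for x
        by (rule has_derivative_at_withinI[OF has_derivative_diff[OF FD has_derivative_ident]])
      show "onorm (\<lambda>H. F' x H - H) \<le> 1/2" if "x \<in> ?B" for x
        by (rule onorm_le) (rule near, use that in simp)
    qed (use AB in auto)
    then have "norm (A - B) \<le> 1/2 * norm (A - B)" using AB(3) by (simp add: norm_minus_commute)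
    then show "A = B" by simp
  qed
  have contF: "continuous_on ?B F"
    by (rule has_derivative_continuous_on) (rule has_derivative_at_withinI[OF FD])
  define U where "U = F ` ?B"
  have U: "open U" unfolding U_def by (rule invariance_of_domain[OF contF open_ball inj])
  define g where "g = inv_into ?B F"
  have gF: "g (F A) = A" if "A \<in> ?B" for A unfolding g_def by (rule inv_into_f_f[OF inj that])
  have gD: "\<exists>g'. (g has_derivative g') (at u) \<and> (\<forall>t H. g' (sc t * H) = sc t * g' H)" if u: "u \<in> U" for u
  proof -
    obtain A where A: "A \<in> ?B" "u = F A" using u unfolding U_def by blast
    have nA: "norm A < \<delta>" using A by simp
    have lin: "linear (F' A)" using FD by (rule has_derivative_linear)
    have zero: "H = 0" if "F' A H = 0" for H using near[OF nA, of H] that by simp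
    have "inj (F' A)" using linear_injective_0[OF lin] zero by blast
    then obtain g' where g': "linear g'" "\<And>H. g' (F' A H) = H" "\<And>H. F' A (g' H) = H"
      using linear_injective_isomorphism[OF lin] by blast
    have "(g has_derivative g') (at (F A))"
      by (rule has_derivative_inverse_on[OF open_ball FD gF _ A(1), where g' = "\<lambda>_. g'"])
        (auto simp: g'(3) fun_eq_iff)
    moreover have "g' (sc t * H) = sc t * g' H" for t H
    proof -
      have "F' A (sc t * g' H) = sc t * F' A (g' H)"
        unfolding F'_def P_sc dexp_sc by (simp only: distrib_left right_diff_distrib)
      then have "F' A (sc t * g' H) = F' A (g' (sc t * H))" by (simp only: g'(3))
      then show ?thesis by (metis g'(2))
    qed
    ultimately show ?thesis using A(2) by blast
  qed
  define \<phi> where "\<phi> u = mexp (P (g u))" for u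
  have \<phi>G: "\<phi> u \<in> GM" for u unfolding \<phi>_def by (rule mexp_lie_in_GM[OF P_lie])
  have P\<phi>: "P (\<phi> u) = P u" if u: "u \<in> U" for u
  proof -
    obtain A where A: "A \<in> ?B" "u = F A" using u unfolding U_def by blast
    have "P u = P (P (\<phi> u)) + (P (g u) - P (P (g u)))"
      using gF[OF A(1)] by (simp add: A(2) F_def \<phi>_def P_add P_diff)
    then show ?thesis by (simp add: PP)
  qed
  have l\<phi>: "l j (raw (\<phi> u)) = l j (raw u)" if "u \<in> U" "j < m" for u j
    using lP[OF that(2), of "\<phi> u"] lP[OF that(2), of u] P\<phi>[OF that(1)] by simp
  have \<phi>D: "\<exists>D. (\<phi> has_derivative D) (at u) \<and> (\<forall>t H. D (sc t * H) = sc t * D H)" if u: "u \<in> U" for u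
  proof -
    obtain g' where g': "(g has_derivative g') (at u)" "\<And>t H. g' (sc t * H) = sc t * g' H" using gD[OF u] by blast
    have "(\<phi> has_derivative (\<lambda>H. dexp (P (g u)) (P (g' H)))) (at u)"
      unfolding \<phi>_def[abs_def]
      by (rule has_derivative_compose[OF bounded_linear.has_derivative[OF P_bl g'(1)] has_derivative_mexp])
    then show ?thesis by (intro exI conjI allI) (assumption, simp only: g'(2) P_sc dexp_sc)
  qed
  define c0 where "c0 = F 0"
  have "c0 \<in> U" unfolding c0_def U_def using d(1) by simp
  then obtain \<epsilon> where \<epsilon>: "\<epsilon> > 0" "ball c0 \<epsilon> \<subseteq> U" using U openE by blast
  define sl where "sl k = {u \<in> ball c0 \<epsilon>. \<forall>j<m. k \<le> j \<longrightarrow> l j (raw u) = l j (raw c0)}" for k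
  define Y where "Y k = \<phi> ` sl k" for k
  let ?X = "subtopology (zariski mscale) G"
  have YG: "raw ` Y k \<subseteq> G" for k using \<phi>G by (auto simp: Y_def GM_def)
  have irrY: "irreducible_in (zariski mscale) (raw ` Y k)" for k
  proof (rule irreducible_in_zariski_curves)
    have "c0 \<in> sl k" using \<epsilon>(1) by (simp add: sl_def)
    then show "Y k \<noteq> {}" by (auto simp: Y_def)
    fix a b assume "a \<in> Y k" "b \<in> Y k"
    then obtain u v where uv: "u \<in> sl k" "a = \<phi> u" "v \<in> sl k" "b = \<phi> v" by (auto simp: Y_def)
    define L where "L z = u + sc z * (v - u)" for z
    have LD: "(L has_derivative (\<lambda>h. sc h * (v - u))) (at z)" for z
      unfolding L_def[abs_def]
      by (rule derivative_eq_intros bounded_linear_imp_has_derivative[OF bounded_linear_sc] refl)+ simp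
    define S where "S = {z. L z \<in> ball c0 \<epsilon>}"
    have lL: "l j (raw (L z)) = l j (raw c0)" if "j < m" "k \<le> j" for j z
    proof -
      have "l j (raw u) = l j (raw c0)" "l j (raw v) = l j (raw c0)" using uv that by (auto simp: sl_def)
      moreover have "l j (raw (v - u)) = l j (raw v) - l j (raw u)"
        using l_add[OF that(1), of "v - u" u] by simp
      ultimately show ?thesis
        unfolding L_def raw_simps(3) l_add[OF that(1)] l_sc[OF that(1)] by simp
    qed
    have Lsl: "L z \<in> sl k" if "z \<in> S" for z using that lL by (simp add: S_def sl_def)
    have "continuous_on UNIV L"
      by (rule has_derivative_continuous_on) (rule has_derivative_at_withinI[OF LD])
    then have "open (L -` ball c0 \<epsilon>)" by (rule open_vimage[OF open_ball])
    moreover have "L -` ball c0 \<epsilon> = S" by (auto simp: S_def)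
    ultimately have Sopen: "open S" by simp
    have Sconv: "convex S"
      unfolding convex_def
    proof (intro ballI allI impI)
      fix z w and p q :: real assume zw: "z \<in> S" "w \<in> S" and pq: "0 \<le> p" "0 \<le> q" "p + q = 1"
      have "(sc (p *\<^sub>R z + q *\<^sub>R w) :: 'n cmat) = p *\<^sub>R sc z + q *\<^sub>R sc w"
        by (simp only: linear_add[OF linear_sc] linear_scale[OF linear_sc])
      moreover have "u = p *\<^sub>R u + q *\<^sub>R u" using pq(3) by (metis scaleR_add_left scaleR_one)
      ultimately have "L (p *\<^sub>R z + q *\<^sub>R w) = p *\<^sub>R L z + q *\<^sub>R L w"
        unfolding L_def by (simp add: distrib_right scaleR_add_right)
      moreover have "p *\<^sub>R L z + q *\<^sub>R L w \<in> ball c0 \<epsilon>"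
        by (rule convexD[OF convex_ball _ _ pq]) (use zw in \<open>simp_all only: S_def mem_Collect_eq\<close>)
      ultimately show "p *\<^sub>R z + q *\<^sub>R w \<in> S" by (simp only: S_def mem_Collect_eq)
    qed
    show "\<exists>S \<gamma> s t. open S \<and> connected S \<and> \<gamma> ` S \<subseteq> Y k \<and> s \<in> S \<and> t \<in> S \<and>
        \<gamma> s = a \<and> \<gamma> t = b \<and> (\<forall>p\<in>poly_fun mscale. (\<lambda>z. p (raw (\<gamma> z))) holomorphic_on S)"
    proof (intro exI conjI ballI)
      show "open S" by (rule Sopen)
      show "connected S" by (rule convex_connected[OF Sconv])
      show "(\<lambda>z. \<phi> (L z)) ` S \<subseteq> Y k" using Lsl by (auto simp: Y_def)
      show "0 \<in> S" "1 \<in> S" using uv by (simp_all add: S_def L_def sl_def)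
      show "\<phi> (L 0) = a" "\<phi> (L 1) = b" using uv by (simp_all add: L_def)
      fix p assume p: "p \<in> poly_fun (mscale :: complex \<Rightarrow> complex^'n^'n \<Rightarrow> _)"
      show "(\<lambda>z. p (raw (\<phi> (L z)))) holomorphic_on S"
        unfolding holomorphic_on_def field_differentiable_def
      proof
        fix z assume "z \<in> S"
        then have "L z \<in> U" using \<epsilon>(2) by (auto simp: S_def)
        then obtain D where D: "(\<phi> has_derivative D) (at (L z))" "\<And>t H. D (sc t * H) = sc t * D H" using \<phi>D by blast
        have "((\<lambda>z. \<phi> (L z)) has_derivative (\<lambda>h. sc h * D (v - u))) (at z)"
          using has_derivative_compose[OF LD D(1)] by (simp only: D(2))
        from cdiff_field_derivative[OF cdiff_poly_fun[OF p] this]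
        obtain f' where "((\<lambda>z. p (raw (\<phi> (L z)))) has_field_derivative f') (at z)" by blast
        then show "\<exists>f'. ((\<lambda>z. p (raw (\<phi> (L z)))) has_field_derivative f') (at z within S)"
          using has_field_derivative_at_within by blast
      qed
    qed
  qed
  define Z where "Z k = ?X closure_of (raw ` Y k)" for k
  have Zirr: "closedin ?X (Z k)" "irreducible_in ?X (Z k)" for k
    unfolding Z_def by (rule closedin_closure_of) (rule irreducible_in_closure[OF irreducible_in_subtopology[OF irrY YG]])
  have YZ: "raw ` Y k \<subseteq> Z k" for k
    unfolding Z_def by (rule closure_of_subset) (use YG in simp)
  have strict: "Z k \<subset> Z (Suc k)" if k: "k < m" for k
  proof
    have "sl k \<subseteq> sl (Suc k)" by (auto simp: sl_def)
    then show "Z k \<subseteq> Z (Suc k)" unfolding Z_def Y_def by (intro closure_of_mono image_mono)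
    let ?C = "{A. l k A - l k (raw c0) = 0}"
    have "closedin (zariski mscale) ?C"
      unfolding closedin_zariski
      by (rule exI[of _ "{\<lambda>A. l k A - l k (raw c0)}"])
        (auto intro: poly_fun_diff_const poly_fun.linear_form l[OF k])
    then have "closedin ?X (?C \<inter> G)" by (auto simp: closedin_subtopology)
    moreover have "raw ` Y k \<subseteq> ?C \<inter> G"
      using YG l\<phi>[OF _ k] \<epsilon>(2) k by (auto simp: Y_def sl_def)
    ultimately have ZC: "Z k \<subseteq> ?C \<inter> G" unfolding Z_def by (intro closure_of_minimal)
    \<comment> \<open>Moving the centre by a small multiple of \<open>X k\<close> changes \<open>l k\<close> and keeps the other values.\<close>
    define \<eta> where "\<eta> = \<epsilon> / (2 * (norm (X k) + 1))"
    have \<eta>: "\<eta> > 0" "\<eta> * norm (X k) < \<epsilon>"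
    proof -
      have n: "norm (X k) + 1 > 0" by (simp add: add_nonneg_pos)
      show "\<eta> > 0" unfolding \<eta>_def using n \<epsilon>(1) by simp
      have "\<eta> * norm (X k) \<le> \<eta> * (norm (X k) + 1)" using \<open>\<eta> > 0\<close> by simp
      also have "\<dots> = \<epsilon> / 2" unfolding \<eta>_def using n by (simp add: field_simps)
      also have "\<dots> < \<epsilon>" using \<epsilon>(1) by simp
      finally show "\<eta> * norm (X k) < \<epsilon>" .
    qed
    define u where "u = c0 + sc (of_real \<eta>) * X k"
    have ub: "u \<in> ball c0 \<epsilon>" using \<eta> by (simp add: u_def dist_norm norm_sc_mult)
    have lu: "l j (raw u) = l j (raw c0) + of_real \<eta> * (if j = k then 1 else 0)" if "j < m" for j
      unfolding u_def raw_simps(3) l_add[OF that] l_sc[OF that] by (simp only: dual[OF that k])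
    have "u \<in> sl (Suc k)" using ub lu by (auto simp: sl_def)
    then have "raw (\<phi> u) \<in> Z (Suc k)" using YZ[of "Suc k"] by (auto simp: Y_def)
    moreover have "raw (\<phi> u) \<notin> Z k"
    proof
      assume "raw (\<phi> u) \<in> Z k"
      then have "l k (raw (\<phi> u)) = l k (raw c0)" using ZC by auto
      then have "l k (raw u) = l k (raw c0)" using l\<phi>[OF _ k, of u] ub \<epsilon>(2) by auto
      then show False using lu[OF k] \<eta>(1) by simp
    qed
    ultimately show "Z k \<noteq> Z (Suc k)" by blast
  qed
  show ?thesis
    unfolding group_dim_def krull_dim_def
    by (rule Sup_upper, rule CollectI, rule exI[of _ m], intro conjI refl exI[of _ Z] allI impI)
      (use Zirr strict in auto)
qed

end

section \<open>Local structure of a closed subgroup\<close>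

context algebraic_matrix_group
begin

lemma mexp_quotient_tendsto:
  fixes Y :: "nat \<Rightarrow> 'n cmat"
  assumes Y: "Y \<longlonglongrightarrow> 0" "\<And>i. Y i \<noteq> 0" and d: "(\<lambda>i. inverse (norm (Y i)) *\<^sub>R Y i) \<longlonglongrightarrow> Z"
  shows "(\<lambda>i. inverse (norm (Y i)) *\<^sub>R (mexp (Y i) - 1)) \<longlonglongrightarrow> Z"
proof -
  have D: "(mexp has_derivative (\<lambda>H. H)) (at (0 :: 'n cmat))"
    using has_derivative_mexp[of "0 :: 'n cmat"] unfolding dexp_0 .
  have "((\<lambda>y. (mexp y - mexp 0 - (y - 0)) /\<^sub>R norm (y - 0)) \<longlongrightarrow> 0) (at (0 :: 'n cmat))"
    using D unfolding has_derivative_at_within by blast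
  moreover have "filterlim Y (at 0) sequentially"
    by (rule filterlim_atI[OF Y(1)]) (simp add: Y(2))
  ultimately have "(\<lambda>i. (mexp (Y i) - mexp 0 - (Y i - 0)) /\<^sub>R norm (Y i - 0)) \<longlonglongrightarrow> 0"
    by (rule filterlim_compose)
  from tendsto_add[OF this d] show ?thesis
    by (simp add: scaleR_diff_right)
qed

text \<open>
  The closed subgroup theorem. By the open mapping theorem every matrix near the identity is of the
  form \<open>\<Psi> Z = mexp (P1 Z) * mexp (P2 Z) * mexp (P3 Z)\<close> with small \<open>Z\<close>. If there were elements of the group
  arbitrarily close to the identity with \<open>P3 Z \<noteq> 0\<close>, then the matrices \<open>mexp (P3 Z)\<close> would lie in the group, and a limit
  of the normalised \<open>P3 Z\<close> would be an element of norm \<open>1\<close> in \<open>lie\<close> that \<open>P3\<close> fixes; but \<open>P3\<close> vanishes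
  on \<open>lie\<close>.
\<close>

theorem group_chart:
  fixes P1 P2 P3 :: "'n cmat \<Rightarrow> 'n cmat"
  assumes lin: "linear P1" "linear P2" "linear P3" and id: "\<And>Z. P1 Z + P2 Z + P3 Z = Z"
    and lie: "\<And>Z. P1 Z \<in> lie" "\<And>Z. P2 Z \<in> lie" and P3: "\<And>Z. Z \<in> lie \<Longrightarrow> P3 Z = 0" "\<And>Z. P3 (P3 Z) = P3 Z"
  shows "\<exists>W. open W \<and> 1 \<in> W \<and> (\<forall>g\<in>GM \<inter> W. \<exists>Z. g = mexp (P1 Z) * mexp (P2 Z))"
proof (rule ccontr)
  assume neg: "\<not> ?thesis"
  have bl: "bounded_linear P1" "bounded_linear P2" "bounded_linear P3"
    using lin by (simp_all add: linear_conv_bounded_linear)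
  define \<Psi> where "\<Psi> Z = mexp (P1 Z) * mexp (P2 Z) * mexp (P3 Z)" for Z
  have \<Psi>0: "\<Psi> 0 = 1" by (simp add: \<Psi>_def linear_0[OF lin(1)] linear_0[OF lin(2)] linear_0[OF lin(3)])
  have D: "((\<lambda>Z. mexp (P Z)) has_derivative (\<lambda>H. dexp (P Z) (P H))) (at Z)" if "bounded_linear P" for P :: "'n cmat \<Rightarrow> 'n cmat" and Z
    by (rule has_derivative_compose[OF bounded_linear_imp_has_derivative[OF that] has_derivative_mexp])
  note der = has_derivative_mult[OF has_derivative_mult[OF D[OF bl(1)] D[OF bl(2)]] D[OF bl(3)]]
  have "(\<Psi> has_derivative (\<lambda>H. mexp (P1 0) * mexp (P2 0) * dexp (P3 0) (P3 H)
     + (mexp (P1 0) * dexp (P2 0) (P2 H) + dexp (P1 0) (P1 H) * mexp (P2 0)) * mexp (P3 0))) (at 0)"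
    unfolding \<Psi>_def[abs_def] by (rule der)
  moreover have "(\<lambda>H. mexp (P1 0) * mexp (P2 0) * dexp (P3 0) (P3 H)
     + (mexp (P1 0) * dexp (P2 0) (P2 H) + dexp (P1 0) (P1 H) * mexp (P2 0)) * mexp (P3 0)) = (\<lambda>H. H)"
  proof
    fix H
    have "P3 H + (P2 H + P1 H) = H" using id[of H] by (simp add: add_ac)
    then show "mexp (P1 0) * mexp (P2 0) * dexp (P3 0) (P3 H)
     + (mexp (P1 0) * dexp (P2 0) (P2 H) + dexp (P1 0) (P1 H) * mexp (P2 0)) * mexp (P3 0) = H"
      by (simp add: linear_0[OF lin(1)] linear_0[OF lin(2)] linear_0[OF lin(3)] dexp_0)
  qed
  ultimately have \<Psi>D: "(\<Psi> has_derivative (\<lambda>H. H)) (at 0)" by simp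
  have cont: "continuous_on UNIV \<Psi>"
    unfolding \<Psi>_def[abs_def]
    by (rule has_derivative_continuous_on) (rule has_derivative_at_withinI[OF der])
  define W where "W j = interior (\<Psi> ` ball 0 (inverse (real (Suc j))))" for j
  have W1: "1 \<in> W j" for j
    unfolding W_def \<Psi>0[symmetric]
  proof (rule sussmann_open_mapping[OF open_UNIV cont UNIV_I \<Psi>D bounded_linear_ident])
    show "0 \<in> interior (ball 0 (inverse (real (Suc j))))" by (simp add: interior_open)
  qed auto
  have "\<exists>Z. norm Z < inverse (real (Suc j)) \<and> \<Psi> Z \<in> GM \<and> P3 Z \<noteq> 0" for j
  proof -
    have "\<not> (\<forall>g\<in>GM \<inter> W j. \<exists>Z. g = mexp (P1 Z) * mexp (P2 Z))"
      using neg W1[of j] by (auto simp: W_def)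
    then obtain g where g: "g \<in> GM" "g \<in> W j" "\<And>Z. g \<noteq> mexp (P1 Z) * mexp (P2 Z)" by blast
    have "g \<in> \<Psi> ` ball 0 (inverse (real (Suc j)))" using g(2) interior_subset unfolding W_def by blast
    then obtain Z where Z: "Z \<in> ball 0 (inverse (real (Suc j)))" "g = \<Psi> Z" by blast
    have "P3 Z \<noteq> 0" using g(3)[of Z] Z(2) unfolding \<Psi>_def by auto
    then show ?thesis using Z g(1) by auto
  qed
  then obtain Z where Z: "\<And>j. norm (Z j) < inverse (real (Suc j))" "\<And>j. \<Psi> (Z j) \<in> GM" "\<And>j. P3 (Z j) \<noteq> 0"
    by metis
  define Y where "Y j = P3 (Z j)" for j
  have Yn0: "Y j \<noteq> 0" for j by (simp add: Y_def Z(3))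
  have "Z \<longlonglongrightarrow> 0"
    by (rule Lim_null_comparison[OF always_eventually LIMSEQ_inverse_real_of_nat])
      (rule allI, rule less_imp_le, rule Z(1))
  then have Y0: "Y \<longlonglongrightarrow> 0"
    unfolding Y_def[abs_def] using bounded_linear.tendsto[OF bl(3), of Z 0] by (simp add: linear_0[OF lin(3)])
  have YG: "mexp (Y j) \<in> GM" for j
  proof -
    have "- P2 (Z j) \<in> lie" "- P1 (Z j) \<in> lie" using lie subspace_neg[OF subspace_lie] by auto
    then have "mexp (- P2 (Z j)) * (mexp (- P1 (Z j)) * \<Psi> (Z j)) \<in> GM"
      by (intro mult_GM mexp_lie_in_GM Z(2))
    moreover have "mexp (- P2 (Z j)) * (mexp (- P1 (Z j)) * \<Psi> (Z j)) = mexp (Y j)"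
    proof -
      have "mexp (- P1 (Z j)) * \<Psi> (Z j) = (mexp (- P1 (Z j)) * mexp (P1 (Z j))) * (mexp (P2 (Z j)) * mexp (P3 (Z j)))"
        by (simp only: \<Psi>_def mult.assoc)
      then have "mexp (- P1 (Z j)) * \<Psi> (Z j) = mexp (P2 (Z j)) * mexp (P3 (Z j))"
        by (simp only: mexp_minus mult_1_left)
      then have "mexp (- P2 (Z j)) * (mexp (- P1 (Z j)) * \<Psi> (Z j)) = (mexp (- P2 (Z j)) * mexp (P2 (Z j))) * mexp (P3 (Z j))"
        by (simp only: mexp_minus mult_1_left mult.assoc[symmetric])
      then show ?thesis by (simp only: mexp_minus mult_1_left Y_def)
    qed
    ultimately show ?thesis by simp
  qed
  define u where "u j = inverse (norm (Y j)) *\<^sub>R Y j" for j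
  have un: "u j \<in> sphere 0 1" for j using Yn0[of j] by (simp add: u_def)
  obtain z r where z: "z \<in> sphere (0::'n cmat) 1" "strict_mono (r :: nat \<Rightarrow> nat)" "(u \<circ> r) \<longlonglongrightarrow> z"
    using compact_sphere[of "0::'n cmat" 1] un unfolding compact_def by blast
  have "z \<in> lie"
  proof (rule lieI_sequence)
    show "mexp (Y (r i)) \<in> GM" for i by (rule YG)
    have Yr: "(\<lambda>i. Y (r i)) \<longlonglongrightarrow> 0" using LIMSEQ_subseq_LIMSEQ[OF Y0 z(2)] by (simp add: o_def)
    show "(\<lambda>i. inverse (norm (Y (r i))) *\<^sub>R (mexp (Y (r i)) - 1)) \<longlonglongrightarrow> z"
      by (rule mexp_quotient_tendsto[OF Yr Yn0]) (use z(3) in \<open>simp add: u_def o_def\<close>)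
    show "(\<lambda>i. norm (Y (r i))) \<longlonglongrightarrow> 0" using tendsto_norm[OF Yr] by simp
    show "norm (Y (r i)) > 0" for i using Yn0 by simp
  qed
  then have "P3 z = 0" by (rule P3(1))
  moreover have "P3 z = z"
  proof (rule LIMSEQ_unique)
    show "(\<lambda>i. P3 ((u \<circ> r) i)) \<longlonglongrightarrow> P3 z" by (rule bounded_linear.tendsto[OF bl(3) z(3)])
    have "P3 (u j) = u j" for j by (simp add: u_def linear_scale[OF lin(3)] Y_def P3(2))
    then show "(\<lambda>i. P3 ((u \<circ> r) i)) \<longlonglongrightarrow> z" using z(3) by (simp add: o_def)
  qed
  ultimately show False using z(1) by simp
qed

text \<open>
  The Lindelof property of Euclidean space.
\<close>

lemma group_countable_translates:
  assumes W: "open W" "1 \<in> W"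
  shows "\<exists>D. countable D \<and> D \<subseteq> GM \<and> (\<forall>g\<in>GM. \<exists>d\<in>D. \<exists>w\<in>GM \<inter> W. g = d * w)"
proof -
  have "\<forall>g\<in>GM. \<exists>h. h \<in> GM \<and> g * h = 1 \<and> h * g = 1" using inverse_GM by metis
  then obtain iv where iv: "\<And>g. g \<in> GM \<Longrightarrow> iv g \<in> GM \<and> g * iv g = 1 \<and> iv g * g = 1" by metis
  define N where "N g = (\<lambda>x. iv g * x) -` W" for g
  have op: "open (N g)" for g unfolding N_def
    by (rule open_vimage[OF W(1)]) (intro continuous_intros)
  obtain F where F: "F \<subseteq> N ` GM" "countable F" "\<Union>F = \<Union>(N ` GM)"
    using Lindelof[of "N ` GM"] op by (metis imageE)
  obtain D where D: "D \<subseteq> GM" "countable D" "F = N ` D"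
    using F(1,2) countable_subset_image[of F N GM] by (metis F(2) countable_subset_image)
  show ?thesis
  proof (intro exI conjI ballI)
    show "countable D" "D \<subseteq> GM" by (rule D)+
    fix g assume g: "g \<in> GM"
    have "g \<in> N g" using iv[OF g] W(2) by (simp add: N_def)
    then have "g \<in> \<Union>F" using F(3) g by blast
    then obtain d where d: "d \<in> D" "g \<in> N d" using D(3) by blast
    have dG: "d \<in> GM" using d(1) D(1) by blast
    have "g = d * (iv d * g)" using iv[OF dG] by (simp add: mult.assoc[symmetric])
    moreover have "iv d * g \<in> GM \<inter> W" using iv[OF dG] g d(2) by (auto simp: N_def mult_GM)
    ultimately show "\<exists>d\<in>D. \<exists>w\<in>GM \<inter> W. g = d * w" using d(1) by blast
  qed
qed

end

section \<open>The differential of a rational representation\<close>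

locale rational_rep = algebraic_matrix_group G for G :: "(complex^'n^'n) set" +
  fixes s :: "complex \<Rightarrow> 'v::ab_group_add \<Rightarrow> 'v" and B :: "'v set" and \<rho> :: "complex^'n^'n \<Rightarrow> 'v \<Rightarrow> 'v"
  assumes fd: "finite_dimensional_vector_space s B"
    and rep: "rational_representation s G \<rho>"

sublocale rational_rep \<subseteq> V: finite_dimensional_vector_space s B by (rule fd)

context rational_rep
begin

definition act :: "'n cmat \<Rightarrow> 'v \<Rightarrow> 'v" where "act X = \<rho> (raw X)"

definition coord :: "'v \<Rightarrow> 'v \<Rightarrow> complex" where "coord b v = V.representation B v b"

text \<open>
  The linear forms on \<open>V\<close> (see \<open>linear_lform\<close>), spelled out so that their two laws are at hand as rewrite rules.
\<close>

definition lform :: "('v \<Rightarrow> complex) \<Rightarrow> bool" where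
  "lform f \<longleftrightarrow> (\<forall>v w. f (v + w) = f v + f w) \<and> (\<forall>c v. f (s c v) = c * f v)"

lemma linear_lform: "Vector_Spaces.linear s (*) f \<longleftrightarrow> lform f"
  by (auto simp: lform_def Vector_Spaces.linear_iff V.vector_space_axioms vector_space_over_itself.vector_space_axioms)

lemma lform_add: "lform f \<Longrightarrow> f (v + w) = f v + f w" and lform_scale: "lform f \<Longrightarrow> f (s c v) = c * f v"
  by (auto simp: lform_def)

lemma lform_0: "lform f \<Longrightarrow> f 0 = 0"
  using lform_add[of f 0 0] by simp

lemma lform_sum: "lform f \<Longrightarrow> f (\<Sum>i\<in>I. g i) = (\<Sum>i\<in>I. f (g i))"
  by (induct I rule: infinite_finite_induct) (auto simp: lform_add lform_0)

lemma lform_coord: "lform (coord b)"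
  unfolding lform_def coord_def
  by (simp add: V.representation_add[OF V.independent_Basis] V.representation_scale[OF V.independent_Basis] V.span_Basis)

lemma coord_expand: "(\<Sum>b\<in>B. s (coord b v) b) = v"
  unfolding coord_def
  by (rule V.sum_representation_eq[OF V.independent_Basis _ V.finite_Basis order_refl]) (simp add: V.span_Basis)

lemma coord_eqI: "(\<And>b. b \<in> B \<Longrightarrow> coord b v = coord b w) \<Longrightarrow> v = w"
  using coord_expand[of v] coord_expand[of w] by (metis (no_types, lifting) sum.cong)

lemma coord_basis: "b' \<in> B \<Longrightarrow> coord b b' = (if b = b' then 1 else 0)"
  unfolding coord_def by (simp add: V.representation_basis[OF V.independent_Basis])

lemma coord_sum_basis: "b \<in> B \<Longrightarrow> coord b (\<Sum>b'\<in>B. s (x b') b') = x b"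
  by (simp add: lform_sum[OF lform_coord] lform_scale[OF lform_coord] coord_basis if_distrib[of "(*) _"] V.finite_Basis cong: if_cong)

lemma lform_expand: "lform f \<Longrightarrow> f v = (\<Sum>b\<in>B. coord b v * f b)"
  using lform_sum[of f "\<lambda>b. s (coord b v) b" B] by (simp add: coord_expand lform_scale)

lemma act_hom: "\<rho> \<in> hom (GL\<lparr>carrier := G\<rparr>) (GL_space s)"
  using rep by (simp add: rational_representation_def)

lemma act_linear: "X \<in> GM \<Longrightarrow> Vector_Spaces.linear s s (act X)" and act_bij: "X \<in> GM \<Longrightarrow> bij (act X)"
  using act_hom by (auto simp: hom_def GL_space_def GM_def act_def Pi_iff)

lemma act_mult: "X \<in> GM \<Longrightarrow> Y \<in> GM \<Longrightarrow> act (X * Y) v = act X (act Y v)"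
  using act_hom by (auto simp: hom_def GL_space_def GM_def act_def GL_def)

lemma act_1: "act 1 v = v"
proof -
  have "act 1 (act 1 v) = act 1 v" using act_mult[OF one_GM one_GM, of v] by simp
  then show ?thesis using act_bij[OF one_GM] by (simp add: bij_def inj_eq)
qed

lemma act_add: "X \<in> GM \<Longrightarrow> act X (v + w) = act X v + act X w"
  and act_scale: "X \<in> GM \<Longrightarrow> act X (s c v) = s c (act X v)"
  using act_linear by (auto simp: Vector_Spaces.linear_iff)

lemma lform_act: "lform f \<Longrightarrow> X \<in> GM \<Longrightarrow> lform (\<lambda>v. f (act X v))"
  by (simp add: lform_def act_add act_scale)

text \<open>
  A regular function on \<open>G\<close> is the restriction of a function \<open>p / det ^ k\<close>, which is complex differentiable
  at all invertible matrices.
\<close>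

lemma regular_extension:
  assumes "lform f"
  shows "\<exists>R. (\<forall>X. invertible (raw X) \<longrightarrow> cdiff R X) \<and> (\<forall>X\<in>GM. f (act X v) = R X)"
proof -
  have "regular_fun G (\<lambda>g. f (\<rho> g v))"
    using rep assms by (auto simp: rational_representation_def linear_lform)
  then obtain p k where p: "p \<in> poly_fun mscale" "\<And>g. g \<in> G \<Longrightarrow> f (\<rho> g v) = p g / det g ^ k"
    unfolding regular_fun_def by blast
  have "cdiff (\<lambda>X. p (raw X) * inverse (det (raw X)) ^ k) X" if "invertible (raw X)" for X
    by (rule cdiff_mult[OF cdiff_poly_fun[OF p(1)] cdiff_power[OF cdiff_inverse[OF cdiff_poly_fun[OF poly_fun_det]]]])
      (use that in \<open>simp add: invertible_det_nz\<close>)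
  moreover have "f (act X v) = p (raw X) * inverse (det (raw X)) ^ k" if "X \<in> GM" for X
    using p(2)[of "raw X"] that by (simp add: act_def GM_def divide_inverse power_inverse)
  ultimately show ?thesis by blast
qed

lemma invertible_one: "invertible (raw (1 :: 'n cmat))"
  using invertible_mexp[of "0 :: 'n cmat"] by simp

lemma ex_dcoord: "\<exists>D. (\<exists>R. (\<forall>X\<in>GM. coord b (act X v) = R X) \<and> (R has_derivative D) (at 1)) \<and> (\<forall>t H. D (sc t * H) = t * D H)"
proof -
  obtain R where R: "\<forall>X. invertible (raw X) \<longrightarrow> cdiff R X" "\<forall>X\<in>GM. coord b (act X v) = R X"
    using regular_extension[OF lform_coord] by metis
  obtain D where D: "(R has_derivative D) (at 1)" "\<And>t H. D (sc t * H) = t * D H"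
    using R(1) invertible_one unfolding cdiff_def by blast
  show ?thesis using R(2) D by blast
qed

text \<open>
  The derivative at the identity of some extension of the coefficient \<open>g \<mapsto> coord b (g v)\<close> to a
  neighbourhood in the space of all matrices. The extension is not unique, but on \<open>lie\<close> its derivative
  is the derivative along the curves \<open>mexp (t *\<^sub>R X)\<close> in \<open>G\<close> (\<open>coord_act_derivative\<close>).
  Having it on all matrices makes it linear by construction.
\<close>

definition dcoord :: "'v \<Rightarrow> 'v \<Rightarrow> 'n cmat \<Rightarrow> complex" where
  "dcoord v b = (SOME D. (\<exists>R. (\<forall>X\<in>GM. coord b (act X v) = R X) \<and> (R has_derivative D) (at 1)) \<and> (\<forall>t H. D (sc t * H) = t * D H))"

lemma dcoord_R: "\<exists>R. (\<forall>X\<in>GM. coord b (act X v) = R X) \<and> (R has_derivative dcoord v b) (at 1)"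
  and dcoord_sc: "dcoord v b (sc t * H) = t * dcoord v b H"
  using someI_ex[OF ex_dcoord[of b v]] unfolding dcoord_def[symmetric] by blast+

lemma dcoord_linear: "linear (dcoord v b)"
  using dcoord_R has_derivative_linear by blast

lemma dcoord_bl: "bounded_linear (dcoord v b)"
  using dcoord_linear by (simp add: linear_conv_bounded_linear)

definition dact :: "'n cmat \<Rightarrow> 'v \<Rightarrow> 'v" where "dact X v = (\<Sum>b\<in>B. s (dcoord v b X) b)"

lemma coord_dact: "b \<in> B \<Longrightarrow> coord b (dact X v) = dcoord v b X"
  unfolding dact_def by (rule coord_sum_basis)

lemma dact_add1: "dact (X + Y) v = dact X v + dact Y v"
  and dact_sc: "dact (sc t * X) v = s t (dact X v)"
  by (rule coord_eqI; simp add: coord_dact lform_add[OF lform_coord] lform_scale[OF lform_coord] linear_add[OF dcoord_linear] dcoord_sc)+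

lemma dact_scaleR: "dact (r *\<^sub>R X) v = s (of_real r) (dact X v)"
  by (simp only: sc_of_real[symmetric] dact_sc)

lemma coord_act_derivative:
  assumes X: "X \<in> lie"
  shows "((\<lambda>t::real. coord b (act (mexp (t *\<^sub>R X)) v)) has_vector_derivative dcoord v b X) (at 0)"
proof -
  obtain R where R: "\<forall>X\<in>GM. coord b (act X v) = R X" "(R has_derivative dcoord v b) (at 1)" using dcoord_R by blast
  have eq: "coord b (act (mexp (t *\<^sub>R X)) v) = R (mexp (t *\<^sub>R X))" for t
    by (rule bspec[OF R(1) lie_exp_real[OF X]])
  have "((\<lambda>t::real. mexp (t *\<^sub>R X)) has_derivative (\<lambda>t. t *\<^sub>R X)) (at 0)"
    using has_vector_derivative_mexp_0[of X] by (simp only: has_vector_derivative_def)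
  moreover have "(R has_derivative dcoord v b) (at (mexp (0 *\<^sub>R X)))" using R(2) by simp
  ultimately have "((\<lambda>t. R (mexp (t *\<^sub>R X))) has_derivative (\<lambda>t. dcoord v b (t *\<^sub>R X))) (at 0)"
    by (rule has_derivative_compose)
  then show ?thesis unfolding has_vector_derivative_def eq linear_scale[OF dcoord_linear] .
qed

lemma act_derivative:
  assumes X: "X \<in> lie" and f: "lform f"
  shows "((\<lambda>t::real. f (act (mexp (t *\<^sub>R X)) v)) has_vector_derivative f (dact X v)) (at 0)"
proof -
  have "((\<lambda>t::real. \<Sum>b\<in>B. coord b (act (mexp (t *\<^sub>R X)) v) * f b) has_vector_derivative (\<Sum>b\<in>B. dcoord v b X * f b)) (at 0)"
    by (rule has_vector_derivative_sum)
      (rule bounded_linear.has_vector_derivative[OF bounded_linear_mult_left coord_act_derivative[OF X]])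
  moreover have "(\<Sum>b\<in>B. dcoord v b X * f b) = f (dact X v)"
    unfolding lform_expand[OF f, of "dact X v"] by (rule sum.cong) (simp_all add: coord_dact)
  ultimately show ?thesis unfolding lform_expand[OF f, symmetric] by simp
qed

lemma dact_eqI:
  assumes X: "X \<in> lie" and "\<And>b. b \<in> B \<Longrightarrow> ((\<lambda>t::real. coord b (act (mexp (t *\<^sub>R X)) v)) has_vector_derivative coord b w) (at 0)"
  shows "dact X v = w"
proof (rule coord_eqI)
  fix b assume b: "b \<in> B"
  show "coord b (dact X v) = coord b w"
    unfolding coord_dact[OF b] by (rule vector_derivative_unique_at[OF coord_act_derivative[OF X] assms(2)[OF b]])
qed

lemma dact_add2: assumes X: "X \<in> lie" shows "dact X (v + w) = dact X v + dact X w"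
  by (rule dact_eqI[OF X])
    (simp only: act_add[OF lie_exp_real[OF X]] lform_add[OF lform_coord],
      rule has_vector_derivative_add[OF act_derivative[OF X lform_coord] act_derivative[OF X lform_coord]])

lemma dact_scale2: assumes X: "X \<in> lie" shows "dact X (s c v) = s c (dact X v)"
  by (rule dact_eqI[OF X])
    (simp only: act_scale[OF lie_exp_real[OF X]] lform_scale[OF lform_coord],
      rule bounded_linear.has_vector_derivative[OF bounded_linear_mult_right act_derivative[OF X lform_coord]])

lemma lform_dact: "X \<in> lie \<Longrightarrow> lform f \<Longrightarrow> lform (\<lambda>v. f (dact X v))"
  by (simp add: lform_def dact_add2 dact_scale2)

text \<open>
  Both sides are derivatives of the same curve, as \<open>mexp\<close> commutes with conjugation.
\<close>

lemma dact_equivariant: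
  assumes g: "g \<in> GM" "h * g = 1" and Y: "Y \<in> lie"
  shows "act g (dact Y (act h v)) = dact (g * Y * h) v"
proof (rule dact_eqI[OF lie_Ad[OF g Y], symmetric])
  fix b
  have h: "h \<in> GM" by (rule left_inverse_GM[OF g])
  have "act (mexp (t *\<^sub>R (g * Y * h))) v = act g (act (mexp (t *\<^sub>R Y)) (act h v))" for t
  proof -
    have "mexp (t *\<^sub>R (g * Y * h)) = g * mexp (t *\<^sub>R Y) * h"
      using mexp_conj[OF g(2), of "t *\<^sub>R Y"] by simp
    then show ?thesis by (simp only: act_mult mult_GM g(1) h lie_exp_real[OF Y])
  qed
  then show "((\<lambda>t. coord b (act (mexp (t *\<^sub>R (g * Y * h))) v)) has_vector_derivative
      coord b (act g (dact Y (act h v)))) (at 0)"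
    by (simp only: act_derivative[OF Y lform_act[OF lform_coord g(1)]])
qed

text \<open>
  Differentiate \<open>g (Y v) = (g Y h) (g v)\<close>, where \<open>g = mexp (t *\<^sub>R X)\<close> and \<open>h\<close> is its inverse, at \<open>t = 0\<close>.
  On the right-hand side both the operator and the vector move; in coordinates this is the product rule for a
  finite sum.
\<close>

lemma dact_bracket:
  assumes X: "X \<in> lie" and Y: "Y \<in> lie"
  shows "dact (X * Y - Y * X) v = dact X (dact Y v) - dact Y (dact X v)"
proof (rule coord_eqI)
  fix b assume b: "b \<in> B"
  define g where "g t = mexp (t *\<^sub>R X)" for t :: real
  define h where "h t = mexp (t *\<^sub>R (- X))" for t :: real
  have gG: "g t \<in> GM" and hg: "h t * g t = 1" for t
    using lie_exp_real[OF X] by (simp_all add: g_def h_def mexp_minus)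
  have eq: "coord b (act (g t) (dact Y v)) = (\<Sum>b'\<in>B. coord b' (act (g t) v) * dcoord b' b (g t * Y * h t))" for t
  proof -
    have hG: "h t \<in> GM" "g t * h t = 1" by (rule left_inverse_GM[OF gG hg])+
    have "act (g t) (dact Y (act (h t) (act (g t) v))) = dact (g t * Y * h t) (act (g t) v)"
      by (rule dact_equivariant[OF gG hg Y])
    moreover have "act (h t) (act (g t) v) = v"
      by (simp only: act_mult[OF hG(1) gG, symmetric] hg act_1)
    ultimately have "coord b (act (g t) (dact Y v)) = coord b (dact (g t * Y * h t) (act (g t) v))" by simp
    also have "\<dots> = (\<Sum>b'\<in>B. coord b' (act (g t) v) * coord b (dact (g t * Y * h t) b'))"
      by (rule lform_expand[OF lform_dact[OF lie_Ad[OF gG hg Y] lform_coord]])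
    finally show ?thesis by (simp only: coord_dact[OF b])
  qed
  have L: "((\<lambda>t. coord b (act (g t) (dact Y v))) has_vector_derivative coord b (dact X (dact Y v))) (at 0)"
    unfolding g_def by (rule act_derivative[OF X lform_coord])
  have R: "((\<lambda>t. \<Sum>b'\<in>B. coord b' (act (g t) v) * dcoord b' b (g t * Y * h t)) has_vector_derivative
    (\<Sum>b'\<in>B. coord b' (act (g 0) v) * dcoord b' b (X * Y - Y * X) + coord b' (dact X v) * dcoord b' b (g 0 * Y * h 0))) (at 0)"
  proof (rule has_vector_derivative_sum, rule has_vector_derivative_mult)
    fix b'
    show "((\<lambda>t. coord b' (act (g t) v)) has_vector_derivative coord b' (dact X v)) (at 0)"
      unfolding g_def by (rule act_derivative[OF X lform_coord])
    show "((\<lambda>t. dcoord b' b (g t * Y * h t)) has_vector_derivative dcoord b' b (X * Y - Y * X)) (at 0)"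
      unfolding g_def h_def by (rule bounded_linear.has_vector_derivative[OF dcoord_bl Ad_vector_derivative])
  qed
  have "coord b (dact X (dact Y v)) = (\<Sum>b'\<in>B. coord b' (act (g 0) v) * dcoord b' b (X * Y - Y * X) + coord b' (dact X v) * dcoord b' b (g 0 * Y * h 0))"
    by (rule vector_derivative_unique_at[OF L[unfolded eq] R])
  also have "\<dots> = (\<Sum>b'\<in>B. coord b' v * coord b (dact (X * Y - Y * X) b')) + (\<Sum>b'\<in>B. coord b' (dact X v) * coord b (dact Y b'))"
    by (simp add: g_def h_def act_1 sum.distrib coord_dact[OF b])
  also have "\<dots> = coord b (dact (X * Y - Y * X) v) + coord b (dact Y (dact X v))"
    by (simp only: lform_expand[OF lform_dact[OF lie_bracket[OF X Y] lform_coord], of b v]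
        lform_expand[OF lform_dact[OF Y lform_coord], of b "dact X v"])
  finally have "coord b (dact (X * Y - Y * X) v) + coord b (dact Y (dact X v)) = coord b (dact X (dact Y v))" by simp
  moreover have "coord b (dact X (dact Y v) - dact Y (dact X v)) + coord b (dact Y (dact X v)) = coord b (dact X (dact Y v))"
    by (simp only: lform_add[OF lform_coord, symmetric] diff_add_cancel)
  ultimately show "coord b (dact (X * Y - Y * X) v) = coord b (dact X (dact Y v) - dact Y (dact X v))"
    by (metis add_right_cancel)
qed

text \<open>
  The curve \<open>t \<mapsto> mexp (t *\<^sub>R Y) v\<close> has derivative \<open>mexp (t *\<^sub>R Y) (Y v) = 0\<close> everywhere.
\<close>

lemma stabilizer_exp:
  assumes Y: "Y \<in> lie" and z: "dact Y v = 0"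
  shows "act (mexp Y) v = v"
proof (rule coord_eqI)
  fix b
  define f where "f t = coord b (act (mexp (t *\<^sub>R Y)) v)" for t :: real
  have "(f has_vector_derivative 0) (at t)" for t
  proof -
    have split: "f (t + r) = coord b (act (mexp (t *\<^sub>R Y)) (act (mexp (r *\<^sub>R Y)) v))" for r
    proof -
      have "mexp ((t + r) *\<^sub>R Y) = mexp (t *\<^sub>R Y) * mexp (r *\<^sub>R Y)"
        unfolding scaleR_add_left by (rule mexp_add) simp
      then show ?thesis unfolding f_def by (simp only: act_mult[OF lie_exp_real[OF Y] lie_exp_real[OF Y]])
    qed
    have "((\<lambda>r. f (t + r)) has_vector_derivative coord b (act (mexp (t *\<^sub>R Y)) (dact Y v))) (at 0)"
      unfolding split by (rule act_derivative[OF Y lform_act[OF lform_coord lie_exp_real[OF Y]]])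
    moreover have "coord b (act (mexp (t *\<^sub>R Y)) (dact Y v)) = 0"
      unfolding z by (rule lform_0[OF lform_act[OF lform_coord lie_exp_real[OF Y]]])
    ultimately have "((\<lambda>r. f (t + r)) has_vector_derivative 0) (at 0)" by simp
    moreover have "((\<lambda>x. x - t) has_vector_derivative 1) (at t)"
      by (auto intro!: derivative_eq_intros)
    ultimately have "(((\<lambda>r. f (t + r)) \<circ> (\<lambda>x. x - t)) has_vector_derivative (1 *\<^sub>R 0)) (at t)"
      by (intro vector_diff_chain_at) simp_all
    then show ?thesis by (simp add: o_def)
  qed
  then have "(f has_derivative (\<lambda>h. 0)) (at t within UNIV)" for t
    unfolding has_vector_derivative_def by simp
  then obtain c where "\<And>x. f x = c"
    using has_derivative_zero_constant[OF convex_UNIV, of f] by auto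
  then have "f 1 = f 0" by simp
  then show "coord b (act (mexp Y) v) = coord b v" by (simp add: f_def act_1)
qed

end

context rational_rep
begin

section \<open>Tangent space of an open orbit\<close>

lemma linear_projection_onto_lie:
  "\<exists>p. linear p \<and> (\<forall>Z. p Z \<in> lie) \<and> (\<forall>Z\<in>lie. p Z = Z)"
proof -
  have "\<exists>g. range g \<subseteq> lie \<and> linear g \<and> (\<forall>v\<in>lie. g (id v) = v)"
    by (rule linear_exists_left_inverse_on[OF linear_id subspace_lie]) simp
  then obtain g where g: "range g \<subseteq> lie" "linear g" "\<forall>v\<in>lie. g (id v) = v" by blast
  show ?thesis by (rule exI[of _ g]) (use g in auto)
qed

lemma mscale_independent_card_le:
  fixes A :: "(complex^'n^'n) set"
  assumes "\<not> module.dependent mscale A"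
  shows "finite A \<and> card A \<le> CARD('n \<times> 'n)"
proof -
  interpret M: vector_space "mscale :: complex \<Rightarrow> complex^'n^'n \<Rightarrow> _" by (rule vector_space_mscale)
  define E where "E = (\<lambda>(i, j). axis i (axis j (1::complex))) ` (UNIV :: ('n \<times> 'n) set)"
  have "A \<in> M.span E" for A :: "complex^'n^'n"
  proof -
    have "(\<Sum>(i, j)\<in>UNIV. mscale (A $ i $ j) (axis i (axis j 1))) \<in> M.span E"
    proof (rule M.span_sum)
      fix x :: "'n \<times> 'n"
      obtain i j where x: "x = (i, j)" by (cases x)
      have "axis i (axis j 1) \<in> E" unfolding E_def by (rule image_eqI[of _ _ "(i, j)"]) simp_all
      then show "(case x of (i, j) \<Rightarrow> mscale (A $ i $ j) (axis i (axis j 1))) \<in> M.span E"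
        unfolding x prod.case by (intro M.span_scale M.span_base)
    qed
    moreover have "(\<Sum>(i, j)\<in>UNIV. mscale (A $ i $ j) (axis i (axis j 1))) = A"
    proof -
      have "(\<Sum>(a, b)\<in>UNIV. mscale (A $ a $ b) (axis a (axis b 1))) $ i $ j = A $ i $ j" for i j
      proof -
        have "(\<Sum>(a, b)\<in>UNIV. mscale (A $ a $ b) (axis a (axis b 1))) $ i $ j
            = (\<Sum>x\<in>UNIV. if x = (i, j) then A $ i $ j else 0)"
          unfolding sum_component
        proof (rule sum.cong[OF refl])
          fix x :: "'n \<times> 'n"
          obtain a b where x: "x = (a, b)" by (cases x)
          show "(case x of (a, b) \<Rightarrow> mscale (A $ a $ b) (axis a (axis b 1))) $ i $ j = (if x = (i, j) then A $ i $ j else 0)"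
            unfolding x prod.case by (cases "i = a"; cases "j = b") (simp_all add: mscale_def axis_def)
        qed
        then show ?thesis by simp
      qed
      then show ?thesis by (simp add: vec_eq_iff)
    qed
    ultimately show ?thesis by simp
  qed
  then have "A \<subseteq> M.span E" by blast
  moreover have fE: "finite E" by (simp add: E_def)
  ultimately have "finite A \<and> card A \<le> card E"
    using M.independent_span_bound assms by blast
  moreover have "card E \<le> CARD('n \<times> 'n)" unfolding E_def by (rule card_image_le) simp
  ultimately show ?thesis by linarith
qed

lemma continuous_poly_fun_affine:
  fixes a :: "'i::finite \<Rightarrow> 'v"
  assumes "f \<in> poly_fun s"
  shows "continuous_on UNIV (\<lambda>y::complex^'i. f (v1 + (\<Sum>i\<in>I. s (y $ i) (a i))))"
  using assms
proof induct
  case (linear_form f)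
  then have f: "lform f" by (simp add: linear_lform)
  show ?case
    unfolding lform_add[OF f] lform_sum[OF f] lform_scale[OF f] by (intro continuous_intros)
qed (auto intro: continuous_intros)

lemma subspace_orbit_tangent: "V.subspace ((\<lambda>X. dact X v) ` lie)"
  unfolding V.subspace_def
proof (intro conjI ballI allI)
  have "dact 0 v = 0"
    using dact_add1[of 0 0 v] by simp
  then show "0 \<in> (\<lambda>X. dact X v) ` lie" using lie_0 by force
  show "x + y \<in> (\<lambda>X. dact X v) ` lie" if "x \<in> (\<lambda>X. dact X v) ` lie" "y \<in> (\<lambda>X. dact X v) ` lie" for x y
    using that by (auto simp: dact_add1[symmetric] intro!: imageI lie_add)
  show "s c x \<in> (\<lambda>X. dact X v) ` lie" if "x \<in> (\<lambda>X. dact X v) ` lie" for c x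
    using that by (auto simp: dact_sc[symmetric] intro!: imageI lie_sc)
qed

text \<open>
  Suppose \<open>T = lie v0\<close> misses \<open>w\<close>. Let \<open>U\<close> be a basis of \<open>T\<close> and let \<open>XX u\<close> be elements of \<open>lie\<close> with
  \<open>XX u v0 = u\<close>. Near the identity, elements of \<open>G\<close> are products \<open>exp X exp Y\<close> with \<open>X\<close> in the span of
  the \<open>XX u\<close> and \<open>Y v0 = 0\<close>, so the orbit is covered by countably many images \<open>d (exp X v0)\<close> of a space of
  dimension \<open>card U\<close>. Project the orbit to the coordinates in \<open>C = insert w U\<close>, which are one more in number.

  A space in which null sets make sense is needed, with room for \<open>card U + 1\<close> complex coordinates. As the
  \<open>XX u\<close> are linearly independent, \<open>card U \<le> n\<^sup>2\<close>, and \<open>complex^('n \<times> 'n) option\<close> is large enough. The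
  map \<open>ix\<close> assigns an index to each element of \<open>C\<close>, with \<open>None\<close> for \<open>w\<close>; coordinates whose index is not
  in the range of \<open>ix\<close> are carried along unchanged. The map \<open>F d\<close> reads the parameters of \<open>X\<close> from the
  coordinates \<open>ix u\<close> and ignores the coordinate \<open>None\<close>, so the images of the hyperplane \<open>S\<close> suffice, and
  they are null sets. But their union contains the set \<open>Y\<close> of all points whose \<open>C\<close>-coordinates belong
  to a point of the orbit on a fixed affine subspace, and \<open>Y\<close> is open and nonempty as the orbit is Zariski-open.
\<close>

theorem open_orbit_tangent:
  assumes open_orbit: "openin (zariski s) ((\<lambda>g. \<rho> g v0) ` G)"
  shows "\<exists>X\<in>lie. dact X v0 = w"
proof (rule ccontr)
  assume neg: "\<not> ?thesis"
  define T where "T = (\<lambda>X. dact X v0) ` lie"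
  have Tsub: "V.subspace T" unfolding T_def by (rule subspace_orbit_tangent)
  have wT: "w \<notin> T" using neg by (auto simp: T_def)
  obtain U where U: "U \<subseteq> T" "V.independent U" "T \<subseteq> V.span U"
    by (rule V.maximal_independent_subset)
  have spanU: "V.span U \<subseteq> T" by (rule V.span_minimal[OF U(1) Tsub])
  define C where "C = insert w U"
  have wU: "w \<notin> V.span U" using wT spanU by blast
  have indC: "V.independent C" unfolding C_def using V.independent_insertI[OF wU U(2)] .
  have wnU: "w \<notin> U" using wU V.span_base by blast
  obtain BB where BB: "C \<subseteq> BB" "V.independent BB" "UNIV \<subseteq> V.span BB"
    by (rule V.maximal_independent_subset_extend[OF subset_UNIV indC])
  define l where "l b u = V.representation BB u b" for b u
  have l: "lform (l b)" for b
    unfolding lform_def l_def using BB(3)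
    by (simp add: V.representation_add[OF BB(2)] V.representation_scale[OF BB(2)] subset_iff)
  have lb: "l b c = (if b = c then 1 else 0)" if "c \<in> BB" for b c
    unfolding l_def V.representation_basis[OF BB(2) that] by simp
  have finC: "finite C" by (rule V.finiteI_independent[OF indC])
  then have finU: "finite U" by (simp add: C_def)
  have UB: "U \<subseteq> BB" using BB(1) by (auto simp: C_def)
  have lU: "(\<Sum>u\<in>U. s (l u x) u) = x" if x: "x \<in> T" for x
  proof -
    have xU: "x \<in> V.span U" using U(3) x by blast
    have "V.representation BB x = V.representation U x" by (rule V.representation_extend[OF BB(2) xU UB])
    then show ?thesis
      unfolding l_def using V.sum_representation_eq[OF U(2) xU finU order_refl] by simp
  qed
  have "\<forall>u\<in>U. \<exists>X. X \<in> lie \<and> dact X v0 = u" using U(1) by (auto simp: T_def)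
  then obtain XX where XX: "\<And>u. u \<in> U \<Longrightarrow> XX u \<in> lie" "\<And>u. u \<in> U \<Longrightarrow> dact (XX u) v0 = u" by metis
  have dact_lin: "dact (\<Sum>u\<in>U. sc (c u) * XX u) v0 = (\<Sum>u\<in>U. s (c u) u)" for c
  proof -
    have "dact (\<Sum>u\<in>I. Z u) v0 = (\<Sum>u\<in>I. dact (Z u) v0)" for I and Z :: "'v \<Rightarrow> _"
    proof (induct I rule: infinite_finite_induct)
      have "dact 0 v0 = 0" using dact_add1[of 0 0 v0] by simp
      then show "dact (\<Sum>u\<in>{}. Z u) v0 = (\<Sum>u\<in>{}. dact (Z u) v0)"
        "\<And>I. infinite I \<Longrightarrow> dact (\<Sum>u\<in>I. Z u) v0 = (\<Sum>u\<in>I. dact (Z u) v0)" by simp_all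
    qed (simp add: dact_add1)
    then have "dact (\<Sum>u\<in>U. sc (c u) * XX u) v0 = (\<Sum>u\<in>U. dact (sc (c u) * XX u) v0)" .
    also have "\<dots> = (\<Sum>u\<in>U. s (c u) u)" by (rule sum.cong) (simp_all add: dact_sc XX(2))
    finally show ?thesis .
  qed
  have cardU: "card U \<le> CARD('n \<times> 'n)"
  proof -
    interpret M: vector_space "mscale :: complex \<Rightarrow> complex^'n^'n \<Rightarrow> _" by (rule vector_space_mscale)
    have inj: "inj_on (\<lambda>u. raw (XX u)) U"
    proof (rule inj_onI)
      fix u u' assume u: "u \<in> U" "u' \<in> U" "raw (XX u) = raw (XX u')"
      then have "XX u = XX u'" by (simp only: cmat_eq_iff)
      then have "dact (XX u) v0 = dact (XX u') v0" by (rule arg_cong[where f = "\<lambda>X. dact X v0"])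
      then show "u = u'" unfolding XX(2)[OF u(1)] XX(2)[OF u(2)] .
    qed
    have "M.independent ((\<lambda>u. raw (XX u)) ` U)"
    proof
      assume "M.dependent ((\<lambda>u. raw (XX u)) ` U)"
      then obtain a where a: "\<exists>A\<in>(\<lambda>u. raw (XX u)) ` U. a A \<noteq> 0" "(\<Sum>A\<in>(\<lambda>u. raw (XX u)) ` U. mscale (a A) A) = 0"
        unfolding M.dependent_finite[OF finite_imageI[OF finU]] by (elim exE conjE)
      define c where "c u = a (raw (XX u))" for u
      have rs: "raw (\<Sum>u\<in>I. Z u) = (\<Sum>u\<in>I. raw (Z u))" for I and Z :: "'v \<Rightarrow> 'n cmat"
        by (induct I rule: infinite_finite_induct) simp_all
      have "raw (\<Sum>u\<in>U. sc (c u) * XX u) = 0"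
        using a(2) by (simp add: sum.reindex[OF inj] rs c_def del: raw_simps(6))
      then have "(\<Sum>u\<in>U. sc (c u) * XX u) = 0" by (simp add: cmat_eq_iff)
      then have "(\<Sum>u\<in>U. s (c u) u) = 0"
        using dact_lin[of c] dact_add1[of 0 0 v0] by simp
      moreover obtain u where u: "u \<in> U" "c u \<noteq> 0" using a(1) by (auto simp: c_def)
      ultimately have "V.dependent U"
        unfolding V.dependent_finite[OF finU] by (intro exI[of _ c] conjI bexI[of _ u])
      then show False using U(2) by blast
    qed
    from mscale_independent_card_le[OF this] show ?thesis by (simp add: card_image[OF inj])
  qed
  obtain \<iota> :: "'v \<Rightarrow> 'n \<times> 'n" where \<iota>: "inj_on \<iota> U"
    using card_le_inj[OF finU finite[of UNIV] cardU] by blast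
  define ix where "ix c = (if c = w then None else Some (\<iota> c))" for c
  have ix: "inj_on ix C"
    using \<iota> wnU by (auto simp: inj_on_def ix_def C_def)
  have ixU: "ix u = Some (\<iota> u)" if "u \<in> U" for u using that wnU by (auto simp: ix_def)
  have ixw: "ix w = None" by (simp add: ix_def)
  define lab where "lab = inv_into C ix"
  have lab: "lab (ix c) = c" if "c \<in> C" for c unfolding lab_def by (rule inv_into_f_f[OF ix that])
  define A where "A x = (\<Sum>u\<in>U. sc (x $ ix u) * XX u)" for x :: "complex^('n \<times> 'n) option"
  have Alie: "A x \<in> lie" for x
    unfolding A_def by (rule subspace_sum[OF subspace_lie]) (simp add: lie_sc XX(1))
  obtain p where p0: "linear p" "\<forall>Z. p Z \<in> lie" "\<forall>Z\<in>lie. p Z = Z"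
    using linear_projection_onto_lie by blast
  note p = p0(1) p0(2)[rule_format] p0(3)[rule_format]
  \<comment> \<open>The chart uses the decomposition of the matrices into the span of the \<open>XX u\<close>, the stabiliser of \<open>v0\<close> in \<open>lie\<close>, and the kernel of the projection \<open>p\<close>.\<close>
  define P1 where "P1 Z = (\<Sum>u\<in>U. sc (l u (dact (p Z) v0)) * XX u)" for Z
  have P1_lie: "P1 Z \<in> lie" for Z
    unfolding P1_def by (rule subspace_sum[OF subspace_lie]) (simp add: lie_sc XX(1))
  have P1_lin: "linear P1"
  proof (rule linearI)
    show "P1 (x + y) = P1 x + P1 y" for x y
      unfolding P1_def sum.distrib[symmetric]
      by (rule sum.cong) (simp_all add: linear_add[OF p(1)] dact_add1 lform_add[OF l] sc_add distrib_right)
    show "P1 (r *\<^sub>R x) = r *\<^sub>R P1 x" for r x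
      unfolding P1_def scaleR_sum_right
      by (rule sum.cong) (simp_all add: linear_scale[OF p(1)] dact_scaleR lform_scale[OF l] sc_mult mult.assoc sc_of_real)
  qed
  have dP1: "dact (P1 Z) v0 = dact (p Z) v0" for Z
    unfolding P1_def dact_lin by (rule lU) (auto simp: T_def p(2))
  define P2 where "P2 Z = p Z - P1 Z" for Z
  have P2_lie: "P2 Z \<in> lie" for Z unfolding P2_def by (rule subspace_diff[OF subspace_lie p(2) P1_lie])
  have P2_lin: "linear P2" unfolding P2_def[abs_def] by (rule linear_compose_sub[OF p(1) P1_lin])
  have dP2: "dact (P2 Z) v0 = 0"
    for Z using dact_add1[of "P2 Z" "P1 Z" v0] by (simp add: P2_def dP1)
  define P3 where "P3 Z = Z - p Z" for Z
  have P3_lin: "linear P3" unfolding P3_def[abs_def] by (rule linear_compose_sub[OF linear_ident p(1)])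
  have "\<exists>W. open W \<and> 1 \<in> W \<and> (\<forall>g\<in>GM \<inter> W. \<exists>Z. g = mexp (P1 Z) * mexp (P2 Z))"
  proof (rule group_chart[OF P1_lin P2_lin P3_lin _ P1_lie P2_lie])
    show "P1 Z + P2 Z + P3 Z = Z" for Z by (simp add: P2_def P3_def)
    show "P3 Z = 0" if "Z \<in> lie" for Z using p(3)[OF that] by (simp add: P3_def)
    show "P3 (P3 Z) = P3 Z" for Z by (simp add: P3_def linear_diff[OF p(1)] p(3)[OF p(2)])
  qed
  then obtain W where W: "open W" "1 \<in> W" "\<forall>g\<in>GM \<inter> W. \<exists>Z. g = mexp (P1 Z) * mexp (P2 Z)" by blast
  obtain D where D0: "countable D" "D \<subseteq> GM" "\<forall>g\<in>GM. \<exists>d\<in>D. \<exists>w\<in>GM \<inter> W. g = d * w"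
    using group_countable_translates[OF W(1,2)] by blast
  note D = D0(1,2) D0(3)[rule_format]
  have cover: "\<exists>d\<in>D. \<exists>c. act g v0 = act (d * mexp (\<Sum>u\<in>U. sc (c u) * XX u)) v0" if g: "g \<in> GM" for g
  proof -
    obtain d k where d: "d \<in> D" "k \<in> GM \<inter> W" "g = d * k" using D(3)[OF g] by blast
    obtain Z where Z: "k = mexp (P1 Z) * mexp (P2 Z)" using W(3) d(2) by blast
    have dG: "d \<in> GM" using d(1) D(2) by blast
    have m: "d * mexp (P1 Z) \<in> GM" by (rule mult_GM[OF dG mexp_lie_in_GM[OF P1_lie]])
    have "act g v0 = act (d * mexp (P1 Z) * mexp (P2 Z)) v0" by (simp only: d(3) Z mult.assoc)
    also have "\<dots> = act (d * mexp (P1 Z)) v0"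
      by (simp only: act_mult[OF m mexp_lie_in_GM[OF P2_lie]] stabilizer_exp[OF P2_lie dP2])
    finally have "act g v0 = act (d * mexp (P1 Z)) v0" .
    then show ?thesis
      unfolding P1_def by (intro bexI[OF _ d(1)] exI[of _ "\<lambda>u. l u (dact (p Z) v0)"])
  qed
  define F where "F d x = (\<chi> i. if i \<in> ix ` C then l (lab i) (act (d * mexp (A x)) v0) else x $ i)"
    for d :: "'n cmat" and x :: "complex^('n \<times> 'n) option"
  define S where "S = {x :: complex^('n \<times> 'n) option. x $ None = 0}"
  have negS: "negligible S"
  proof (rule negligible_subset[OF negligible_standard_hyperplane[of "axis None (1::complex)" 0]])
    show "axis None (1::complex) \<in> (Basis :: (complex^('n \<times> 'n) option) set)"
      by (simp add: axis_in_Basis_iff Basis_complex_def)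
    show "S \<subseteq> {x. x \<bullet> axis None 1 = 0}" by (auto simp: S_def inner_axis)
  qed
  have diffF: "F d differentiable_on S" if d: "d \<in> GM" for d
    unfolding differentiable_on_def
  proof
    fix x assume "x \<in> S"
    have comp: "(\<lambda>x. F d x $ i) differentiable (at x within S)" for i
    proof (cases "i \<in> ix ` C")
      case False
      have "(\<lambda>x :: complex^('n \<times> 'n) option. x $ i) differentiable (at x within S)"
        by (rule bounded_linear_imp_differentiable[OF bounded_linear_vec_nth])
      then show ?thesis using False by (simp add: F_def)
    next
      case True
      obtain R where R: "\<forall>X. invertible (raw X) \<longrightarrow> cdiff R X" "\<forall>X\<in>GM. l (lab i) (act X v0) = R X"
        using regular_extension[OF l] by metis
      have mG: "d * mexp (A y) \<in> GM" for y by (rule mult_GM[OF d mexp_lie_in_GM[OF Alie]])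
      have eq: "F d y $ i = R (d * mexp (A y))" for y
        using True bspec[OF R(2) mG] by (simp add: F_def)
      have "invertible (raw (d * mexp (A x)))"
        using mG[of x] unfolding GM_def mem_Collect_eq by (rule mem_G_iff[THEN iffD1, THEN conjunct1])
      then have "cdiff R (d * mexp (A x))" by (rule R(1)[rule_format])
      then obtain R' where R': "(R has_derivative R') (at (d * mexp (A x)))"
        unfolding cdiff_def by (elim exE conjE)
      have Alin: "linear A"
      proof (rule linearI)
        show "A (x + y) = A x + A y" for x y
          unfolding A_def by (simp add: sc_add distrib_right sum.distrib)
        show "A (r *\<^sub>R x) = r *\<^sub>R A x" for r x
          unfolding A_def scaleR_sum_right
          by (rule sum.cong) (simp_all add: scaleR_conv_of_real[of r "x $ _"] sc_mult mult.assoc sc_of_real)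
      qed
      then have "bounded_linear A" by (simp add: linear_conv_bounded_linear)
      then have "(A has_derivative A) (at x within S)" by (rule bounded_linear_imp_has_derivative)
      from bounded_linear.has_derivative[OF bounded_linear_mult_right has_derivative_compose[OF this has_derivative_mexp]]
      have "((\<lambda>y. d * mexp (A y)) has_derivative (\<lambda>y. d * dexp (A x) (A y))) (at x within S)" .
      from has_derivative_compose[OF this R'] have "(\<lambda>y. R (d * mexp (A y))) differentiable (at x within S)"
        by (rule differentiableI)
      then show ?thesis by (simp only: eq)
    qed
    show "F d differentiable (at x within S)"
    proof (subst differentiable_componentwise_within, rule ballI)
      fix e :: "complex^('n \<times> 'n) option" assume "e \<in> Basis"
      then obtain i u where e: "e = axis i u" by (auto simp: Basis_vec_def)
      have "(\<lambda>x. F d x $ i \<bullet> u) differentiable (at x within S)"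
        by (rule differentiable_inner[OF comp]) simp
      then show "(\<lambda>x. F d x \<bullet> e) differentiable (at x within S)" by (simp add: e inner_axis)
    qed
  qed
  have negF: "negligible (F d ` S)" if "d \<in> GM" for d
    by (rule negligible_differentiable_image_negligible[OF order_refl negS diffF[OF that]])
  have negU: "negligible (\<Union>d\<in>D. F d ` S)"
  proof (rule negligible_countable_Union)
    show "countable ((\<lambda>d. F d ` S) ` D)" by (rule countable_image[OF D(1)])
    show "negligible X" if "X \<in> (\<lambda>d. F d ` S) ` D" for X using that D(2) negF by blast
  qed
  \<comment> \<open>The affine subspace through \<open>v0\<close> in the directions of \<open>C\<close>, parametrised by the coordinates.\<close>
  define v1 where "v1 = v0 - (\<Sum>c\<in>C. s (l c v0) c)"
  define wv where "wv y = v1 + (\<Sum>i\<in>ix ` C. s (y $ i) (lab i))" for y :: "complex^('n \<times> 'n) option"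
  have wv: "wv y = v1 + (\<Sum>c\<in>C. s (y $ ix c) c)" for y
    unfolding wv_def sum.reindex[OF ix] by (simp add: lab)
  have lsum: "l c (\<Sum>c\<in>C. s (a c) c) = a c" if "c \<in> C" for c a
  proof -
    have "l c (\<Sum>c'\<in>C. s (a c') c') = (\<Sum>c'\<in>C. if c' = c then a c else 0)"
      unfolding lform_sum[OF l] lform_scale[OF l] by (rule sum.cong) (use BB(1) lb in auto)
    then show ?thesis using finC that by simp
  qed
  have lwv: "l c (wv y) = y $ ix c" if c: "c \<in> C" for c y
  proof -
    have "l c v1 + l c (\<Sum>c\<in>C. s (l c v0) c) = l c v0"
      unfolding v1_def lform_add[OF l, symmetric] by simp
    then have "l c v1 = 0" by (simp add: lsum[OF c])
    then show ?thesis unfolding wv lform_add[OF l] by (simp add: lsum[OF c])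
  qed
  define Orb where "Orb = (\<lambda>g. \<rho> g v0) ` G"
  obtain E where E: "E \<subseteq> poly_fun s" "- Orb = {x. \<forall>f\<in>E. f x = 0}"
    using open_orbit unfolding openin_zariski Orb_def by blast
  define Y where "Y = {y. wv y \<in> Orb}"
  have Yopen: "open Y"
  proof -
    have "x \<in> Orb \<longleftrightarrow> (\<exists>f\<in>E. f x \<noteq> 0)" for x
      using E(2) by blast
    then have "Y = (\<Union>f\<in>E. {y. f (wv y) \<noteq> 0})"
      unfolding Y_def by blast
    moreover have "open {y. f (wv y) \<noteq> 0}" if "f \<in> E" for f
    proof -
      have "continuous_on UNIV (\<lambda>y. f (wv y))"
        unfolding wv_def by (rule continuous_poly_fun_affine) (use E(1) that in blast)
      then show ?thesis by (intro open_Collect_neq continuous_on_const)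
    qed
    ultimately show ?thesis by auto
  qed
  have OG: "Orb = (\<lambda>g. act g v0) ` GM"
  proof -
    have "Orb = (\<lambda>g. \<rho> g v0) ` (raw ` GM)" by (simp only: Orb_def raw_GM)
    then show ?thesis by (simp only: image_image act_def)
  qed
  have Yne: "Y \<noteq> {}"
  proof -
    define y :: "complex^('n \<times> 'n) option" where "y = (\<chi> i. if i \<in> ix ` C then l (lab i) v0 else 0)"
    have "wv y = v1 + (\<Sum>c\<in>C. s (l c v0) c)"
      unfolding wv by (simp add: y_def lab)
    then have "wv y = act 1 v0" by (simp add: v1_def act_1)
    then have "y \<in> Y" using one_GM by (auto simp: Y_def OG)
    then show ?thesis by blast
  qed
  have "Y \<subseteq> (\<Union>d\<in>D. F d ` S)"
  proof
    fix y assume "y \<in> Y"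
    then obtain g where g: "g \<in> GM" "wv y = act g v0" by (auto simp: Y_def OG)
    obtain d c where d: "d \<in> D" "act g v0 = act (d * mexp (\<Sum>u\<in>U. sc (c u) * XX u)) v0" using cover[OF g(1)] by blast
    define x :: "complex^('n \<times> 'n) option" where "x = (\<chi> i. if i = None then 0 else if i \<in> ix ` C then c (lab i) else y $ i)"
    have xU: "x $ ix u = c u" if u: "u \<in> U" for u
    proof -
      have uC: "u \<in> C" using u by (simp add: C_def)
      have "ix u \<noteq> None" using ixU[OF u] by simp
      then show ?thesis using uC lab[OF uC] by (auto simp: x_def)
    qed
    have "A x = (\<Sum>u\<in>U. sc (c u) * XX u)" unfolding A_def by (rule sum.cong) (simp_all add: xU)
    then have e: "act (d * mexp (A x)) v0 = wv y" using d(2) g(2) by simp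
    have "F d x $ i = y $ i" for i
    proof (cases "i \<in> ix ` C")
      case True
      then obtain k where k: "k \<in> C" "i = ix k" by blast
      then show ?thesis using True by (simp add: F_def e lab lwv)
    next
      case False
      then have "i \<noteq> None" using ixw by (auto simp: C_def)
      then show ?thesis using False by (auto simp: F_def x_def)
    qed
    then have "y = F d x" by (simp add: vec_eq_iff)
    moreover have "x \<in> S" by (simp add: S_def x_def)
    ultimately show "y \<in> (\<Union>d\<in>D. F d ` S)" using d(1) by blast
  qed
  with negU have "negligible Y" by (rule negligible_subset)
  then show False using open_not_negligible[OF Yopen Yne] by blast
qed

section \<open>The trace argument\<close>

definition trV :: "('v \<Rightarrow> 'v) \<Rightarrow> complex" where "trV f = (\<Sum>b\<in>B. coord b (f b))"

lemma trV_commute: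
  assumes f: "\<And>b. lform (\<lambda>v. coord b (f v))" and g: "\<And>b. lform (\<lambda>v. coord b (g v))"
  shows "trV (\<lambda>v. f (g v)) = trV (\<lambda>v. g (f v))"
proof -
  have "trV (\<lambda>v. f (g v)) = (\<Sum>b\<in>B. \<Sum>b'\<in>B. coord b' (g b) * coord b (f b'))"
    unfolding trV_def by (rule sum.cong[OF refl]) (rule lform_expand[OF f])
  also have "\<dots> = (\<Sum>b'\<in>B. \<Sum>b\<in>B. coord b' (g b) * coord b (f b'))" by (rule sum.swap)
  also have "\<dots> = (\<Sum>b'\<in>B. \<Sum>b\<in>B. coord b (f b') * coord b' (g b))" by (simp only: mult.commute)
  also have "\<dots> = trV (\<lambda>v. g (f v))"
    unfolding trV_def by (rule sum.cong[OF refl]) (rule lform_expand[OF g, symmetric])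
  finally show ?thesis .
qed

lemma trV_diff: "trV (\<lambda>v. f v - g v) = trV f - trV g"
proof -
  have "coord b (f v - g v) = coord b (f v) - coord b (g v)" for b v
    using lform_add[OF lform_coord, of b "f v - g v" "g v"] by simp
  then show ?thesis by (simp add: trV_def sum_subtractf)
qed

text \<open>
  Carry the adjoint representation over to \<open>V\<close> by the inverse \<open>J\<close> of \<open>X \<mapsto> X v0\<close>: this is \<open>ad\<close>. The linear
  form \<open>\<tau>\<close>, the difference of the traces of the two representations, vanishes on brackets and hence on
  \<open>lie\<close>; its value at \<open>J v0\<close> is the dimension of \<open>V\<close>.
\<close>

theorem no_etale:
  assumes rad: "radical G = {mat 1}"
    and open_orbit: "openin (zariski s) ((\<lambda>g. \<rho> g v0) ` G)"
    and dim: "group_dim G = enat (card B)"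
  shows "B = {}"
proof -
  obtain b where b: "bij_betw b {..<card B} B" using V.finite_Basis ex_bij_betw_nat_finite[of B]
    by (auto simp: atLeast0LessThan)
  have bB: "b i \<in> B" if "i < card B" for i using b that by (auto simp: bij_betw_def)
  have bi: "b i = b j \<longleftrightarrow> i = j" if "i < card B" "j < card B" for i j
    using b that by (auto simp: bij_betw_def inj_on_def)
  have "\<forall>u. \<exists>X. X \<in> lie \<and> dact X v0 = u" using open_orbit_tangent[OF open_orbit] by blast
  then obtain pre where pre: "\<And>u. pre u \<in> lie" "\<And>u. dact (pre u) v0 = u" by metis
  have inj0: "Y = 0" if Y: "Y \<in> lie" "dact Y v0 = 0" for Y
  proof (rule ccontr)
    assume "Y \<noteq> 0"
    then obtain k m where km: "raw Y $ k $ m \<noteq> 0" by (auto simp: cmat_eq_iff vec_eq_iff)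
    let ?d = "card B"
    \<comment> \<open>A nonzero \<open>Y\<close> in the kernel extends the preimages of the basis vectors to \<open>card B + 1\<close> elements; the dual forms are the coordinates of \<open>A v0\<close> and a matrix entry that does not vanish at \<open>Y\<close>, corrected to vanish on the preimages.\<close>
    define l' where "l' A = A $ k $ m / raw Y $ k $ m" for A :: "complex^'n^'n"
    define lo where "lo i A = dcoord v0 (b i) (cmat A)" for i A
    define l where "l i A = (if i < ?d then lo i A else l' A - (\<Sum>j<?d. lo j A * l' (raw (pre (b j)))))" for i A
    define X where "X i = (if i < ?d then pre (b i) else Y)" for i
    have lo_add: "lo i (A + A') = lo i A + lo i A'" and lo_sc: "lo i (mscale c A) = c * lo i A" for i A A' c
    proof -
      have "cmat (A + A') = cmat A + cmat A'" "cmat (mscale c A) = sc c * cmat A"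
        by (simp_all add: cmat_eq_iff del: raw_simps(6))
      then show "lo i (A + A') = lo i A + lo i A'" "lo i (mscale c A) = c * lo i A"
        by (simp_all add: lo_def linear_add[OF dcoord_linear] dcoord_sc)
    qed
    have lo_pre: "lo i (raw (pre (b j))) = (if i = j then 1 else 0)" if ij: "i < ?d" "j < ?d" for i j
    proof -
      have "lo i (raw (pre (b j))) = coord (b i) (dact (pre (b j)) v0)" by (simp add: lo_def coord_dact[OF bB[OF ij(1)]])
      then show ?thesis by (simp add: pre(2) coord_basis[OF bB[OF ij(2)]] bi[OF ij])
    qed
    have lo_Y: "lo i (raw Y) = 0" if "i < ?d" for i
    proof -
      have "lo i (raw Y) = coord (b i) (dact Y v0)" by (simp add: lo_def coord_dact[OF bB[OF that]])
      then show ?thesis by (simp add: Y(2) lform_0[OF lform_coord])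
    qed
    have "enat (Suc ?d) \<le> group_dim G"
    proof (rule lie_dim_le_group_dim[where X = X and l = l])
      show "X j \<in> lie" for j using pre(1) Y(1) by (simp add: X_def)
      show "Vector_Spaces.linear mscale (*) (l j)" for j
      proof -
        have "l' (A + A') = l' A + l' A'" "l' (mscale c A) = c * l' A" for A A' c
          by (simp_all add: l'_def mscale_def add_divide_distrib)
        then show ?thesis
          unfolding linear_form_iff l_def
          by (auto simp: lo_add lo_sc distrib_right sum.distrib right_diff_distrib sum_distrib_left mult.assoc)
      qed
      show "l i (raw (X j)) = (if i = j then 1 else 0)" if ij: "i < Suc ?d" "j < Suc ?d" for i j
      proof (cases "i < ?d")
        case True
        then show ?thesis using lo_pre[OF True] lo_Y[OF True] by (auto simp: l_def X_def)
      next
        case False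
        then have i: "i = ?d" using ij by simp
        show ?thesis
        proof (cases "j < ?d")
          case True
          have "(\<Sum>j'<?d. lo j' (raw (pre (b j))) * l' (raw (pre (b j'))))
              = (\<Sum>j'<?d. if j' = j then l' (raw (pre (b j))) else 0)"
            by (rule sum.cong) (use lo_pre True in auto)
          also have "\<dots> = l' (raw (pre (b j)))" using True by simp
          finally show ?thesis using True i by (simp add: l_def X_def)
        next
          case jF: False
          then have "j = ?d" using ij by simp
          then show ?thesis using i km by (simp add: l_def X_def lo_Y l'_def)
        qed
      qed
    qed
    then show False unfolding dim by simp
  qed
  have dact0: "dact 0 v = 0" for v using dact_add1[of 0 0 v] by simp
  have dact_diff: "dact (X - Y) v = dact X v - dact Y v" for X Y v
    using dact_add1[of "X - Y" Y v] by simp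
  define J where "J u = (SOME X. X \<in> lie \<and> dact X v0 = u)" for u
  have J: "J u \<in> lie" "dact (J u) v0 = u" for u
  proof -
    have "\<exists>X. X \<in> lie \<and> dact X v0 = u" using pre by blast
    from someI_ex[OF this] show "J u \<in> lie" "dact (J u) v0 = u" by (simp_all add: J_def)
  qed
  have J_eq: "J u = X" if X: "X \<in> lie" "dact X v0 = u" for X u
  proof -
    have "J u - X = 0"
      by (rule inj0[OF subspace_diff[OF subspace_lie J(1) X(1)]]) (simp add: dact_diff J(2) X(2))
    then show ?thesis by simp
  qed
  have J_add: "J (u + v) = J u + J v" for u v
    by (rule J_eq) (simp_all add: lie_add J dact_add1)
  have J_sc: "J (s c u) = sc c * J u" for c u
    by (rule J_eq) (simp_all add: lie_sc J dact_sc)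
  define ad where "ad X u = dact (X * J u - J u * X) v0" for X u
  have ad_lform: "lform (\<lambda>v. coord b (ad X v))" if "X \<in> lie" for X b
  proof -
    have "ad X (u + v) = ad X u + ad X v" for u v
      unfolding ad_def dact_add1[symmetric] J_add by (simp add: algebra_simps)
    moreover have "ad X (s c u) = s c (ad X u)" for c u
    proof -
      have "X * (sc c * J u) - sc c * J u * X = sc c * (X * J u - J u * X)"
        by (simp add: right_diff_distrib sc_left_commute[of X] mult.assoc)
      then show ?thesis by (simp only: ad_def J_sc dact_sc)
    qed
    ultimately show ?thesis by (simp add: lform_def lform_add[OF lform_coord] lform_scale[OF lform_coord])
  qed
  have J_ad: "J (ad X u) = X * J u - J u * X" if "X \<in> lie" for X u
    by (rule J_eq) (simp_all add: ad_def lie_bracket[OF that J(1)])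
  have ad_bracket: "ad (X * Y - Y * X) u = ad X (ad Y u) - ad Y (ad X u)" if XY: "X \<in> lie" "Y \<in> lie" for X Y u
    unfolding ad_def[of "X * Y - Y * X"] ad_def[of X "ad Y u"] ad_def[of Y "ad X u"] J_ad[OF XY(1)] J_ad[OF XY(2)]
      dact_diff[symmetric]
    by (simp add: algebra_simps)
  define \<tau> where "\<tau> X = trV (dact X) - trV (ad X)" for X
  have \<tau>_lin: "\<tau> (X + Y) = \<tau> X + \<tau> Y" "\<tau> (r *\<^sub>R X) = of_real r * \<tau> X" for X Y r
  proof -
    have a: "ad (X + Y) v = ad X v + ad Y v" for v
      unfolding ad_def dact_add1[symmetric] by (simp add: algebra_simps)
    have r: "ad (r *\<^sub>R X) v = s (of_real r) (ad X v)" for v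
      unfolding ad_def dact_scaleR[symmetric] by (simp add: scaleR_diff_right)
    show "\<tau> (X + Y) = \<tau> X + \<tau> Y"
      unfolding \<tau>_def trV_def a dact_add1 lform_add[OF lform_coord] sum.distrib by simp
    show "\<tau> (r *\<^sub>R X) = of_real r * \<tau> X"
      unfolding \<tau>_def trV_def r dact_scaleR lform_scale[OF lform_coord] right_diff_distrib sum_distrib_left by simp
  qed
  have \<tau>_bracket: "\<tau> (X * Y - Y * X) = 0" if XY: "X \<in> lie" "Y \<in> lie" for X Y
  proof -
    have "trV (dact (X * Y - Y * X)) = trV (\<lambda>v. dact X (dact Y v) - dact Y (dact X v))"
      by (simp only: trV_def dact_bracket[OF XY])
    also have "\<dots> = 0"
      unfolding trV_diff by (simp add: trV_commute[OF lform_dact[OF XY(1) lform_coord] lform_dact[OF XY(2) lform_coord]])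
    finally have 1: "trV (dact (X * Y - Y * X)) = 0" .
    have "trV (ad (X * Y - Y * X)) = trV (\<lambda>v. ad X (ad Y v) - ad Y (ad X v))"
      by (simp only: trV_def ad_bracket[OF XY])
    also have "\<dots> = 0"
      unfolding trV_diff by (simp add: trV_commute[OF ad_lform[OF XY(1)] ad_lform[OF XY(2)]])
    finally show ?thesis using 1 by (simp add: \<tau>_def)
  qed
  have "\<tau> X = 0" if "X \<in> span {x * y - y * x | x y. x \<in> lie \<and> y \<in> lie}" for X
    using that
  proof (induct rule: span_induct_alt)
    case base
    show ?case using \<tau>_lin(2)[of 0 0] by simp
  next
    case (step c x z)
    then show ?case using \<tau>_bracket by (auto simp: \<tau>_lin)
  qed
  then have "\<tau> (J v0) = 0" using lie_perfect[OF rad] J(1) by blast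
  moreover have "\<tau> (J v0) = of_nat (card B)"
  proof -
    have "dact (J v0) u - ad (J v0) u = u" for u
      unfolding ad_def dact_bracket[OF J(1) J(1)] J(2) by simp
    then have "trV (\<lambda>u. dact (J v0) u - ad (J v0) u) = of_nat (card B)"
      by (simp add: trV_def coord_basis)
    then show ?thesis by (simp add: \<tau>_def trV_diff)
  qed
  ultimately show ?thesis using V.finite_Basis by simp
qed

end

theorem corollary4p5:
  fixes G :: "(complex^'n^'n) set"
  assumes "semisimple_algebraic_group G"
    and "group_dim G > 0"
  shows "\<not> (\<exists>(s :: complex \<Rightarrow> 'v::ab_group_add \<Rightarrow> 'v) \<rho>. etale_representation s G \<rho>)"
proof
  assume "\<exists>(s :: complex \<Rightarrow> 'v \<Rightarrow> 'v) \<rho>. etale_representation s G \<rho>"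
  then obtain s :: "complex \<Rightarrow> 'v \<Rightarrow> 'v" and \<rho> where e: "etale_representation s G \<rho>" by blast
  then have rep: "rational_representation s G \<rho>" by (simp add: etale_representation_def)
  obtain v where v: "openin (zariski s) ((\<lambda>g. \<rho> g v) ` G)" using e by (auto simp: etale_representation_def)
  obtain B where B: "finite_dimensional_vector_space s B" using rep by (auto simp: rational_representation_def)
  have alg: "linear_algebraic_group G" and rad: "radical G = {mat 1}"
    using assms(1) by (simp_all add: semisimple_algebraic_group_def)
  interpret V: finite_dimensional_vector_space s B by (rule B)
  interpret rational_rep G s B \<rho>
    by unfold_locales (rule alg, rule rep)
  have "V.dim UNIV = card B" using V.dim_UNIV by (simp add: V.dimension_def)
  then have dim: "group_dim G = enat (card B)" using e by (simp add: etale_representation_def)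
  have "B = {}" by (rule no_etale[OF rad v dim])
  then show False using dim assms(2) by (simp add: zero_enat_def)
qed

end
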